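(* Let $p$ and the neighborhood $V$ of $0\in\mathbf{C}$ satisfy assumptions (A1)--(A3) and (A5) of the context, and assume in addition that $\{\mathrm{Re}\,p,\mathrm{Im}\,p\}\equiv 0$ on $\mathbf{R}^4$. Let $\omega$ be the spectral density function and $w$ the Weyl density of $p$ on $V$, as defined in the context. Then $w(z)=\omega(z)$ for all $z\in V$.
   Context: Write points of $\mathbf{R}^4=\mathbf{R}^2_x\times\mathbf{R}^2_\xi$ and $\mathbf{C}^4=\mathbf{C}^2_x\times\mathbf{C}^2_\xi$ as $\rho=(x,\xi)$. The function $p(x,\xi)$ is bounded and holomorphic in a tubular neighborhood of $\mathbf{R}^4$ in $\mathbf{C}^4$. $\{f,g\}=\sum_j(\partial_{\xi_j}f\,\partial_{x_j}g-\partial_{x_j}f\,\partial_{\xi_j}g)$ is the Poisson bracket. $L(dz)=d\,\mathrm{Re}\,z\,d\,\mathrm{Im}\,z$ is Lebesgue measure on $\mathbf{C}$. Assumptions: (A1) $\mathbf{R}^4\cap p^{-1}(0)$ is nonempty and connected. (A2) On $\mathbf{R}^4$, $|p(x,\xi)|\ge 1/C$ for $|(x,\xi)|\ge C$, for some $C>0$. (A3) $d\,\mathrm{Re}\,p(x,\xi)$ and $d\,\mathrm{Im}\,p(x,\xi)$ are linearly independent for all $(x,\xi)\in p^{-1}(0)\cap\mathbf{R}^4$. When $\{\mathrm{Re}\,p,\mathrm{Im}\,p\}\equiv0$, for $z$ in a neighborhood of $0$ the set $\Gamma(z)=p^{-1}(z)\cap\mathbf{R}^4$ is a real Lagrangian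 torus depending smoothly on $z$. Let $I_j(z)=\int_{\gamma_j(z)}\xi\cdot dx\in\mathbf{R}$, $j=1,2$, be the actions along two fundamental cycles $\gamma_1(z),\gamma_2(z)\subset\Gamma(z)$ (a basis of the first homology of the torus, chosen to depend continuously on $z$); these depend smoothly on $z$. (A5) $V$ is a (sufficiently small) neighborhood of $0$ in $\mathbf{C}$ on which the preceding objects are defined, and $z\mapsto I(z)=(I_1(z),I_2(z))$ is a diffeomorphism from $V$ onto $I(V)$. Spectral density $\omega$: the function $0<\omega\in C^\infty(V)$ defined by $dI_1(z)\wedge dI_2(z)=\pm\omega(z)\,d\,\mathrm{Re}\,z\wedge d\,\mathrm{Im}\,z$, with the sign chosen so that $\omega>0$. Weyl density $w$: the function on $V$ defined by $$\int f(z)w(z)\,L(dz)=\iint_{\mathbf{R}^4}f(p(x,\xi))\,dx\,d\xi,\qquad f\in C_0^\infty(V).$$ *)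

theory Defs
  imports "HOL-Analysis.Analysis" "HOL-Homology.Homology"
begin

type_synonym rphase = "(real^2) \<times> (real^2)"
type_synonym cphase = "(complex^2) \<times> (complex^2)"

subsection \<open>Smooth maps\<close>

text \<open>Meant for open \<open>S\<close>: derivatives are taken at points of \<open>S\<close> in the full space.\<close>

primrec ck_on :: "nat \<Rightarrow> 'a::real_normed_vector set \<Rightarrow> ('a \<Rightarrow> 'b::real_normed_vector) \<Rightarrow> bool" where
  "ck_on 0 S f \<longleftrightarrow> continuous_on S f"
| "ck_on (Suc k) S f \<longleftrightarrow>
     (\<forall>x\<in>S. f differentiable (at x)) \<and>
     (\<forall>v. ck_on k S (\<lambda>x. frechet_derivative f (at x) v))"

definition smooth_on :: "'a::real_normed_vector set \<Rightarrow> ('a \<Rightarrow> 'b::real_normed_vector) \<Rightarrow> bool" where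
  "smooth_on S f \<longleftrightarrow> (\<forall>k. ck_on k S f)"

definition diffeo_on ::
  "'a::real_normed_vector set \<Rightarrow> 'b::real_normed_vector set \<Rightarrow> ('a \<Rightarrow> 'b) \<Rightarrow> bool" where
  "diffeo_on V W F \<longleftrightarrow>
     open V \<and> open W \<and> smooth_on V F \<and> F ` V = W \<and>
     (\<exists>G. smooth_on W G \<and> (\<forall>x\<in>V. G (F x) = x))"

subsection \<open>The symbol on real and complex phase space\<close>

definition cplx :: "rphase \<Rightarrow> cphase" where
  "cplx \<rho> = ((\<chi> j. complex_of_real (fst \<rho> $ j)), (\<chi> j. complex_of_real (snd \<rho> $ j)))"

definition tube :: "real \<Rightarrow> cphase set" where
  "tube \<delta> = {\<zeta>. \<exists>\<rho>. dist \<zeta> (cplx \<rho>) < \<delta>}"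

definition holomorphic_phase :: "cphase set \<Rightarrow> (cphase \<Rightarrow> complex) \<Rightarrow> bool" where
  "holomorphic_phase S p \<longleftrightarrow>
     (\<forall>\<zeta>\<in>S. \<exists>D. (p has_derivative D) (at \<zeta>) \<and> (\<forall>c a b. D (c *s a, c *s b) = c * D (a, b)))"

definition level_set :: "(cphase \<Rightarrow> complex) \<Rightarrow> complex \<Rightarrow> rphase set" where
  "level_set p z = {\<rho>. p (cplx \<rho>) = z}"

definition re_symbol :: "(cphase \<Rightarrow> complex) \<Rightarrow> rphase \<Rightarrow> real" where
  "re_symbol p \<rho> = Re (p (cplx \<rho>))"

definition im_symbol :: "(cphase \<Rightarrow> complex) \<Rightarrow> rphase \<Rightarrow> real" where
  "im_symbol p \<rho> = Im (p (cplx \<rho>))"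

definition independent_covectors :: "('a \<Rightarrow> real) \<Rightarrow> ('a \<Rightarrow> real) \<Rightarrow> bool" where
  "independent_covectors \<alpha> \<beta> \<longleftrightarrow>
     (\<forall>a b. (\<forall>v. a * \<alpha> v + b * \<beta> v = 0) \<longrightarrow> a = 0 \<and> b = 0)"

definition d_x :: "2 \<Rightarrow> (rphase \<Rightarrow> real) \<Rightarrow> rphase \<Rightarrow> real" where
  "d_x j f \<rho> = frechet_derivative f (at \<rho>) (axis j 1, 0)"

definition d_xi :: "2 \<Rightarrow> (rphase \<Rightarrow> real) \<Rightarrow> rphase \<Rightarrow> real" where
  "d_xi j f \<rho> = frechet_derivative f (at \<rho>) (0, axis j 1)"

definition poisson :: "(rphase \<Rightarrow> real) \<Rightarrow> (rphase \<Rightarrow> real) \<Rightarrow> rphase \<Rightarrow> real" where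
  "poisson f g \<rho> = (\<Sum>j\<in>UNIV. d_xi j f \<rho> * d_x j g \<rho> - d_x j f \<rho> * d_xi j g \<rho>)"

subsection \<open>Smooth families of tori\<close>

text \<open>
  An embedding of the torus \<open>\<real>\<^sup>2 / \<int>\<^sup>2\<close> with image \<open>T\<close>, given as a periodic map on the
  universal cover.
\<close>

definition torus_embedding :: "(real^2 \<Rightarrow> rphase) \<Rightarrow> rphase set \<Rightarrow> bool" where
  "torus_embedding \<phi> T \<longleftrightarrow>
     smooth_on UNIV \<phi> \<and> range \<phi> = T \<and>
     (\<forall>s t. \<phi> s = \<phi> t \<longleftrightarrow> (\<forall>j. s $ j - t $ j \<in> \<int>)) \<and>
     (\<forall>t. inj (frechet_derivative \<phi> (at t)))"

text \<open>
  Smooth dependence on \<open>z\<close> is local triviality. For \<open>\<Gamma> = level_set p\<close> it is not required here that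
  the tori be Lagrangian: as \<open>p\<close> equals \<open>z\<close> on \<open>\<Gamma> z\<close>, smooth dependence makes the differentials of
  \<open>Re p\<close> and \<open>Im p\<close> independent along \<open>\<Gamma> z\<close>, so the Lagrangian property follows from the
  vanishing of their Poisson bracket.
\<close>

definition smooth_torus_family :: "complex set \<Rightarrow> (complex \<Rightarrow> rphase set) \<Rightarrow> bool" where
  "smooth_torus_family V \<Gamma> \<longleftrightarrow>
     (\<forall>z0\<in>V. \<exists>U \<Phi>. open U \<and> z0 \<in> U \<and> U \<subseteq> V \<and>
        smooth_on (U \<times> UNIV) (\<lambda>(z, t). \<Phi> z t) \<and>
        (\<forall>z\<in>U. torus_embedding (\<Phi> z) (\<Gamma> z)))"

subsection \<open>Fundamental cycles and actions\<close>

definition path_simplex :: "(real \<Rightarrow> 'a) \<Rightarrow> (nat \<Rightarrow> real) \<Rightarrow> 'a" where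
  "path_simplex g = restrict (\<lambda>s. g (s 1)) (standard_simplex 1)"

definition loop_class :: "'a::topological_space set \<Rightarrow> (real \<Rightarrow> 'a) \<Rightarrow> 'a chain set" where
  "loop_class T g = homologous_rel_set 1 (top_of_set T) {} (frag_of (path_simplex g))"

definition homology_basis ::
  "'a::topological_space set \<Rightarrow> (real \<Rightarrow> 'a) \<Rightarrow> (real \<Rightarrow> 'a) \<Rightarrow> bool" where
  "homology_basis T g h \<longleftrightarrow>
     (let H = homology_group 1 (top_of_set T) in
      bij_betw (\<lambda>(m::int, n::int). (loop_class T g [^]\<^bsub>H\<^esub> m) \<otimes>\<^bsub>H\<^esub> (loop_class T h [^]\<^bsub>H\<^esub> n))
        UNIV (carrier H))"

definition loop_family ::
  "complex set \<Rightarrow> (complex \<Rightarrow> rphase set) \<Rightarrow> (complex \<Rightarrow> real \<Rightarrow> rphase) \<Rightarrow> bool" where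
  "loop_family V \<Gamma> \<gamma> \<longleftrightarrow>
     continuous_on (V \<times> {0..1}) (\<lambda>(z, t). \<gamma> z t) \<and>
     (\<forall>z\<in>V. valid_path (\<gamma> z) \<and> pathfinish (\<gamma> z) = pathstart (\<gamma> z) \<and> path_image (\<gamma> z) \<subseteq> \<Gamma> z)"

definition fundamental_cycles ::
  "complex set \<Rightarrow> (complex \<Rightarrow> rphase set) \<Rightarrow>
   (complex \<Rightarrow> real \<Rightarrow> rphase) \<Rightarrow> (complex \<Rightarrow> real \<Rightarrow> rphase) \<Rightarrow> bool" where
  "fundamental_cycles V \<Gamma> \<gamma>1 \<gamma>2 \<longleftrightarrow>
     loop_family V \<Gamma> \<gamma>1 \<and> loop_family V \<Gamma> \<gamma>2 \<and>
     (\<forall>z\<in>V. homology_basis (\<Gamma> z) (\<gamma>1 z) (\<gamma>2 z))"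

definition action :: "(real \<Rightarrow> rphase) \<Rightarrow> real" where
  "action g =
     integral {0..1} (\<lambda>t. snd (g t) \<bullet> fst (vector_derivative g (at t within {0..1})))"

subsection \<open>Densities\<close>

definition wedge :: "('a \<Rightarrow> real) \<Rightarrow> ('a \<Rightarrow> real) \<Rightarrow> 'a \<Rightarrow> 'a \<Rightarrow> real" where
  "wedge \<alpha> \<beta> u v = \<alpha> u * \<beta> v - \<alpha> v * \<beta> u"

definition spectral_density ::
  "complex set \<Rightarrow> (complex \<Rightarrow> real) \<Rightarrow> (complex \<Rightarrow> real) \<Rightarrow> (complex \<Rightarrow> real) \<Rightarrow> bool" where
  "spectral_density V I1 I2 \<omega> \<longleftrightarrow>
     smooth_on V \<omega> \<and> (\<forall>z\<in>V. \<omega> z > 0) \<and>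
     (\<forall>z\<in>V. \<exists>\<sigma>\<in>{1, -1}. \<forall>u v.
        wedge (frechet_derivative I1 (at z)) (frechet_derivative I2 (at z)) u v
          = \<sigma> * \<omega> z * wedge Re Im u v)"

definition test_function :: "complex set \<Rightarrow> (complex \<Rightarrow> complex) \<Rightarrow> bool" where
  "test_function V f \<longleftrightarrow>
     smooth_on UNIV f \<and> compact (closure {z. f z \<noteq> 0}) \<and> closure {z. f z \<noteq> 0} \<subseteq> V"

text \<open>
  The integral identity fixes \<open>w\<close> only up to null sets; continuity selects the representative whose
  pointwise values are meaningful.
\<close>

definition weyl_density :: "complex set \<Rightarrow> (cphase \<Rightarrow> complex) \<Rightarrow> (complex \<Rightarrow> real) \<Rightarrow> bool" where
  "weyl_density V p w \<longleftrightarrow>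
     continuous_on V w \<and>
     (\<forall>f. test_function V f \<longrightarrow>
        (LINT z:V|lborel. f z * complex_of_real (w z)) = (LINT \<rho>|lborel. f (p (cplx \<rho>))))"

end

theory Submission
  imports Defs
begin

text \<open>
  Near a point of \<open>V\<close> the torus family gives coordinates \<open>\<rho> = \<Psi>(z, t)\<close> with \<open>p(\<rho>) = z\<close> and
  \<open>t \<in> \<real>\<^sup>2/\<int>\<^sup>2\<close>, so the Weyl density at \<open>z\<close> is the integral of \<open>\<bar>det d\<Psi>\<bar>\<close> over the torus. As the tori are
  Lagrangian, \<open>det d\<Psi>\<close> reduces to \<open>A\<^sub>1 B\<^sub>2 - A\<^sub>2 B\<^sub>1\<close>, where the one-forms \<open>A\<close> and \<open>B\<close> on the torus are
  the contractions of \<open>\<sigma> = d\<xi> \<and> dx\<close> with \<open>\<partial>\<Psi>/\<partial>Re z\<close> and \<open>\<partial>\<Psi>/\<partial>Im z\<close>. Both are closed, so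
  the integral of \<open>A \<and> B\<close> is the determinant of their periods, and these periods are the derivatives of the
  actions along the coordinate loops. The fundamental cycles differ from the coordinate loops by a
  locally constant integer matrix of determinant \<open>\<plusminus>1\<close>, read off from lifts to the covering
  \<open>\<Psi>\<close>; hence the determinant is \<open>\<plusminus>\<omega>(z)\<close>. Testing against smooth bumps gives equality at every point.
\<close>

section \<open>Directional derivatives and smoothness\<close>

text \<open>The overview leaves open why the absolute value costs nothing. The Weyl density
  integrates the modulus of the Jacobian, while the periods only see the integral of the signed
  Jacobian. The two agree up to one sign because \<Psi> is an immersion between spaces of equal
  dimension, so the Jacobian never vanishes, and the plane of angles is connected. The torus itself
  is handled through integer-periodic functions on the plane, and a period of a closed form becomes
  its mean over the unit square. A mean needs no base point, and it turns Stokes and Cartan's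
  formula into one fact: the derivative of a periodic function has mean zero. The given cycles are
  arbitrary generators of singular homology. They can be compared with the coordinate loops only by
  a functional on chains that kills boundaries; the increment of a lift to the angles is such a
  functional. Lifts require simply connected domains, which is why charts are taken over balls in
  \<open>z\<close>.\<close>

definition dir_deriv :: "'a::real_normed_vector \<Rightarrow> ('a \<Rightarrow> 'b::real_normed_vector) \<Rightarrow> 'a \<Rightarrow> 'b" where
  "dir_deriv v f x = frechet_derivative f (at x) v"

lemma smooth_on_has_derivative:
  assumes "smooth_on S f" "x \<in> S"
  shows "(f has_derivative (\<lambda>v. dir_deriv v f x)) (at x)"
proof -
  have "ck_on (Suc 0) S f" using assms(1) smooth_on_def by blast
  then have "f differentiable (at x)" using assms(2) by simp
  then show ?thesis unfolding dir_deriv_def using frechet_derivative_works by fastforce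
qed

lemma smooth_on_dir_deriv:
  assumes "smooth_on S f"
  shows "smooth_on S (dir_deriv v f)"
  unfolding smooth_on_def
proof
  fix k
  have "ck_on (Suc k) S f" using assms smooth_on_def by blast
  then show "ck_on k S (dir_deriv v f)" by (simp add: dir_deriv_def[abs_def])
qed

lemma smooth_on_continuous_on: "smooth_on S f \<Longrightarrow> continuous_on S f"
  unfolding smooth_on_def using ck_on.simps(1) by blast

lemma has_derivative_imp_dir_deriv:
  "(f has_derivative f') (at x) \<Longrightarrow> dir_deriv v f x = f' v"
  by (simp add: dir_deriv_def frechet_derivative_at[symmetric])

text \<open>A single function does not support an induction on the order, since its derivatives are
  other functions. The induction therefore runs over a whole family closed under directional
  derivatives.\<close>

lemma smooth_on_coinduct:
  assumes "f \<in> F"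
    and "\<And>f x. f \<in> F \<Longrightarrow> x \<in> S \<Longrightarrow> f differentiable (at x)"
    and "\<And>f v. f \<in> F \<Longrightarrow> dir_deriv v f \<in> F"
  shows "smooth_on S f"
proof -
  have "\<forall>f\<in>F. ck_on k S f" for k
  proof (induction k)
    case 0
    then show ?case
      by (auto intro!: continuous_at_imp_continuous_on differentiable_imp_continuous_within assms(2))
  next
    case (Suc k)
    then show ?case using assms(2,3) by (auto simp: dir_deriv_def[abs_def])
  qed
  then show ?thesis using assms(1) smooth_on_def by blast
qed

text \<open>Two applications of the mean value theorem: along \<open>u\<close> to the difference of
  \<open>g\<close> across \<open>v\<close>, then along \<open>v\<close> to the first derivative in
  direction \<open>u\<close>. The second difference is symmetric in \<open>u\<close> and
  \<open>v\<close>, which is what Schwarz's theorem exploits.\<close>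

lemma second_difference_mvt:
  fixes g :: "'a::real_normed_vector \<Rightarrow> real"
  assumes g: "\<And>y. y \<in> ball x r \<Longrightarrow> (g has_derivative g' y) (at y)"
    and k: "\<And>y. y \<in> ball x r \<Longrightarrow> ((\<lambda>y. g' y u) has_derivative k' y) (at y)"
    and h: "h > 0" "h * (norm u + norm v) < r"
  shows "\<exists>y\<in>ball x r. g (x + h *\<^sub>R u + h *\<^sub>R v) - g (x + h *\<^sub>R u) - g (x + h *\<^sub>R v) + g x
           = h * h * k' y v"
proof -
  have inb: "x + s *\<^sub>R u + t *\<^sub>R v \<in> ball x r" if "0 \<le> s" "s \<le> h" "0 \<le> t" "t \<le> h" for s t
  proof -
    have "dist x (x + s *\<^sub>R u + t *\<^sub>R v) = norm (s *\<^sub>R u + t *\<^sub>R v)"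
      by (metis add.assoc dist_add_cancel dist_0_norm add.right_neutral)
    also have "\<dots> \<le> s * norm u + t * norm v"
      using norm_triangle_ineq[of "s *\<^sub>R u" "t *\<^sub>R v"] that by simp
    also have "\<dots> \<le> h * norm u + h * norm v" using that by (intro add_mono mult_right_mono) auto
    finally show ?thesis using h by (simp add: algebra_simps)
  qed
  have d1: "((\<lambda>s. g (x + s *\<^sub>R u + t *\<^sub>R v)) has_real_derivative g' (x + s *\<^sub>R u + t *\<^sub>R v) u) (at s)"
    if "0 \<le> s" "s \<le> h" "0 \<le> t" "t \<le> h" for s t
  proof -
    have "((\<lambda>s. g (x + s *\<^sub>R u + t *\<^sub>R v)) has_derivative (\<lambda>d. g' (x + s *\<^sub>R u + t *\<^sub>R v) (d *\<^sub>R u))) (at s)"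
      by (rule has_derivative_compose[where f = "\<lambda>s. x + s *\<^sub>R u + t *\<^sub>R v", OF _ g[OF inb[OF that]]]) (auto intro!: derivative_eq_intros)
    moreover have "linear (g' (x + s *\<^sub>R u + t *\<^sub>R v))"
      using g[OF inb[OF that]] has_derivative_linear by blast
    ultimately show ?thesis
      by (simp add: has_field_derivative_def linear_cmul mult_commute_abs)
  qed
  have d2: "((\<lambda>t. g' (x + s *\<^sub>R u + t *\<^sub>R v) u) has_real_derivative k' (x + s *\<^sub>R u + t *\<^sub>R v) v) (at t)"
    if "0 \<le> s" "s \<le> h" "0 \<le> t" "t \<le> h" for s t
  proof -
    have "((\<lambda>t. g' (x + s *\<^sub>R u + t *\<^sub>R v) u) has_derivative (\<lambda>d. k' (x + s *\<^sub>R u + t *\<^sub>R v) (d *\<^sub>R v))) (at t)"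
      by (rule has_derivative_compose[where f = "\<lambda>t. x + s *\<^sub>R u + t *\<^sub>R v", OF _ k[OF inb[OF that]]]) (auto intro!: derivative_eq_intros)
    moreover have "linear (k' (x + s *\<^sub>R u + t *\<^sub>R v))"
      using k[OF inb[OF that]] has_derivative_linear by blast
    ultimately show ?thesis
      by (simp add: has_field_derivative_def linear_cmul mult_commute_abs)
  qed
  \<comment> \<open>The idle term \<open>0 *\<^sub>R v\<close> keeps both values in the form covered
    by \<open>d1\<close> and then by \<open>d2\<close>.\<close>
  let ?\<phi> = "\<lambda>s. g (x + s *\<^sub>R u + h *\<^sub>R v) - g (x + s *\<^sub>R u + 0 *\<^sub>R v)"
  have "\<exists>s. 0 < s \<and> s < h \<and> ?\<phi> h - ?\<phi> 0 =
     (h - 0) * (g' (x + s *\<^sub>R u + h *\<^sub>R v) u - g' (x + s *\<^sub>R u + 0 *\<^sub>R v) u)"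
    using h by (intro MVT2 derivative_intros d1) auto
  then obtain s where s: "0 < s" "s < h" and
    e1: "?\<phi> h - ?\<phi> 0 = h * (g' (x + s *\<^sub>R u + h *\<^sub>R v) u - g' (x + s *\<^sub>R u + 0 *\<^sub>R v) u)"
    by auto
  have "\<exists>t. 0 < t \<and> t < h \<and> g' (x + s *\<^sub>R u + h *\<^sub>R v) u - g' (x + s *\<^sub>R u + 0 *\<^sub>R v) u
     = (h - 0) * k' (x + s *\<^sub>R u + t *\<^sub>R v) v"
    using h s by (intro MVT2 d2) auto
  then obtain t where t: "0 < t" "t < h" and
    e2: "g' (x + s *\<^sub>R u + h *\<^sub>R v) u - g' (x + s *\<^sub>R u + 0 *\<^sub>R v) u = h * k' (x + s *\<^sub>R u + t *\<^sub>R v) v"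
    by auto
  show ?thesis
    using inb[of s t] s t e1 e2 by (intro bexI[of _ "x + s *\<^sub>R u + t *\<^sub>R v"]) auto
qed

text \<open>Schwarz's theorem: the symmetric second difference expresses both mixed derivatives, at
  two unrelated points near \<open>x\<close>, and continuity closes the gap.\<close>

lemma mixed_derivs_eq:
  fixes g :: "'a::real_normed_vector \<Rightarrow> real"
  assumes "open S" "x \<in> S"
    and g: "\<And>y. y \<in> S \<Longrightarrow> (g has_derivative g' y) (at y)"
    and k: "\<And>y. y \<in> S \<Longrightarrow> ((\<lambda>y. g' y u) has_derivative k' y) (at y)"
    and l: "\<And>y. y \<in> S \<Longrightarrow> ((\<lambda>y. g' y v) has_derivative l' y) (at y)"
    and ck: "continuous_on S (\<lambda>y. k' y v)" and cl: "continuous_on S (\<lambda>y. l' y u)"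
  shows "k' x v = l' x u"
proof (rule ccontr)
  \<comment> \<open>Half the supposed gap: the values at the two intermediate points coincide, so
    two errors below \<open>e\<close> would have to bridge it.\<close>
  define e where "e = \<bar>k' x v - l' x u\<bar> / 2"
  assume "k' x v \<noteq> l' x u"
  then have e: "e > 0" by (simp add: e_def)
  have "\<forall>\<^sub>F y in at x. dist (k' y v) (k' x v) < e"
    using ck assms(1,2) e by (simp add: continuous_on_eq_continuous_at isCont_def tendsto_iff)
  moreover have "\<forall>\<^sub>F y in at x. dist (l' y u) (l' x u) < e"
    using cl assms(1,2) e by (simp add: continuous_on_eq_continuous_at isCont_def tendsto_iff)
  moreover have "\<forall>\<^sub>F y in at x. y \<in> S"
    using assms(1,2) by (metis eventually_at_topological)
  ultimately have "\<forall>\<^sub>F y in at x. y \<in> S \<and> dist (k' y v) (k' x v) < e \<and> dist (l' y u) (l' x u) < e"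
    by eventually_elim auto
  then obtain r where r: "r > 0" and
    R: "\<And>y. y \<noteq> x \<Longrightarrow> dist y x < r \<Longrightarrow> y \<in> S \<and> dist (k' y v) (k' x v) < e \<and> dist (l' y u) (l' x u) < e"
    unfolding eventually_at by auto
  have R': "y \<in> S \<and> dist (k' y v) (k' x v) < e \<and> dist (l' y u) (l' x u) < e" if "y \<in> ball x r" for y
    using R[of y] that assms(2) e by (cases "y = x") (auto simp: dist_commute)
  \<comment> \<open>The summand 1 keeps \<open>N\<close> positive when both directions are
    zero.\<close>
  define N where "N = norm u + norm v + 1"
  define h where "h = r / 2 / N"
  have n: "N > 0" unfolding N_def by (smt (verit) norm_ge_zero)
  have h: "h > 0" using r n by (simp add: h_def)
  have "h * (norm u + norm v) \<le> h * N" using h by (simp add: N_def)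
  also have "\<dots> = r / 2" using n by (simp add: h_def)
  finally have hr: "h * (norm u + norm v) < r" using r by simp
  obtain y where y: "y \<in> ball x r"
    "g (x + h *\<^sub>R u + h *\<^sub>R v) - g (x + h *\<^sub>R u) - g (x + h *\<^sub>R v) + g x = h * h * k' y v"
    using second_difference_mvt[of x r g g' u k' h v] g k R' h hr by blast
  obtain z where z: "z \<in> ball x r"
    "g (x + h *\<^sub>R v + h *\<^sub>R u) - g (x + h *\<^sub>R v) - g (x + h *\<^sub>R u) + g x = h * h * l' z u"
    using second_difference_mvt[of x r g g' v l' h u] g l R' h hr by (metis add.commute)
  have "h * h * k' y v = h * h * l' z u"
    using y(2) z(2) by (simp add: algebra_simps)
  then have "k' y v = l' z u" using h by simp
  moreover have "\<bar>k' y v - k' x v\<bar> < e" "\<bar>l' z u - l' x u\<bar> < e"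
    using R'[OF y(1)] R'[OF z(1)] by (auto simp: dist_real_def)
  ultimately have "\<bar>k' x v - l' x u\<bar> < 2 * e" by linarith
  then show False by (simp add: e_def)
qed

text \<open>The mean value theorem needs real values, so both sides are tested against an arbitrary
  vector by the inner product.\<close>

lemma smooth_on_dir_deriv_commute:
  fixes f :: "'a::real_normed_vector \<Rightarrow> 'b::real_inner"
  assumes "open S" "smooth_on S f" "x \<in> S"
  shows "dir_deriv u (dir_deriv v f) x = dir_deriv v (dir_deriv u f) x"
proof -
  have "dir_deriv u (dir_deriv v f) x \<bullet> w = dir_deriv v (dir_deriv u f) x \<bullet> w" for w
  proof (rule mixed_derivs_eq[OF assms(1,3), where g = "\<lambda>x. f x \<bullet> w"
        and g' = "\<lambda>y d. dir_deriv d f y \<bullet> w" 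
        and k' = "\<lambda>y d. dir_deriv d (dir_deriv v f) y \<bullet> w" and u = v and v = u
        and l' = "\<lambda>y d. dir_deriv d (dir_deriv u f) y \<bullet> w"])
    show "continuous_on S (\<lambda>y. dir_deriv a (dir_deriv b f) y \<bullet> w)" for a b
      by (intro continuous_intros smooth_on_continuous_on smooth_on_dir_deriv assms)
    then show "continuous_on S (\<lambda>y. dir_deriv v (dir_deriv u f) y \<bullet> w)" .
  qed (auto intro!: has_derivative_inner_left smooth_on_has_derivative smooth_on_dir_deriv assms)
  then show ?thesis using vector_eq_rdot by blast
qed

section \<open>Smooth bump functions\<close>

text \<open>The classical flat function exp(-1/x), with a power of \<open>x\<close> in the
  denominator because differentiation produces such powers. The span of the family over all
  \<open>k\<close> is closed under differentiation.\<close>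

definition flat_exp :: "nat \<Rightarrow> real \<Rightarrow> real" where
  "flat_exp k x = (if x > 0 then exp (- 1 / x) / x ^ k else 0)"

lemma power_over_fact_le_exp:
  fixes y :: real
  assumes "y \<ge> 0"
  shows "y ^ n / fact n \<le> exp y"
proof -
  have "sum (\<lambda>i. inverse (fact i) *\<^sub>R y ^ i) {n} \<le> suminf (\<lambda>i. inverse (fact i) *\<^sub>R y ^ i)"
    using assms summable_exp_generic[of y] by (intro sum_le_suminf) auto
  then show ?thesis by (simp add: exp_def divide_inverse mult.commute)
qed

text \<open>One term of the exponential series at \<open>1 / x\<close> beats the denominator. The
  exponent \<open>k + 2\<close> leaves two powers of \<open>x\<close>, so one survives in the
  difference quotient at 0.\<close>

lemma flat_exp_bound: "\<bar>flat_exp k x\<bar> \<le> fact (k + 2) * x\<^sup>2"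
proof (cases "x > 0")
  case True
  have "(1 / x) ^ (k + 2) / fact (k + 2) \<le> exp (1 / x)"
    using True by (intro power_over_fact_le_exp) simp
  then have "exp (- (1 / x)) \<le> inverse ((1 / x) ^ (k + 2) / fact (k + 2))"
    unfolding exp_minus using True by (intro le_imp_inverse_le) auto
  also have "\<dots> = fact (k + 2) * x ^ (k + 2)"
    using True by (simp add: field_simps)
  finally have "exp (- (1 / x)) / x ^ k \<le> fact (k + 2) * x ^ (k + 2) / x ^ k"
    using True by (intro divide_right_mono) auto
  also have "\<dots> = fact (k + 2) * x\<^sup>2"
    using True by (simp add: power_add power2_eq_square)
  finally show ?thesis using True by (simp add: flat_exp_def)
qed (simp add: flat_exp_def)

lemma has_field_derivative_flat_exp:
  "(flat_exp k has_real_derivative flat_exp (k + 2) x - real k * flat_exp (k + 1) x) (at x)"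
proof -
  consider "x > 0" | "x < 0" | "x = 0" by linarith
  then show ?thesis
  proof cases
    case 1
    have "((\<lambda>x. exp (- 1 / x) / x ^ k) has_real_derivative flat_exp (k + 2) x - real k * flat_exp (k + 1) x) (at x)"
      using 1 unfolding flat_exp_def
      by (cases k) (auto intro!: derivative_eq_intros simp: field_simps power2_eq_square,
          (metis One_nat_def mult.commute neq0_conv power_minus_mult)?)
    then show ?thesis
      by (rule has_field_derivative_transform_within_open[where S = "{0<..}"])
        (use 1 in \<open>auto simp: flat_exp_def\<close>)
  next
    case 2
    have "((\<lambda>x. 0) has_real_derivative flat_exp (k + 2) x - real k * flat_exp (k + 1) x) (at x)"
      using 2 by (simp add: flat_exp_def)
    then show ?thesis
      by (rule has_field_derivative_transform_within_open[where S = "{..<0}"])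
        (use 2 in \<open>auto simp: flat_exp_def\<close>)
  next
    case 3
    have "(\<lambda>h. flat_exp k h / h) \<midarrow>0\<rightarrow> 0"
    proof (rule Lim_null_comparison)
      show "\<forall>\<^sub>F h in at 0. norm (flat_exp k h / h) \<le> fact (k + 2) * \<bar>h\<bar>"
      proof (intro always_eventually allI)
        fix h :: real
        show "norm (flat_exp k h / h) \<le> fact (k + 2) * \<bar>h\<bar>"
          using flat_exp_bound[of k h]
          by (cases "h = 0") (auto simp: divide_simps power2_eq_square abs_mult mult.assoc)
      qed
      show "(\<lambda>h. fact (k + 2) * \<bar>h\<bar>) \<midarrow>0\<rightarrow> (0::real)"
        by (auto intro!: tendsto_eq_intros)
    qed
    \<comment> \<open>At 0 the bound forces every member of the family to vanish, so the asserted
      derivative is 0 too.\<close>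
    then show ?thesis
      using 3 flat_exp_bound[of _ 0] by (simp add: DERIV_def)
  qed
qed

text \<open>The derivative-closed family that \<open>smooth_on_coinduct\<close> asks for, with the
  flat functions of r^2 - |z - c|^2 as its only generators that are not polynomials.\<close>

inductive_set bump_algebra :: "complex \<Rightarrow> real \<Rightarrow> (complex \<Rightarrow> real) set" for c r where
  bump_const: "(\<lambda>z. a) \<in> bump_algebra c r"
| bump_Re: "Re \<in> bump_algebra c r"
| bump_Im: "Im \<in> bump_algebra c r"
| bump_flat: "(\<lambda>z. flat_exp k (r\<^sup>2 - (Re z - Re c)\<^sup>2 - (Im z - Im c)\<^sup>2)) \<in> bump_algebra c r"
| bump_add: "f \<in> bump_algebra c r \<Longrightarrow> g \<in> bump_algebra c r \<Longrightarrow> (\<lambda>z. f z + g z) \<in> bump_algebra c r"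
| bump_mult: "f \<in> bump_algebra c r \<Longrightarrow> g \<in> bump_algebra c r \<Longrightarrow> (\<lambda>z. f z * g z) \<in> bump_algebra c r"

lemma bump_algebra_has_derivative:
  assumes "f \<in> bump_algebra c r"
  shows "\<exists>f'. (\<forall>z. (f has_derivative f' z) (at z)) \<and> (\<forall>v. (\<lambda>z. f' z v) \<in> bump_algebra c r)"
  using assms
proof induction
  case (bump_const a)
  then show ?case by (intro exI[of _ "\<lambda>z v. 0"]) (auto intro: bump_algebra.bump_const)
next
  case bump_Re
  then show ?case by (intro exI[of _ "\<lambda>z v. Re v"])
    (auto intro: bump_algebra.bump_const bounded_linear_imp_has_derivative bounded_linear_Re)
next
  case bump_Im
  then show ?case by (intro exI[of _ "\<lambda>z v. Im v"])
    (auto intro: bump_algebra.bump_const bounded_linear_imp_has_derivative bounded_linear_Im)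
next
  case (bump_flat k)
  let ?u = "\<lambda>z. r\<^sup>2 - (Re z - Re c)\<^sup>2 - (Im z - Im c)\<^sup>2"
  \<comment> \<open>Differences are spelled as sums with negated terms because the generating rules
    offer only sums and products.\<close>
  let ?D = "\<lambda>z v. (- 2 * Re v * (Re z + - Re c) + - 2 * Im v * (Im z + - Im c)) *
       (flat_exp (k + 2) (?u z) + - real k * flat_exp (k + 1) (?u z))"
  have "((\<lambda>z. flat_exp k (?u z)) has_derivative ?D z) (at z)" for z
  proof -
    have "(?u has_derivative (\<lambda>v. - 2 * Re v * (Re z - Re c) - 2 * Im v * (Im z - Im c))) (at z)"
      by (auto intro!: derivative_eq_intros simp: algebra_simps)
    from DERIV_compose_FDERIV[OF has_field_derivative_flat_exp this, of k]
    show ?thesis by (rule has_derivative_eq_rhs) (auto simp: fun_eq_iff algebra_simps)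
  qed
  moreover have "(\<lambda>z. ?D z v) \<in> bump_algebra c r" for v
    by (intro bump_algebra.intros)
  ultimately show ?case by (intro exI[of _ ?D]) blast
next
  case (bump_add f g)
  then obtain f' g' where "\<forall>z. (f has_derivative f' z) (at z)" "\<forall>v. (\<lambda>z. f' z v) \<in> bump_algebra c r"
    "\<forall>z. (g has_derivative g' z) (at z)" "\<forall>v. (\<lambda>z. g' z v) \<in> bump_algebra c r" by blast
  then show ?case
    by (intro exI[of _ "\<lambda>z v. f' z v + g' z v"]) (auto intro!: has_derivative_add bump_algebra.bump_add)
next
  case (bump_mult f g)
  then obtain f' g' where "\<forall>z. (f has_derivative f' z) (at z)" "\<forall>v. (\<lambda>z. f' z v) \<in> bump_algebra c r"
    "\<forall>z. (g has_derivative g' z) (at z)" "\<forall>v. (\<lambda>z. g' z v) \<in> bump_algebra c r" by blast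
  with bump_mult(1,2) show ?case
    by (intro exI[of _ "\<lambda>z v. f z * g' z v + f' z v * g z"])
      (auto intro!: has_derivative_mult bump_algebra.bump_add bump_algebra.bump_mult)
qed

definition bump :: "complex \<Rightarrow> real \<Rightarrow> complex \<Rightarrow> real" where
  "bump c r z = flat_exp 0 (r\<^sup>2 - (Re z - Re c)\<^sup>2 - (Im z - Im c)\<^sup>2)"

lemma bump_nonneg: "bump c r z \<ge> 0"
  by (simp add: bump_def flat_exp_def)

lemma bump_pos_iff:
  assumes "r > 0"
  shows "bump c r z > 0 \<longleftrightarrow> z \<in> ball c r"
proof -
  have "z \<in> ball c r \<longleftrightarrow> (dist c z)\<^sup>2 < r\<^sup>2"
    using assms power2_less_imp_less[of "dist c z" r] power_strict_mono[of "dist c z" r 2] by auto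
  also have "(dist c z)\<^sup>2 = (Re z - Re c)\<^sup>2 + (Im z - Im c)\<^sup>2"
    by (simp add: dist_norm cmod_power2 power2_commute)
  finally show ?thesis by (auto simp: bump_def flat_exp_def)
qed

lemma smooth_on_bump: "smooth_on UNIV (\<lambda>z. complex_of_real (bump c r z))"
proof (rule smooth_on_coinduct[where F = "(\<lambda>f z. complex_of_real (f z)) ` bump_algebra c r"])
  show "(\<lambda>z. complex_of_real (bump c r z)) \<in> (\<lambda>f z. complex_of_real (f z)) ` bump_algebra c r"
    by (intro image_eqI[where x = "bump c r"]) (auto simp: bump_def[abs_def] intro: bump_flat)
  fix f assume "f \<in> (\<lambda>f z. complex_of_real (f z)) ` bump_algebra c r"
  then obtain g where g: "g \<in> bump_algebra c r" "f = (\<lambda>z. complex_of_real (g z))" by blast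
  then obtain g' where g': "\<And>z. (g has_derivative g' z) (at z)" "\<And>v. (\<lambda>z. g' z v) \<in> bump_algebra c r"
    using bump_algebra_has_derivative by blast
  have d: "(f has_derivative (\<lambda>v. complex_of_real (g' z v))) (at z)" for z
    unfolding g(2) by (intro has_derivative_of_real g')
  show "f differentiable (at z)" for z using d differentiable_def by blast
  show "dir_deriv v f \<in> (\<lambda>f z. complex_of_real (f z)) ` bump_algebra c r" for v
    using has_derivative_imp_dir_deriv[OF d] g'(2)[of v]
    by (intro image_eqI[where x = "\<lambda>z. g' z v"]) auto
qed

lemma test_function_bump:
  assumes "r > 0" "cball c r \<subseteq> V"
  shows "test_function V (\<lambda>z. complex_of_real (bump c r z))"
proof -
  have "{z. complex_of_real (bump c r z) \<noteq> 0} = ball c r"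
    using bump_pos_iff[OF assms(1), of c] bump_nonneg[of c r]
    by (force simp del: mem_ball simp: less_le)
  then show ?thesis
    using assms smooth_on_bump by (simp add: test_function_def)
qed

lemma continuous_on_bump: "continuous_on S (bump c r)"
proof -
  have "continuous_on UNIV (\<lambda>z. Re (complex_of_real (bump c r z)))"
    by (intro continuous_intros smooth_on_continuous_on smooth_on_bump)
  then show ?thesis using continuous_on_subset by fastforce
qed

section \<open>Periodic closed forms on the plane\<close>

text \<open>Such a map only relabels coordinates and so preserves the side lengths of boxes. It
  identifies product types of equal dimension without a Jacobian factor.\<close>

lemma distr_lborel_Basis_bij:
  fixes L :: "'a::euclidean_space \<Rightarrow> 'b::euclidean_space"
  assumes L: "linear L" and bij: "bij_betw L Basis Basis"
  shows "distr lborel borel L = lborel"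
proof (rule lborel_eqI[symmetric])
  have [measurable]: "L \<in> borel_measurable borel"
    using L linear_continuous_on linear_conv_bounded_linear borel_measurable_continuous_onI by blast
  have inner: "L x \<bullet> L b = x \<bullet> b" if "b \<in> Basis" for x b
  proof -
    have "L x = (\<Sum>c\<in>Basis. (x \<bullet> c) *\<^sub>R L c)"
      by (subst euclidean_representation[of x, symmetric]) (simp add: linear_sum[OF L] linear_cmul[OF L])
    then have "L x \<bullet> L b = (\<Sum>c\<in>Basis. (x \<bullet> c) * (L c \<bullet> L b))"
      by (simp add: inner_sum_left)
    also have "\<dots> = (\<Sum>c\<in>Basis. if c = b then x \<bullet> c else 0)"
    proof (intro sum.cong refl)
      fix c :: 'a assume c: "c \<in> Basis"
      have "L c \<in> Basis" "L b \<in> Basis" "L c = L b \<longleftrightarrow> c = b"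
        using bij c that by (auto simp: bij_betw_def inj_on_def)
      then show "(x \<bullet> c) * (L c \<bullet> L b) = (if c = b then x \<bullet> c else 0)"
        by (simp add: inner_Basis)
    qed
    finally show ?thesis using that by simp
  qed
  fix l u :: 'b
  assume lu: "\<And>b. b \<in> Basis \<Longrightarrow> l \<bullet> b \<le> u \<bullet> b"
  define P where "P y = (\<Sum>b\<in>Basis. (y \<bullet> L b) *\<^sub>R b)" for y :: 'b
  have P: "P y \<bullet> b = y \<bullet> L b" if "b \<in> Basis" for y b
    using that by (simp add: P_def)
  have "x \<in> L -` box l u \<longleftrightarrow> x \<in> box (P l) (P u)" for x
  proof -
    have "x \<in> L -` box l u \<longleftrightarrow> (\<forall>b\<in>L ` Basis. l \<bullet> b < L x \<bullet> b \<and> L x \<bullet> b < u \<bullet> b)"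
      using bij by (simp add: mem_box bij_betw_def)
    also have "\<dots> \<longleftrightarrow> x \<in> box (P l) (P u)"
      by (simp add: mem_box inner P)
    finally show ?thesis .
  qed
  then have "L -` box l u = box (P l) (P u)" by blast
  moreover have "emeasure (distr lborel borel L) (box l u) = emeasure lborel (L -` box l u)"
    by (subst emeasure_distr) auto
  moreover have "P l \<bullet> b \<le> P u \<bullet> b" if "b \<in> Basis" for b
    using that P lu bij by (metis bij_betwE)
  ultimately have "emeasure (distr lborel borel L) (box l u) = (\<Prod>b\<in>Basis. (P u - P l) \<bullet> b)"
    by simp
  also have "(\<Prod>b\<in>Basis. (P u - P l) \<bullet> b) = (\<Prod>b\<in>Basis. (u - l) \<bullet> L b)"
    by (intro prod.cong) (auto simp: inner_diff_left P)
  also have "\<dots> = (\<Prod>b\<in>Basis. (u - l) \<bullet> b)"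
    by (rule prod.reindex_bij_betw[OF bij])
  finally show "emeasure (distr lborel borel L) (box l u) = (\<Prod>b\<in>Basis. (u - l) \<bullet> b)" .
qed simp

lemma set_integral_lborel_cbox:
  fixes g :: "'a::euclidean_space \<Rightarrow> real"
  assumes "continuous_on (cbox a b) g"
  shows "(LINT x|lborel. indicator (cbox a b) x * g x) = integral (cbox a b) g"
  using set_borel_integral_eq_integral(2)[of "cbox a b" g]
    borel_integrable_compact[OF compact_cbox assms]
  by (simp add: set_lebesgue_integral_def set_integrable_def)

text \<open>Fubini with coordinate \<open>k\<close> innermost: the inner integral is the difference
  of \<open>f\<close> at the ends of a unit segment, which periodicity cancels.\<close>

lemma integral_dir_deriv_periodic:
  fixes f :: "real^2 \<Rightarrow> real"
  assumes f: "\<And>x. (f has_derivative f' x) (at x)"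
    and cont: "continuous_on UNIV (\<lambda>x. f' x (axis k 1))"
    and per: "\<And>x. f (x + axis k 1) = f x"
  shows "integral (cbox 0 1) (\<lambda>x. f' x (axis k 1)) = 0"
proof -
  let ?g = "\<lambda>x. f' x (axis k 1)"
  \<comment> \<open>\<open>M\<close> puts its second argument into coordinate \<open>k\<close>, so
    that the inner integral runs in the direction of differentiation.\<close>
  define M :: "real \<times> real \<Rightarrow> real^2" where "M = (\<lambda>(t, s). \<chi> i. if i = k then s else t)"
  have linM: "linear M"
    by (auto intro!: linearI simp: M_def vec_eq_iff)
  have cM: "continuous_on S M" for S
    using linM linear_continuous_on linear_conv_bounded_linear by blast
  have [measurable]: "M \<in> borel_measurable borel"
    using cM borel_measurable_continuous_onI by blast
  have [measurable]: "?g \<in> borel_measurable borel"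
    using cont borel_measurable_continuous_onI by blast
  obtain l :: 2 where l: "l \<noteq> k" "UNIV = {k, l}"
  proof (cases "k = 1")
    case True
    then show ?thesis using that[of 2] UNIV_2 by auto
  next
    case False
    then have "k = 2" using exhaust_2 by blast
    then show ?thesis using that[of 1] UNIV_2 by (auto simp: insert_commute)
  qed
  have Ml: "M (1, 0) = axis l 1" "M (0, 1) = axis k 1"
    using l by (auto simp: M_def vec_eq_iff axis_def)
  have Basis2: "(Basis :: (real^2) set) = {axis l 1, axis k 1}"
    using l(2) by (auto simp: Basis_vec_def)
  have "bij_betw M Basis Basis"
    unfolding bij_betw_def using l
    by (auto simp: Basis_prod_def inj_on_def Ml Basis2 axis_eq_axis)
  note distr = distr_lborel_Basis_bij[OF linM this]
  have in_cbox: "M (t, s) \<in> cbox 0 1 \<longleftrightarrow> t \<in> {0..1} \<and> s \<in> {0..1}" for t s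
  proof -
    have "M (t, s) \<in> cbox 0 1 \<longleftrightarrow> (\<forall>i\<in>{k, l}. 0 \<le> M (t, s) $ i \<and> M (t, s) $ i \<le> 1)"
      unfolding l(2)[symmetric] by (simp add: mem_box_cart)
    then show ?thesis using l(1) by (auto simp: M_def)
  qed
  have inner: "(LINT s|lborel. indicator {0..1} s * ?g (M (t, s))) = 0" for t
  proof -
    have "((\<lambda>s. ?g (M (t, s))) has_integral (f (M (t, 1)) - f (M (t, 0)))) {0..1}"
    proof (rule fundamental_theorem_of_calculus)
      fix s :: real
      have "M = (\<lambda>p. fst p *\<^sub>R axis l 1 + snd p *\<^sub>R axis k 1)"
      proof
        fix p
        have "M p = M (fst p *\<^sub>R (1, 0) + snd p *\<^sub>R (0, 1))" by simp
        also have "\<dots> = fst p *\<^sub>R axis l 1 + snd p *\<^sub>R axis k 1"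
          by (simp only: linear_add[OF linM] linear_cmul[OF linM] Ml)
        finally show "M p = fst p *\<^sub>R axis l 1 + snd p *\<^sub>R axis k 1" .
      qed
      then have "((\<lambda>s. M (t, s)) has_derivative (\<lambda>h. h *\<^sub>R axis k 1)) (at s)"
        by (auto intro!: derivative_eq_intros)
      from has_derivative_compose[OF this f]
      have "((\<lambda>s. f (M (t, s))) has_derivative (\<lambda>h. f' (M (t, s)) (h *\<^sub>R axis k 1))) (at s)" .
      moreover have "linear (f' (M (t, s)))" using f has_derivative_linear by blast
      ultimately show "((\<lambda>s. f (M (t, s))) has_vector_derivative ?g (M (t, s))) (at s within {0..1})"
        by (simp add: has_vector_derivative_def linear_cmul has_derivative_at_withinI)
    qed simp
    moreover have "M (t, 1) = M (t, 0) + axis k 1"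
      by (auto simp: M_def vec_eq_iff axis_def)
    ultimately have "integral {0..1} (\<lambda>s. ?g (M (t, s))) = 0"
      by (metis per diff_self integral_unique)
    moreover have "continuous_on {0..1} (\<lambda>s. ?g (M (t, s)))"
      by (rule continuous_on_compose2[OF cont continuous_on_compose2[OF cM]])
        (auto intro!: continuous_intros)
    ultimately show ?thesis
      using set_integral_lborel_cbox[of 0 1 "\<lambda>s::real. ?g (M (t, s))"] by simp
  qed
  have int: "integrable lborel (\<lambda>x. indicator (cbox 0 1) x * ?g x)"
    using borel_integrable_compact[OF compact_cbox continuous_on_subset[OF cont], of 0 1] by simp
  have "integral (cbox 0 1) ?g = (LINT x|lborel. indicator (cbox 0 1) x * ?g x)"
    using set_integral_lborel_cbox[OF continuous_on_subset[OF cont]] by simp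
  also have "\<dots> = (LINT p|lborel. indicator (cbox 0 1) (M p) * ?g (M p))"
    by (subst distr[symmetric], subst integral_distr) auto
  also have "\<dots> = (LINT p|(lborel \<Otimes>\<^sub>M lborel). indicator (cbox 0 1) (M p) * ?g (M p))"
    by (simp add: lborel_prod)
  also have "\<dots> = (LINT t|lborel. LINT s|lborel. indicator (cbox 0 1) (M (t, s)) * ?g (M (t, s)))"
  proof (rule lborel_pair.integral_fst'[symmetric])
    have "integrable (distr lborel borel M) (\<lambda>x. indicator (cbox 0 1) x * ?g x)"
      using int distr by simp
    then show "integrable (lborel \<Otimes>\<^sub>M lborel) (\<lambda>p. indicator (cbox 0 1) (M p) * ?g (M p))"
      by (subst (asm) integrable_distr_eq) (auto simp: lborel_prod)
  qed
  also have "\<dots> = (LINT t|lborel. indicator {0..1::real} t * (LINT s|lborel. indicator {0..1} s * ?g (M (t, s))))"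
    by (simp only: integral_mult_right_zero[symmetric])
      (intro Bochner_Integration.integral_cong refl, simp add: indicator_def in_cbox)
  finally show ?thesis by (simp only: inner) simp
qed

text \<open>\<open>leibniz_rule\<close> wants a derivative continuous in operator norm, whereas
  \<open>ck_on\<close> speaks of one direction at a time. On a Euclidean space continuity on basis
  vectors is enough, hence the passage through \<open>Blinfun\<close>.\<close>

lemma integral_has_derivative:
  fixes f :: "'a::euclidean_space \<Rightarrow> 'b::euclidean_space \<Rightarrow> real"
  assumes "open U" "convex U" "x0 \<in> U"
    and f: "\<And>x t. x \<in> U \<Longrightarrow> t \<in> cbox a b \<Longrightarrow> ((\<lambda>x. f x t) has_derivative f' x t) (at x)"
    and cf: "\<And>x. x \<in> U \<Longrightarrow> continuous_on (cbox a b) (f x)"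
    and cf': "\<And>h. continuous_on (U \<times> cbox a b) (\<lambda>(x, t). f' x t h)"
  shows "((\<lambda>x. integral (cbox a b) (f x)) has_derivative (\<lambda>h. integral (cbox a b) (\<lambda>t. f' x0 t h))) (at x0)"
proof -
  define D where "D x t = Blinfun (f' x t)" for x t
  have D: "blinfun_apply (D x t) = f' x t" if "x \<in> U" "t \<in> cbox a b" for x t
    using f[OF that] unfolding D_def by (intro bounded_linear_Blinfun_apply has_derivative_bounded_linear)
  have cD: "continuous_on (U \<times> cbox a b) (\<lambda>(x, t). D x t)"
  proof (rule continuous_on_blinfun_componentwise)
    fix i :: 'a
    show "continuous_on (U \<times> cbox a b) (\<lambda>p. blinfun_apply (case p of (x, t) \<Rightarrow> D x t) i)"
      using cf'[of i] by (rule continuous_on_eq) (auto simp: D)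
  qed
  have der: "((\<lambda>x. integral (cbox a b) (f x)) has_derivative integral (cbox a b) (D x0)) (at x0 within U)"
  proof (rule leibniz_rule[OF _ _ cD assms(3,2)])
    fix x t assume "x \<in> U" "t \<in> cbox a b"
    then show "((\<lambda>x. f x t) has_derivative blinfun_apply (D x t)) (at x within U)"
      unfolding D[OF \<open>x \<in> U\<close> \<open>t \<in> cbox a b\<close>] by (rule has_derivative_at_withinI[OF f])
  next
    fix x assume "x \<in> U"
    then show "f x integrable_on cbox a b" by (intro integrable_continuous cf)
  qed
  have eq: "blinfun_apply (integral (cbox a b) (D x0)) h = integral (cbox a b) (\<lambda>t. f' x0 t h)" for h
  proof -
    have "continuous_on (cbox a b) (\<lambda>t. case (x0, t) of (x, t) \<Rightarrow> D x t)"
      by (rule continuous_on_compose2[OF cD]) (auto intro!: continuous_intros simp: assms(3))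
    then have "D x0 integrable_on cbox a b"
      by (intro integrable_continuous) simp
    then have "blinfun_apply (integral (cbox a b) (D x0)) h = integral (cbox a b) (\<lambda>t. blinfun_apply (D x0 t) h)"
      by (rule blinfun_apply_integral)
    also have "\<dots> = integral (cbox a b) (\<lambda>t. f' x0 t h)"
      by (intro Henstock_Kurzweil_Integration.integral_cong) (simp add: D assms(3))
    finally show ?thesis .
  qed
  have "blinfun_apply (integral (cbox a b) (D x0)) = (\<lambda>h. integral (cbox a b) (\<lambda>t. f' x0 t h))"
    using eq by (rule ext)
  then show ?thesis
    using der at_within_open[OF assms(3,1)] by simp
qed

text \<open>The derivative is carried as explicit data, so that closedness of a form can be stated
  on its formula.\<close>

definition C1_on :: "'a::real_normed_vector set \<Rightarrow> ('a \<Rightarrow> 'b::real_normed_vector) \<Rightarrow> ('a \<Rightarrow> 'a \<Rightarrow> 'b) \<Rightarrow> bool" where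
  "C1_on S f f' \<longleftrightarrow> (\<forall>x\<in>S. (f has_derivative f' x) (at x)) \<and> (\<forall>v. continuous_on S (\<lambda>x. f' x v))"

lemma C1_onI:
  assumes "\<And>x. x \<in> S \<Longrightarrow> (f has_derivative f' x) (at x)" "\<And>v. continuous_on S (\<lambda>x. f' x v)"
  shows "C1_on S f f'"
  using assms by (simp add: C1_on_def)

lemma C1_onD:
  assumes "C1_on S f f'"
  shows "x \<in> S \<Longrightarrow> (f has_derivative f' x) (at x)" "continuous_on S (\<lambda>x. f' x v)" "continuous_on S f"
  using assms unfolding C1_on_def
  by (auto intro: continuous_at_imp_continuous_on has_derivative_continuous)

lemma linear_real_2:
  fixes L :: "real^2 \<Rightarrow> 'b::real_vector"
  assumes "linear L"
  shows "L v = v $ 1 *\<^sub>R L (axis 1 1) + v $ 2 *\<^sub>R L (axis 2 1)"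
proof -
  have "v = v $ 1 *\<^sub>R axis 1 1 + v $ 2 *\<^sub>R axis 2 1"
    by (simp add: vec_eq_iff forall_2 axis_def)
  then show ?thesis using linear_add[OF assms] linear_cmul[OF assms] by metis
qed

lemma C1_on_mult:
  fixes f g :: "'a::real_normed_vector \<Rightarrow> real"
  assumes "C1_on S f f'" "C1_on S g g'"
  shows "C1_on S (\<lambda>x. f x * g x) (\<lambda>x h. f x * g' x h + f' x h * g x)"
  using assms C1_onD(3)[OF assms(1)] C1_onD(3)[OF assms(2)] unfolding C1_on_def
  by (auto intro!: has_derivative_mult continuous_intros)

lemma has_derivative_vec_nth:
  "((\<lambda>x. x $ i) has_derivative (\<lambda>h. h $ i)) F"
  by (rule bounded_linear_imp_has_derivative[OF bounded_linear_vec_nth])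

text \<open>Poincare lemma: the primitive integrates the form along the segment from the origin to
  \<open>x\<close>. Closedness turns the derivative of the integrand in direction \<open>h\<close>
  into a derivative in \<open>t\<close>, which can then be integrated.\<close>

lemma closed_form_primitive:
  fixes A1 A2 :: "real^2 \<Rightarrow> real"
  assumes A1: "C1_on UNIV A1 A1'" and A2: "C1_on UNIV A2 A2'"
    and closed: "\<And>x. A1' x (axis 2 1) = A2' x (axis 1 1)"
  obtains F where "C1_on UNIV F (\<lambda>x h. h $ 1 * A1 x + h $ 2 * A2 x)"
proof
  define f where "f x t = x $ 1 * A1 (t *\<^sub>R x) + x $ 2 * A2 (t *\<^sub>R x)" for x t
  define f' where "f' x t h = h $ 1 * A1 (t *\<^sub>R x) + x $ 1 * (t * A1' (t *\<^sub>R x) h)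
      + (h $ 2 * A2 (t *\<^sub>R x) + x $ 2 * (t * A2' (t *\<^sub>R x) h))" for x t h
  have comp: "continuous_on S (\<lambda>p. B (snd p *\<^sub>R fst p))" if "continuous_on UNIV B"
    for B :: "real^2 \<Rightarrow> real" and S
    by (rule continuous_on_compose2[OF that]) (auto intro!: continuous_intros)
  have comp2: "continuous_on S (\<lambda>t. B (t *\<^sub>R x))" if "continuous_on UNIV B"
    for B :: "real^2 \<Rightarrow> real" and S x
    by (rule continuous_on_compose2[OF that]) (auto intro!: continuous_intros)
  note conts = C1_onD(2,3)[OF A1] C1_onD(2,3)[OF A2]
  have scale: "((\<lambda>x. B (t *\<^sub>R x)) has_derivative (\<lambda>h. t * B' (t *\<^sub>R x) h)) (at x)"
    if B: "C1_on UNIV B B'" for B :: "real^2 \<Rightarrow> real" and B' t x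
  proof -
    have "((\<lambda>x. t *\<^sub>R x) has_derivative (\<lambda>h. t *\<^sub>R h)) (at x)"
      by (auto intro!: derivative_eq_intros)
    from has_derivative_compose[OF this, of B "B' (t *\<^sub>R x)"] C1_onD(1)[OF B]
    have "((\<lambda>x. B (t *\<^sub>R x)) has_derivative (\<lambda>h. B' (t *\<^sub>R x) (t *\<^sub>R h))) (at x)" by simp
    moreover have "linear (B' (t *\<^sub>R x))" using C1_onD(1)[OF B] has_derivative_linear by blast
    ultimately show ?thesis by (simp add: linear_cmul)
  qed
  have der: "((\<lambda>x. integral (cbox 0 1) (f x)) has_derivative (\<lambda>h. integral (cbox 0 1) (\<lambda>t. f' x t h))) (at x)" for x
  proof (rule integral_has_derivative[where U = UNIV])
    show "((\<lambda>x. f x t) has_derivative f' x t) (at x)" for x t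
      unfolding f_def
      by (rule has_derivative_eq_rhs, (rule derivative_intros scale[OF A1] scale[OF A2] has_derivative_vec_nth)+)
        (auto simp: f'_def algebra_simps)
    show "continuous_on (cbox 0 1) (f x)" for x
      unfolding f_def by (intro continuous_intros comp2 conts)
    show "continuous_on (UNIV \<times> cbox 0 1) (\<lambda>(x, t). f' x t h)" for h
      unfolding f'_def case_prod_unfold by (intro continuous_intros comp conts)
  qed auto
  have int: "integral (cbox 0 1) (\<lambda>t. f' x t h) = h $ 1 * A1 x + h $ 2 * A2 x" for x h
  proof -
    \<comment> \<open>The antiderivative in \<open>t\<close>: it vanishes at 0, and at 1 it is the
      form at \<open>x\<close> applied to \<open>h\<close>.\<close>
    let ?G = "\<lambda>t. t * (h $ 1 * A1 (t *\<^sub>R x) + h $ 2 * A2 (t *\<^sub>R x))"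
    have "((\<lambda>t. f' x t h) has_integral (?G 1 - ?G 0)) {0..1}"
    proof (rule fundamental_theorem_of_calculus)
      fix t :: real
      have line: "((\<lambda>t. B (t *\<^sub>R x)) has_real_derivative B' (t *\<^sub>R x) x) (at t)"
        if B: "C1_on UNIV B B'" for B B'
      proof -
        have "((\<lambda>t. t *\<^sub>R x) has_derivative (\<lambda>h. h *\<^sub>R x)) (at t)"
          by (auto intro!: derivative_eq_intros)
        from has_derivative_compose[OF this, of B "B' (t *\<^sub>R x)"] C1_onD(1)[OF B]
        have "((\<lambda>t. B (t *\<^sub>R x)) has_derivative (\<lambda>h. B' (t *\<^sub>R x) (h *\<^sub>R x))) (at t)" by simp
        moreover have "linear (B' (t *\<^sub>R x))" using C1_onD(1)[OF B] has_derivative_linear by blast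
        ultimately show ?thesis by (simp add: linear_cmul has_field_derivative_def mult_commute_abs)
      qed
      let ?L1 = "A1' (t *\<^sub>R x)" and ?L2 = "A2' (t *\<^sub>R x)"
      have "(?G has_real_derivative h $ 1 * A1 (t *\<^sub>R x) + h $ 2 * A2 (t *\<^sub>R x)
           + t * (h $ 1 * ?L1 x + h $ 2 * ?L2 x)) (at t)"
        by (auto intro!: derivative_eq_intros line[OF A1] line[OF A2])
      moreover have "linear ?L1" "linear ?L2"
        using C1_onD(1)[OF A1] C1_onD(1)[OF A2] has_derivative_linear by blast+
      then have eq: "h $ 1 * ?L1 x + h $ 2 * ?L2 x = x $ 1 * ?L1 h + x $ 2 * ?L2 h"
        using closed[of "t *\<^sub>R x"] linear_real_2[of ?L1 x] linear_real_2[of ?L2 x]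
          linear_real_2[of ?L1 h] linear_real_2[of ?L2 h]
        by (simp add: algebra_simps)
      moreover have "f' x t h = h $ 1 * A1 (t *\<^sub>R x) + h $ 2 * A2 (t *\<^sub>R x)
           + t * (x $ 1 * ?L1 h + x $ 2 * ?L2 h)"
        by (simp add: f'_def algebra_simps)
      ultimately have "(?G has_real_derivative f' x t h) (at t)"
        by (simp only: eq)
      then show "(?G has_vector_derivative f' x t h) (at t within {0..1})"
        using has_real_derivative_iff_has_vector_derivative has_vector_derivative_at_within by blast
    qed simp
    then show ?thesis by (simp add: integral_unique)
  qed
  show "C1_on UNIV (\<lambda>x. integral (cbox 0 1) (f x)) (\<lambda>x h. h $ 1 * A1 x + h $ 2 * A2 x)"
    using der unfolding int by (intro C1_onI continuous_intros conts) auto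
qed

definition int_vec :: "real^2 \<Rightarrow> bool" where
  "int_vec m \<longleftrightarrow> (\<forall>j. m $ j \<in> \<int>)"

lemma int_vec_axis: "int_vec (axis k 1)"
  by (auto simp: int_vec_def axis_def)

text \<open>By periodicity the increment of \<open>F\<close> across an integer vector does not
  depend on \<open>x\<close>, so it is additive and fixed by its values on the two axes. On an axis
  it is the mean of the form, since subtracting a suitable linear function makes \<open>F\<close>
  periodic in that direction.\<close>

lemma primitive_shift:
  fixes A1 A2 :: "real^2 \<Rightarrow> real"
  assumes F: "C1_on UNIV F (\<lambda>x h. h $ 1 * A1 x + h $ 2 * A2 x)"
    and A: "continuous_on UNIV A1" "continuous_on UNIV A2"
    and per: "\<And>x m. int_vec m \<Longrightarrow> A1 (x + m) = A1 x" "\<And>x m. int_vec m \<Longrightarrow> A2 (x + m) = A2 x"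
    and m: "int_vec m"
  shows "F (x + m) - F x = m $ 1 * integral (cbox 0 1) A1 + m $ 2 * integral (cbox 0 1) A2"
proof -
  define C where "C m = F m - F 0" for m
  have C: "F (x + m) - F x = C m" if m: "int_vec m" for x m
  proof -
    have "F (x + m) - F x = F (0 + m) - F 0"
    proof (rule has_derivative_zero_unique[OF convex_UNIV, where f = "\<lambda>x. F (x + m) - F x"])
      fix x
      have "((\<lambda>x. x + m) has_derivative (\<lambda>h. h)) (at x)" by (auto intro!: derivative_eq_intros)
      from has_derivative_compose[OF this C1_onD(1)[OF F]]
      have "((\<lambda>x. F (x + m)) has_derivative (\<lambda>h. h $ 1 * A1 x + h $ 2 * A2 x)) (at x)"
        using per m by simp
      from has_derivative_diff[OF this C1_onD(1)[OF F]]
      show "((\<lambda>x. F (x + m) - F x) has_derivative (\<lambda>h. 0)) (at x)" by simp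
    qed auto
    then show ?thesis by (simp add: C_def)
  qed
  have Cadd: "C (a + b) = C a + C b" if "int_vec a" "int_vec b" for a b
    using C[OF that(2), of a] by (simp add: C_def)
  have Cax: "C (axis k 1) = integral (cbox 0 1) (\<lambda>x. axis k 1 $ 1 * A1 x + axis k 1 $ 2 * A2 x)" for k
  proof -
    let ?f = "\<lambda>x. F x - x $ k * C (axis k 1)"
    have "(?f has_derivative (\<lambda>h. h $ 1 * A1 x + h $ 2 * A2 x - h $ k * C (axis k 1))) (at x)" for x
      by (rule has_derivative_eq_rhs, (rule derivative_intros C1_onD(1)[OF F] has_derivative_vec_nth UNIV_I)+) auto
    moreover have "?f (x + axis k 1) = ?f x" for x
      using C[OF int_vec_axis, of x k] by (simp add: algebra_simps)
    ultimately have "integral (cbox 0 1) (\<lambda>x. axis k 1 $ 1 * A1 x + axis k 1 $ 2 * A2 x - axis k 1 $ k * C (axis k 1)) = 0"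
      using A by (intro integral_dir_deriv_periodic[where f = ?f
            and f' = "\<lambda>x h. h $ 1 * A1 x + h $ 2 * A2 x - h $ k * C (axis k 1)"])
        (auto intro!: continuous_intros)
    moreover have "(\<lambda>x. axis k 1 $ 1 * A1 x + axis k 1 $ 2 * A2 x) integrable_on cbox 0 1"
      by (intro integrable_continuous continuous_intros continuous_on_subset[OF A(1)]
          continuous_on_subset[OF A(2)]) auto
    ultimately have "integral (cbox 0 1) (\<lambda>x. axis k 1 $ 1 * A1 x + axis k 1 $ 2 * A2 x)
       = integral (cbox (0::real^2) 1) (\<lambda>x. C (axis k 1))"
      by (subst (asm) Henstock_Kurzweil_Integration.integral_diff) auto
    also have "\<dots> = C (axis k 1)"
      using content_cbox_cart[of "0::real^2" 1] by (simp add: interval_ne_empty_cart)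
    finally show ?thesis by simp
  qed
  have C1: "C (axis 1 1) = integral (cbox 0 1) A1" and C2: "C (axis 2 1) = integral (cbox 0 1) A2"
    using Cax[of 1] Cax[of 2] by (simp_all add: axis_def)
  obtain p q :: int where pq: "m $ 1 = of_int p" "m $ 2 = of_int q"
    using m unfolding int_vec_def by (metis Ints_cases)
  have Cmult: "C (of_int n *\<^sub>R axis k 1) = of_int n * C (axis k 1)" for n k
  proof (induction n rule: int_induct[where k = 0])
    case (step1 i)
    have "C (of_int i *\<^sub>R axis k 1 + axis k 1) = C (of_int i *\<^sub>R axis k 1) + C (axis k 1)"
      by (intro Cadd) (auto simp: int_vec_def axis_def)
    then show ?case using step1 by (simp add: algebra_simps)
  next
    case (step2 i)
    have "C (of_int (i - 1) *\<^sub>R axis k 1 + axis k 1) = C (of_int (i - 1) *\<^sub>R axis k 1) + C (axis k 1)"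
      by (intro Cadd) (auto simp: int_vec_def axis_def)
    then show ?case using step2 by (simp add: algebra_simps)
  qed (simp add: C_def)
  have "m = of_int p *\<^sub>R axis 1 1 + of_int q *\<^sub>R axis 2 1"
    using pq by (simp add: vec_eq_iff forall_2 axis_def)
  then have "C m = of_int p * C (axis 1 1) + of_int q * C (axis 2 1)"
    using Cadd[of "of_int p *\<^sub>R axis 1 1" "of_int q *\<^sub>R axis 2 1"] Cmult
    by (auto simp: int_vec_def axis_def)
  then show ?thesis using C[OF m] pq C1 C2 by simp
qed

lemma axis_nth_2 [simp]:
  "axis 1 (a::real) $ (1::2) = a" "axis 1 (a::real) $ (2::2) = 0"
  "axis 2 (a::real) $ (1::2) = 0" "axis 2 (a::real) $ (2::2) = a"
  by (simp_all add: axis_def)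

text \<open>Subtracting the averages from the first form leaves the differential of a periodic function
  \<open>g\<close>, and \<open>dg \<and> B = d(g B)\<close> integrates to zero.\<close>

lemma integral_wedge_closed_forms:
  fixes A1 A2 B1 B2 :: "real^2 \<Rightarrow> real"
  assumes A1: "C1_on UNIV A1 A1'" and A2: "C1_on UNIV A2 A2'"
    and B1: "C1_on UNIV B1 B1'" and B2: "C1_on UNIV B2 B2'"
    and closedA: "\<And>x. A1' x (axis 2 1) = A2' x (axis 1 1)"
    and closedB: "\<And>x. B1' x (axis 2 1) = B2' x (axis 1 1)"
    and perA: "\<And>x m. int_vec m \<Longrightarrow> A1 (x + m) = A1 x" "\<And>x m. int_vec m \<Longrightarrow> A2 (x + m) = A2 x"
    and perB: "\<And>x m. int_vec m \<Longrightarrow> B1 (x + m) = B1 x" "\<And>x m. int_vec m \<Longrightarrow> B2 (x + m) = B2 x"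
  shows "integral (cbox 0 1) (\<lambda>x. A1 x * B2 x - A2 x * B1 x) =
    integral (cbox 0 1) A1 * integral (cbox 0 1) B2 - integral (cbox 0 1) A2 * integral (cbox 0 1) B1"
proof -
  define a1 a2 where "a1 = integral (cbox 0 1) A1" and "a2 = integral (cbox 0 1) A2"
  note conts = C1_onD(2,3)[OF A1] C1_onD(2,3)[OF A2] C1_onD(2,3)[OF B1] C1_onD(2,3)[OF B2]
  obtain F where F: "C1_on UNIV F (\<lambda>x h. h $ 1 * A1 x + h $ 2 * A2 x)"
    using closed_form_primitive[OF A1 A2 closedA] by blast
  define g where "g x = F x - (x $ 1 * a1 + x $ 2 * a2)" for x
  have g: "C1_on UNIV g (\<lambda>x h. h $ 1 * (A1 x - a1) + h $ 2 * (A2 x - a2))"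
  proof (rule C1_onI)
    show "(g has_derivative (\<lambda>h. h $ 1 * (A1 x - a1) + h $ 2 * (A2 x - a2))) (at x)" for x
      unfolding g_def
      by (rule has_derivative_eq_rhs, (rule derivative_intros C1_onD(1)[OF F] has_derivative_vec_nth UNIV_I)+)
        (auto simp: algebra_simps)
  qed (intro continuous_intros conts)
  have gper: "g (x + axis k 1) = g x" for x k
    using primitive_shift[OF F conts(2,4) perA int_vec_axis, of x k]
    by (simp add: g_def a1_def a2_def algebra_simps)
  have "integral (cbox 0 1) (\<lambda>x. g x * B2' x (axis 1 1) + (A1 x - a1) * B2 x) = 0"
    using integral_dir_deriv_periodic[OF C1_onD(1)[OF C1_on_mult[OF g B2] UNIV_I]
        C1_onD(2)[OF C1_on_mult[OF g B2]], of 1] gper perB(2)[OF int_vec_axis]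
    by (simp add: axis_nth_2)
  moreover have "integral (cbox 0 1) (\<lambda>x. g x * B1' x (axis 2 1) + (A2 x - a2) * B1 x) = 0"
    using integral_dir_deriv_periodic[OF C1_onD(1)[OF C1_on_mult[OF g B1] UNIV_I]
        C1_onD(2)[OF C1_on_mult[OF g B1]], of 2] gper perB(1)[OF int_vec_axis]
    by (simp add: axis_nth_2)
  moreover have ib: "f integrable_on cbox 0 1" if "continuous_on UNIV f" for f :: "real^2 \<Rightarrow> real"
    using that continuous_on_subset by (intro integrable_continuous) blast
  note gcont = C1_onD(3)[OF g]
  ultimately have "integral (cbox 0 1) (\<lambda>x. (g x * B2' x (axis 1 1) + (A1 x - a1) * B2 x)
       - (g x * B1' x (axis 2 1) + (A2 x - a2) * B1 x)) = 0"
    by (subst Henstock_Kurzweil_Integration.integral_diff) (auto intro!: ib continuous_intros conts gcont)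
  also have "(\<lambda>x. (g x * B2' x (axis 1 1) + (A1 x - a1) * B2 x)
       - (g x * B1' x (axis 2 1) + (A2 x - a2) * B1 x)) =
     (\<lambda>x. (A1 x * B2 x - A2 x * B1 x) - (a1 * B2 x - a2 * B1 x))"
    by (simp add: fun_eq_iff closedB algebra_simps)
  finally have "integral (cbox 0 1) (\<lambda>x. A1 x * B2 x - A2 x * B1 x)
      = integral (cbox 0 1) (\<lambda>x. a1 * B2 x - a2 * B1 x)"
    by (subst (asm) Henstock_Kurzweil_Integration.integral_diff) (auto intro!: ib continuous_intros conts)
  also have "\<dots> = a1 * integral (cbox 0 1) B2 - a2 * integral (cbox 0 1) B1"
    by (subst Henstock_Kurzweil_Integration.integral_diff) (auto intro!: ib continuous_intros conts)
  finally show ?thesis by (simp add: a1_def a2_def)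
qed

section \<open>The torus family as a covering\<close>

lemma int_vec_0: "int_vec 0"
  and int_vec_diff: "int_vec a \<Longrightarrow> int_vec b \<Longrightarrow> int_vec (a - b)"
  by (auto simp: int_vec_def)

lemma int_vec_eq_0:
  assumes "int_vec m" "\<And>j. \<bar>m $ j\<bar> < 1"
  shows "m = 0"
  using assms Ints_nonzero_abs_less1 by (fastforce simp: int_vec_def vec_eq_iff)

text \<open>Distinct integers are at distance at least 1, so each component has discrete range on a
  connected set.\<close>

lemma int_vec_continuous_const:
  assumes "connected S" "continuous_on S f" "\<And>x. x \<in> S \<Longrightarrow> int_vec (f x)" "x \<in> S" "y \<in> S"
  shows "f x = f y"
proof -
  have "(\<lambda>x. f x $ j) constant_on S" for j
  proof (rule continuous_discrete_range_constant[OF assms(1)])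
    show "continuous_on S (\<lambda>x. f x $ j)" by (intro continuous_intros assms)
    fix x assume x: "x \<in> S"
    show "\<exists>e>0. \<forall>y. y \<in> S \<and> f y $ j \<noteq> f x $ j \<longrightarrow> e \<le> norm (f y $ j - f x $ j)"
    proof (intro exI[of _ 1] conjI allI impI)
      fix y assume y: "y \<in> S \<and> f y $ j \<noteq> f x $ j"
      then have "f y $ j - f x $ j \<in> \<int>" using assms(3) x unfolding int_vec_def by simp
      then show "1 \<le> norm (f y $ j - f x $ j)"
        using Ints_nonzero_abs_ge1[of "f y $ j - f x $ j"] y by simp
    qed simp
  qed
  then show ?thesis using assms(4,5) unfolding constant_on_def vec_eq_iff by metis
qed

text \<open>\<open>q\<close> stands for the symbol on real phase space. The base is a ball so that
  it and its product with an interval are convex; lifts over them then exist without monodromy in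
  \<open>z\<close>.\<close>

locale torus_chart =
  fixes q :: "rphase \<Rightarrow> complex" and q' :: "rphase \<Rightarrow> rphase \<Rightarrow> complex"
    and \<Psi> :: "complex \<times> (real^2) \<Rightarrow> rphase" and z0 :: complex and r :: real
  assumes r_pos: "r > 0"
    and q_deriv: "\<And>\<rho>. (q has_derivative q' \<rho>) (at \<rho>)"
    and smooth: "smooth_on (ball z0 r \<times> UNIV) \<Psi>"
    and torus: "\<And>z. z \<in> ball z0 r \<Longrightarrow> torus_embedding (\<lambda>t. \<Psi> (z, t)) {\<rho>. q \<rho> = z}"
begin

lemma q_\<Psi>: "z \<in> ball z0 r \<Longrightarrow> q (\<Psi> (z, t)) = z"
  using torus[of z] unfolding torus_embedding_def by blast

lemma \<Psi>_eq_iff: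
  assumes "z \<in> ball z0 r" "z' \<in> ball z0 r"
  shows "\<Psi> (z, s) = \<Psi> (z', t) \<longleftrightarrow> z = z' \<and> int_vec (s - t)"
proof -
  have "\<Psi> (z, s) = \<Psi> (z', t) \<Longrightarrow> z = z'" using q_\<Psi> assms by metis
  then show ?thesis
    using torus[OF assms(1)] unfolding torus_embedding_def int_vec_def by auto
qed

lemma \<Psi>_surj: "q \<rho> \<in> ball z0 r \<Longrightarrow> \<exists>t. \<Psi> (q \<rho>, t) = \<rho>"
  using torus[of "q \<rho>"] unfolding torus_embedding_def by (metis (mono_tags) image_iff mem_Collect_eq)

lemma \<Psi>_has_derivative:
  "z \<in> ball z0 r \<Longrightarrow> (\<Psi> has_derivative (\<lambda>v. dir_deriv v \<Psi> (z, t))) (at (z, t))"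
  using smooth_on_has_derivative[OF smooth] by simp

lemma linear_dir_deriv: "z \<in> ball z0 r \<Longrightarrow> linear (\<lambda>v. dir_deriv v \<Psi> (z, t))"
  using \<Psi>_has_derivative has_derivative_linear by blast

lemma q'_dir_deriv:
  assumes "z \<in> ball z0 r"
  shows "q' (\<Psi> (z, t)) (dir_deriv v \<Psi> (z, t)) = fst v"
proof -
  have "((\<lambda>x. q (\<Psi> x)) has_derivative (\<lambda>v. q' (\<Psi> (z, t)) (dir_deriv v \<Psi> (z, t)))) (at (z, t))"
    using has_derivative_compose[OF \<Psi>_has_derivative[OF assms] q_deriv] .
  moreover have "((\<lambda>x. q (\<Psi> x)) has_derivative fst) (at (z, t))"
  proof (rule has_derivative_transform_within_open[of fst fst _ _ "ball z0 r \<times> UNIV"])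
    show "\<And>x. x \<in> ball z0 r \<times> UNIV \<Longrightarrow> fst x = q (\<Psi> x)"
      using q_\<Psi> by force
  qed (use assms in \<open>auto intro!: open_Times bounded_linear_imp_has_derivative bounded_linear_fst\<close>)
  ultimately have "(\<lambda>v. q' (\<Psi> (z, t)) (dir_deriv v \<Psi> (z, t))) = fst"
    by (rule has_derivative_unique)
  then show ?thesis by (rule fun_cong)
qed

text \<open>Differentiating q(\<Psi>(z, t)) = z removes the \<open>z\<close>-component of a kernel
  vector, and the immersion property of the torus removes the rest. As dimensions agree, \<Psi> is a
  local diffeomorphism.\<close>

lemma dir_deriv_eq_0:
  assumes z: "z \<in> ball z0 r" and "dir_deriv v \<Psi> (z, t) = 0"
  shows "v = 0"
proof -
  have fst: "fst v = 0"
    using q'_dir_deriv[OF z, of t v] assms(2) has_derivative_linear[OF q_deriv]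
    by (simp add: linear_0)
  have "((\<lambda>t. \<Psi> (z, t)) has_derivative (\<lambda>w. dir_deriv (0, w) \<Psi> (z, t))) (at t)"
    by (rule has_derivative_compose[where f = "\<lambda>t. (z, t)", OF _ \<Psi>_has_derivative[OF z]]) (auto intro!: derivative_eq_intros)
  then have "frechet_derivative (\<lambda>t. \<Psi> (z, t)) (at t) = (\<lambda>w. dir_deriv (0, w) \<Psi> (z, t))"
    by (simp add: frechet_derivative_at[symmetric])
  then have "inj (\<lambda>w. dir_deriv (0, w) \<Psi> (z, t))"
    using torus[OF z] unfolding torus_embedding_def by metis
  moreover have "dir_deriv (0, snd v) \<Psi> (z, t) = dir_deriv (0, 0) \<Psi> (z, t)"
    using assms(2) fst linear_0[OF linear_dir_deriv[OF z, of t]] by (simp add: zero_prod_def[symmetric]) (metis prod.collapse)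
  ultimately have "snd v = 0" by (meson injD)
  then show ?thesis using fst by (simp add: prod_eq_iff)
qed

text \<open>The image of the ball times a unit box is evenly covered, with the integer translates as
  sheets. Invariance of domain gives openness and continuous local inverses, both sides having real
  dimension 4.\<close>

lemma covering: "covering_space (ball z0 r \<times> UNIV) \<Psi> (q -` ball z0 r)"
proof -
  \<comment> \<open>Half-width 1/2 and openness: two points of one box never differ by a nonzero
    integer vector, which yields injectivity on a sheet and disjointness of the sheets.\<close>
  let ?h = "(\<chi> j. 1/2) :: real^2"
  let ?u = "\<lambda>c. ball z0 r \<times> box (c - ?h) (c + ?h)"
  have cont: "continuous_on S \<Psi>" if "S \<subseteq> ball z0 r \<times> UNIV" for S
    using smooth_on_continuous_on[OF smooth] continuous_on_subset that by blast
  have mem: "t \<in> box (c - ?h) (c + ?h) \<longleftrightarrow> (\<forall>j. \<bar>t $ j - c $ j\<bar> < 1/2)" for t c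
    unfolding mem_box_cart abs_diff_less_iff by (auto simp: algebra_simps)
  have inj: "inj_on \<Psi> (?u c)" for c
  proof (rule inj_onI, clarsimp simp del: mem_ball)
    fix z s z' t assume *: "z \<in> ball z0 r" "z' \<in> ball z0 r" "\<Psi> (z, s) = \<Psi> (z', t)"
      "s \<in> box (c - ?h) (c + ?h)" "t \<in> box (c - ?h) (c + ?h)"
    then have "int_vec (s - t)" "z = z'" using \<Psi>_eq_iff by auto
    moreover have "\<bar>(s - t) $ j\<bar> < 1" for j
      using *(4)[unfolded mem, rule_format, of j] *(5)[unfolded mem, rule_format, of j] by (simp add: abs_if split: if_splits)
    ultimately show "z = z' \<and> s = t" using int_vec_eq_0[of "s - t"] by simp
  qed
  have dims: "DIM(rphase) \<le> DIM(complex \<times> (real^2))" by simp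
  have shift: "\<Psi> ` ?u (c + m) = \<Psi> ` ?u c" if m: "int_vec m" for c m
  proof -
    have *: "\<Psi> ` ?u (c + m) \<subseteq> \<Psi> ` ?u c" if m: "int_vec m" for c m
    proof
      fix y assume "y \<in> \<Psi> ` ?u (c + m)"
      then obtain z t where y: "y = \<Psi> (z, t)" and z: "z \<in> ball z0 r"
        and t: "t \<in> box (c + m - ?h) (c + m + ?h)" by blast
      have "t - m \<in> box (c - ?h) (c + ?h)" using t unfolding mem by (simp add: algebra_simps)
      moreover have "\<Psi> (z, t) = \<Psi> (z, t - m)" using \<Psi>_eq_iff[OF z z] m by simp
      ultimately show "y \<in> \<Psi> ` ?u c" using z y by blast
    qed
    have "int_vec (- m)" using int_vec_diff[OF int_vec_0 m] by simp
    from *[OF m, of c] *[OF this, of "c + m"] show ?thesis by auto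
  qed
  show ?thesis
  proof (rule covering_spaceI)
    show "continuous_on (ball z0 r \<times> UNIV) \<Psi>" using cont by blast
    show "\<Psi> ` (ball z0 r \<times> UNIV) = q -` ball z0 r"
    proof (intro equalityI subsetI)
      fix \<rho> assume "\<rho> \<in> q -` ball z0 r"
      then show "\<rho> \<in> \<Psi> ` (ball z0 r \<times> UNIV)" using \<Psi>_surj[of \<rho>] by (metis SigmaI UNIV_I image_eqI vimageE)
    qed (use q_\<Psi> in force)
    fix \<rho> assume "\<rho> \<in> q -` ball z0 r"
    then have q\<rho>: "q \<rho> \<in> ball z0 r" by blast
    then obtain c where c: "\<Psi> (q \<rho>, c) = \<rho>" using \<Psi>_surj by blast
    let ?T = "\<Psi> ` ?u c"
    have "\<rho> \<in> ?T"
      using q\<rho> c by (intro image_eqI[of _ _ "(q \<rho>, c)"]) (auto simp: mem simp del: mem_ball)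
    moreover have "openin (top_of_set (q -` ball z0 r)) ?T"
    proof (rule open_subset)
      show "?T \<subseteq> q -` ball z0 r" using q_\<Psi> by force
      show "open ?T"
        by (rule invariance_of_domain_gen[OF _ cont inj dims]) (auto intro!: open_Times)
    qed
    moreover have "\<exists>v. \<Union>v = ball z0 r \<times> UNIV \<inter> \<Psi> -` ?T \<and>
         (\<forall>u\<in>v. openin (top_of_set (ball z0 r \<times> UNIV)) u) \<and> pairwise disjnt v \<and>
         (\<forall>u\<in>v. \<exists>q. homeomorphism u ?T \<Psi> q)"
    proof (rule exI[of _ "(\<lambda>m. ?u (c + m)) ` Collect int_vec"], intro conjI ballI)
      let ?v = "(\<lambda>m. ?u (c + m)) ` Collect int_vec"
      show "\<Union>?v = ball z0 r \<times> UNIV \<inter> \<Psi> -` ?T"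
      proof (intro equalityI subsetI)
        fix x assume "x \<in> \<Union>?v"
        then obtain m where m: "int_vec m" "x \<in> ?u (c + m)" by blast
        then have "\<Psi> x \<in> ?T" using shift[OF m(1), of c] by blast
        then show "x \<in> ball z0 r \<times> UNIV \<inter> \<Psi> -` ?T" using m(2) by auto
      next
        fix x assume x: "x \<in> ball z0 r \<times> UNIV \<inter> \<Psi> -` ?T"
        obtain z s where xz: "x = (z, s)" by fastforce
        from x xz obtain z' t where *: "z \<in> ball z0 r" "\<Psi> (z, s) = \<Psi> (z', t)" "z' \<in> ball z0 r"
          "t \<in> box (c - ?h) (c + ?h)" by auto
        then have "int_vec (s - t)" using \<Psi>_eq_iff by blast
        moreover have "x \<in> ?u (c + (s - t))"
          using * unfolding xz by (auto simp: mem simp del: mem_ball)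
        ultimately show "x \<in> \<Union>?v" by blast
      qed
      show "pairwise disjnt ?v"
      proof (rule pairwise_imageI)
        fix m n :: "real^2" assume mn: "m \<in> Collect int_vec" "n \<in> Collect int_vec" "m \<noteq> n"
        then obtain j where j: "\<not> \<bar>(m - n) $ j\<bar> < 1"
          using int_vec_eq_0[of "m - n"] int_vec_diff by auto
        show "disjnt (?u (c + m)) (?u (c + n))"
          unfolding disjnt_def
        proof (rule ccontr)
          assume "?u (c + m) \<inter> ?u (c + n) \<noteq> {}"
          then obtain t where "t \<in> box (c + m - ?h) (c + m + ?h)" "t \<in> box (c + n - ?h) (c + n + ?h)"
            by blast
          then have "\<bar>t $ j - (c + m) $ j\<bar> < 1/2" "\<bar>t $ j - (c + n) $ j\<bar> < 1/2"
            unfolding mem by blast+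
          then show False using j by (simp add: abs_if split: if_splits)
        qed
      qed
      fix u assume "u \<in> ?v"
      then obtain m where m: "int_vec m" "u = ?u (c + m)" by blast
      show "openin (top_of_set (ball z0 r \<times> UNIV)) u"
        unfolding m(2) by (rule open_subset) (auto intro!: open_Times)
      have "open u" unfolding m(2) by (auto intro!: open_Times)
      then obtain g where "homeomorphism u (\<Psi> ` u) \<Psi> g"
        using invariance_of_domain_homeomorphism[of u \<Psi>] cont[of u] dims inj[of "c + m"]
        unfolding m(2) by (metis Sigma_mono order_refl subset_UNIV)
      then show "\<exists>q. homeomorphism u ?T \<Psi> q"
        unfolding m(2) shift[OF m(1)] by blast
    qed
    ultimately show "\<exists>T. \<rho> \<in> T \<and> openin (top_of_set (q -` ball z0 r)) T \<and>
         (\<exists>v. \<Union>v = ball z0 r \<times> UNIV \<inter> \<Psi> -` T \<and>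
         (\<forall>u\<in>v. openin (top_of_set (ball z0 r \<times> UNIV)) u) \<and> pairwise disjnt v \<and>
         (\<forall>u\<in>v. \<exists>q. homeomorphism u T \<Psi> q))" by (intro exI[of _ ?T] conjI)
  qed
qed

text \<open>The first component of a lift is forced to be \<open>q (f u)\<close>, so only the angles
  are returned.\<close>

lemma lift_exists:
  fixes U :: "'c::real_normed_vector set"
  assumes "simply_connected U" "locally path_connected U" "continuous_on U f"
    and "\<And>u. u \<in> U \<Longrightarrow> q (f u) \<in> ball z0 r"
  obtains \<theta> where "continuous_on U \<theta>" "\<And>u. u \<in> U \<Longrightarrow> \<Psi> (q (f u), \<theta> u) = f u"
proof -
  obtain g where g: "continuous_on U g" "g \<in> U \<rightarrow> ball z0 r \<times> UNIV" "\<And>u. u \<in> U \<Longrightarrow> \<Psi> (g u) = f u"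
    using covering_space_lift[OF covering assms(1-3)] assms(4) by (metis Pi_I vimageI)
  have "\<Psi> (q (f u), snd (g u)) = f u" if "u \<in> U" for u
    using g(2,3) that q_\<Psi> by (metis PiE SigmaE2 prod.collapse)
  then show thesis using that[of "\<lambda>u. snd (g u)"] continuous_on_snd[OF g(1)] by blast
qed

text \<open>Two lifts differ by a continuous integer vector, hence by a constant, which cancels in
  the increment.\<close>

lemma lift_increment_unique:
  assumes z: "z \<in> ball z0 r" and "connected S" "x \<in> S" "y \<in> S"
    and "continuous_on S \<theta>" "continuous_on S \<theta>'"
    and "\<And>u. u \<in> S \<Longrightarrow> \<Psi> (z, \<theta> u) = \<Psi> (z, \<theta>' u)"
  shows "\<theta> y - \<theta> x = \<theta>' y - \<theta>' x"
proof -
  have "\<theta> x - \<theta>' x = \<theta> y - \<theta>' y"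
    using int_vec_continuous_const[of S "\<lambda>u. \<theta> u - \<theta>' u" x y] assms \<Psi>_eq_iff[OF z z]
    by (auto intro!: continuous_intros)
  then show ?thesis by (simp add: algebra_simps)
qed

end

section \<open>Winding numbers and first homology\<close>

text \<open>Barycentric coordinates of the standard 1-simplex; the parameter sits in coordinate 1,
  the one that \<open>path_simplex\<close> reads.\<close>

definition edge_point :: "real \<Rightarrow> nat \<Rightarrow> real" where
  "edge_point u = (\<lambda>i. if i = 0 then 1 - u else if i = 1 then u else 0)"

definition triangle_point :: "real \<times> real \<Rightarrow> nat \<Rightarrow> real" where
  "triangle_point = (\<lambda>(a, b) i. if i = 0 then 1 - a - b else if i = 1 then a else if i = 2 then b else 0)"

definition std_triangle :: "(real \<times> real) set" where
  "std_triangle = {x. 0 \<le> fst x \<and> 0 \<le> snd x \<and> fst x + snd x \<le> 1}"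

lemma edge_point_simplex: "u \<in> {0..1} \<Longrightarrow> edge_point u \<in> standard_simplex 1"
  by (auto simp: edge_point_def standard_simplex_def)

lemma triangle_point_simplex: "x \<in> std_triangle \<Longrightarrow> triangle_point x \<in> standard_simplex 2"
  by (cases x) (auto simp: std_triangle_def triangle_point_def standard_simplex_def numeral_2_eq_2)

lemma path_simplex_edge_point: "u \<in> {0..1} \<Longrightarrow> path_simplex g (edge_point u) = g u"
  using edge_point_simplex by (simp add: path_simplex_def) (simp add: edge_point_def)

lemma continuous_on_singular_triangle:
  assumes "singular_simplex 2 (top_of_set T) f"
  shows "continuous_on std_triangle (\<lambda>x. f (triangle_point x))" "x \<in> std_triangle \<Longrightarrow> f (triangle_point x) \<in> T"
proof -
  have f: "continuous_map (subtopology (powertop_real UNIV) (standard_simplex 2)) (top_of_set T) f"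
    using assms by (simp add: singular_simplex_def)
  have "continuous_map (top_of_set std_triangle) (subtopology (powertop_real UNIV) (standard_simplex 2)) triangle_point"
  proof -
    have "continuous_on std_triangle (\<lambda>x. triangle_point x i)" for i
      by (cases "i = 0"; cases "i = 1"; cases "i = 2")
        (auto simp: triangle_point_def case_prod_unfold intro!: continuous_intros)
    then show ?thesis
      using triangle_point_simplex by (auto simp: continuous_map_in_subtopology continuous_map_componentwise_UNIV)
  qed
  from continuous_map_compose[OF this f]
  show "continuous_on std_triangle (\<lambda>x. f (triangle_point x))" "x \<in> std_triangle \<Longrightarrow> f (triangle_point x) \<in> T"
    by (auto simp: o_def continuous_map_in_subtopology)
qed

lemma singular_simplex_path_simplex:
  assumes "path g" "path_image g \<subseteq> T"
  shows "singular_simplex 1 (top_of_set T) (path_simplex g)"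
proof -
  have "continuous_map (subtopology (powertop_real UNIV) (standard_simplex 1)) (top_of_set {0..1}) (\<lambda>s. s 1)"
    by (auto simp: continuous_map_in_subtopology standard_simplex_def
        intro!: continuous_map_from_subtopology continuous_map_product_projection)
  moreover have "continuous_map (top_of_set {0..1}) (top_of_set T) g"
    using assms by (auto simp: path_def path_image_def)
  ultimately have "continuous_map (subtopology (powertop_real UNIV) (standard_simplex 1)) (top_of_set T) (g \<circ> (\<lambda>s. s 1))"
    by (rule continuous_map_compose)
  then have "continuous_map (subtopology (powertop_real UNIV) (standard_simplex 1)) (top_of_set T) (path_simplex g)"
    by (rule continuous_map_eq) (simp add: path_simplex_def)
  then show ?thesis by (simp add: singular_simplex_def path_simplex_def)
qed

text \<open>The two faces of a path simplex are its endpoints; for a loop they coincide and cancel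
  in the boundary.\<close>

lemma singular_relcycle_path_simplex:
  assumes "path g" "path_image g \<subseteq> T" "pathfinish g = pathstart g"
  shows "singular_relcycle 1 (top_of_set T) {} (frag_of (path_simplex g))"
proof -
  \<comment> \<open>The only point of the standard 0-simplex, so comparing the two faces there
    suffices.\<close>
  let ?e = "\<lambda>j::nat. if j = 0 then 1 else 0 :: real"
  have e: "simplical_face k ?e \<in> standard_simplex 1" if "k \<le> 1" for k
    using simplical_face_in_standard_simplex[of 1 k ?e] that by (simp add: standard_simplex_0)
  have "path_simplex g (simplical_face 0 ?e) = path_simplex g (simplical_face 1 ?e)"
    unfolding path_simplex_def restrict_apply'[OF e[OF zero_le_one]] restrict_apply'[OF e[OF order_refl]]
    using assms(3) by (simp add: simplical_face_def pathfinish_def pathstart_def)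
  then have "singular_face 1 0 (path_simplex g) = singular_face 1 1 (path_simplex g)"
    unfolding singular_face_def by (intro restrict_ext) (auto simp: standard_simplex_0)
  then have "chain_boundary 1 (frag_of (path_simplex g)) = 0"
    by (simp add: chain_boundary_of)
  then show ?thesis
    using singular_simplex_path_simplex[OF assms(1,2)]
    by (simp add: singular_relcycle_def singular_chain_of)
qed

text \<open>Operations in the quotient group are traced back to formal integer combinations of
  chains, on which the winding functional is linear.\<close>

lemma homology_group_combination:
  assumes "singular_relcycle 1 X {} a" "singular_relcycle 1 X {} b"
  shows "(homologous_rel_set 1 X {} a [^]\<^bsub>homology_group 1 X\<^esub> (m::int)) \<otimes>\<^bsub>homology_group 1 X\<^esub>
           (homologous_rel_set 1 X {} b [^]\<^bsub>homology_group 1 X\<^esub> (n::int)) =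
         homologous_rel_set 1 X {} (frag_cmul m a + frag_cmul n b)"
proof -
  let ?R = "relcycle_group 1 X {}" and ?B = "singular_relboundary_set 1 X {}" and ?H = "homology_group 1 X"
  have H: "?H = ?R Mod ?B" by (simp add: relative_homology_group_def)
  have coset: "r_coset ?R ?B a = homologous_rel_set 1 X {} a" for a
    using right_coset_singular_relboundary[of 1 X "{}"] by (rule fun_cong)
  have normal: "?B \<lhd> ?R" by (rule normal_subgroup_singular_relboundary_relcycle)
  have pow: "homologous_rel_set 1 X {} c [^]\<^bsub>?H\<^esub> k = homologous_rel_set 1 X {} (frag_cmul k c)"
    "singular_relcycle 1 X {} (frag_cmul k c)"
    if c: "singular_relcycle 1 X {} c" for c and k :: int
  proof -
    have chain: "Poly_Mapping.keys c \<subseteq> singular_simplex_set 1 X"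
      using c by (simp add: singular_relcycle_def singular_chain_def)
    have k: "c [^]\<^bsub>?R\<^esub> k = frag_cmul k c"
    proof -
      have "c \<in> carrier (subgroup_generated (free_Abelian_group (singular_simplex_set 1 X))
              (singular_relcycle_set 1 X {}))"
        using c by (metis carrier_relcycle_group chain_group_def mem_Collect_eq relcycle_group_def)
      then show ?thesis
        by (simp add: relcycle_group_def chain_group_def group.int_pow_subgroup_generated chain del: One_nat_def)
    qed
    show "homologous_rel_set 1 X {} c [^]\<^bsub>?H\<^esub> k = homologous_rel_set 1 X {} (frag_cmul k c)"
      unfolding H coset[symmetric] k[symmetric]
      using c by (intro normal.FactGroup_int_pow[OF normal]) simp
    have "c [^]\<^bsub>?R\<^esub> k \<in> carrier ?R"
      using c by (intro group.int_pow_closed) auto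
    then show "singular_relcycle 1 X {} (frag_cmul k c)" using k by simp
  qed
  have "(r_coset ?R ?B (frag_cmul m a)) <#>\<^bsub>?R\<^esub> (r_coset ?R ?B (frag_cmul n b)) =
      r_coset ?R ?B (frag_cmul m a \<otimes>\<^bsub>?R\<^esub> frag_cmul n b)"
    using pow(2)[OF assms(1), of m] pow(2)[OF assms(2), of n] by (intro normal.rcos_sum[OF normal]) auto
  then show ?thesis
    using pow(1)[OF assms(1), of m] pow(1)[OF assms(2), of n]
    by (simp add: H FactGroup_def coset del: One_nat_def)
qed

section \<open>Winding vectors of singular chains\<close>

context torus_chart
begin

text \<open>The choice is harmless: by \<open>lift_increment_unique\<close> all lifts of an edge
  within one torus have the same increment. Taking a simplex as argument rather than a path allows
  the extension to chains.\<close>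

definition lift_increment :: "complex \<Rightarrow> ((nat \<Rightarrow> real) \<Rightarrow> rphase) \<Rightarrow> real^2" where
  "lift_increment z f = (let \<theta> = SOME \<theta>. continuous_on {0..1} \<theta> \<and>
     (\<forall>u\<in>{0..1}. \<Psi> (z, \<theta> u) = f (edge_point u)) in \<theta> 1 - \<theta> 0)"

lemma lift_increment_eq:
  assumes z: "z \<in> ball z0 r" and \<theta>: "continuous_on {0..1} \<theta>" "\<And>u. u \<in> {0..1} \<Longrightarrow> \<Psi> (z, \<theta> u) = f (edge_point u)"
  shows "lift_increment z f = \<theta> 1 - \<theta> 0"
proof -
  let ?P = "\<lambda>\<theta>. continuous_on {0..1::real} \<theta> \<and> (\<forall>u\<in>{0..1}. \<Psi> (z, \<theta> u) = f (edge_point u))"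
  have "?P (Eps ?P)" by (rule someI[of ?P \<theta>]) (use \<theta> in blast)
  then have "Eps ?P 1 - Eps ?P 0 = \<theta> 1 - \<theta> 0"
    using \<theta> by (intro lift_increment_unique[OF z, of "{0..1::real}"]) (auto simp: connected_Icc)
  then show ?thesis by (simp add: lift_increment_def)
qed

text \<open>A triangle is simply connected, so the whole singular simplex lifts at once. The
  increments along its edges are differences of vertex values of that lift and cancel in the
  alternating sum.\<close>

lemma lift_increment_boundary:
  assumes z: "z \<in> ball z0 r" and f: "singular_simplex 2 (top_of_set {\<rho>. q \<rho> = z}) f"
  shows "lift_increment z (singular_face 2 0 f) - lift_increment z (singular_face 2 1 f)
       + lift_increment z (singular_face 2 2 f) = 0"
proof -
  have conv: "convex std_triangle"
  proof -
    have eq: "std_triangle = {x. (- 1, 0) \<bullet> x \<le> 0} \<inter> {x. (0, - 1) \<bullet> x \<le> 0} \<inter> {x. (1, 1) \<bullet> x \<le> 1}"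
      by (auto simp: std_triangle_def inner_prod_def)
    show ?thesis unfolding eq by (intro convex_Int convex_halfspace_le)
  qed
  have q: "q (f (triangle_point x)) = z" if "x \<in> std_triangle" for x
    using continuous_on_singular_triangle(2)[OF f that] by simp
  obtain \<theta> where \<theta>: "continuous_on std_triangle \<theta>"
    "\<And>x. x \<in> std_triangle \<Longrightarrow> \<Psi> (z, \<theta> x) = f (triangle_point x)"
  proof (rule lift_exists[OF convex_imp_simply_connected[OF conv] convex_imp_locally_path_connected[OF conv]
        continuous_on_singular_triangle(1)[OF f]])
    show "x \<in> std_triangle \<Longrightarrow> q (f (triangle_point x)) \<in> ball z0 r" for x
      using q z by simp
    fix \<theta> assume "continuous_on std_triangle \<theta>"
      "\<And>u. u \<in> std_triangle \<Longrightarrow> \<Psi> (q (f (triangle_point u)), \<theta> u) = f (triangle_point u)"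
    then show thesis using that q by simp
  qed
  have incr: "lift_increment z (singular_face 2 k f) = \<theta> (c 1) - \<theta> (c 0)"
    if "continuous_on {0..1} c" "c ` {0..1} \<subseteq> std_triangle"
      "\<And>u. u \<in> {0..1} \<Longrightarrow> simplical_face k (edge_point u) = triangle_point (c u)" for k c
  proof (rule lift_increment_eq[OF z, of "\<lambda>u. \<theta> (c u)"])
    show "continuous_on {0..1} (\<lambda>u. \<theta> (c u))"
      using continuous_on_compose2[OF \<theta>(1) that(1,2)] .
    fix u :: real assume u: "u \<in> {0..1}"
    have "edge_point u \<in> standard_simplex (2 - Suc 0)" using edge_point_simplex[OF u] by simp
    then have "singular_face 2 k f (edge_point u) = f (simplical_face k (edge_point u))"
      by (simp only: singular_face_def restrict_apply' o_apply)
    also have "\<dots> = \<Psi> (z, \<theta> (c u))"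
    proof -
      have "c u \<in> std_triangle" using that(2) u by blast
      then show ?thesis using \<theta>(2) that(3)[OF u] by simp
    qed
    finally show "\<Psi> (z, \<theta> (c u)) = singular_face 2 k f (edge_point u)" by simp
  qed
  have "lift_increment z (singular_face 2 0 f) = \<theta> (0, 1) - \<theta> (1, 0)"
  proof -
    \<comment> \<open>Face 0 runs from vertex 1 to vertex 2, which have the planar parameters (1, 0)
      and (0, 1).\<close>
    have "simplical_face 0 (edge_point u) i = triangle_point (1 - u, u) i" for u i
      by (cases i; cases "i - 1") (auto simp: simplical_face_def edge_point_def triangle_point_def)
    moreover have cont: "continuous_on {0..1} (\<lambda>u::real. (1 - u, u))"
      by (intro continuous_intros)
    have im: "(\<lambda>u::real. (1 - u, u)) ` {0..1} \<subseteq> std_triangle"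
      by (auto simp: std_triangle_def)
    ultimately show ?thesis
      using incr[OF cont im, of 0] by (simp add: fun_eq_iff)
  qed
  moreover have "lift_increment z (singular_face 2 1 f) = \<theta> (0, 1) - \<theta> (0, 0)"
  proof -
    have "simplical_face 1 (edge_point u) i = triangle_point (0, u) i" for u i
      by (cases i; cases "i - 1") (auto simp: simplical_face_def edge_point_def triangle_point_def)
    moreover have cont: "continuous_on {0..1} (\<lambda>u::real. (0, u))"
      by (intro continuous_intros)
    have im: "(\<lambda>u::real. (0, u)) ` {0..1} \<subseteq> std_triangle"
      by (auto simp: std_triangle_def)
    ultimately show ?thesis
      using incr[OF cont im, of 1] by (simp add: fun_eq_iff)
  qed
  moreover have "lift_increment z (singular_face 2 2 f) = \<theta> (1, 0) - \<theta> (0, 0)"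
  proof -
    have "simplical_face 2 (edge_point u) i = triangle_point (u, 0) i" for u i
      by (cases i; cases "i - 1") (auto simp: simplical_face_def edge_point_def triangle_point_def)
    moreover have cont: "continuous_on {0..1} (\<lambda>u::real. (u, 0))"
      by (intro continuous_intros)
    have im: "(\<lambda>u::real. (u, 0)) ` {0..1} \<subseteq> std_triangle"
      by (auto simp: std_triangle_def)
    ultimately show ?thesis
      using incr[OF cont im, of 2] by (simp add: fun_eq_iff)
  qed
  ultimately show ?thesis by simp
qed

text \<open>A cochain with values in \<open>real^2\<close>; by
  \<open>chain_increment_boundary\<close> it is a cocycle on each torus and so descends to
  homology.\<close>

definition chain_increment :: "complex \<Rightarrow> rphase chain \<Rightarrow> real^2" where
  "chain_increment z c = (\<Sum>f\<in>Poly_Mapping.keys c. of_int (Poly_Mapping.lookup c f) *\<^sub>R lift_increment z f)"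

text \<open>The supports of a sum and of its summands differ; over a common larger index set,
  additivity holds term by term.\<close>

lemma chain_increment_superset:
  assumes "finite K" "Poly_Mapping.keys c \<subseteq> K"
  shows "chain_increment z c = (\<Sum>f\<in>K. of_int (Poly_Mapping.lookup c f) *\<^sub>R lift_increment z f)"
  unfolding chain_increment_def using assms
  by (intro sum.mono_neutral_left) (auto simp: in_keys_iff)

lemma chain_increment_add: "chain_increment z (a + b) = chain_increment z a + chain_increment z b"
proof -
  let ?K = "Poly_Mapping.keys a \<union> Poly_Mapping.keys b"
  have "finite ?K" by simp
  note sup = chain_increment_superset[OF this]
  show ?thesis
    by (subst (1 2 3) sup) (auto simp: lookup_add scaleR_left.add sum.distrib in_keys_iff)
qed

lemma chain_increment_cmul: "chain_increment z (frag_cmul k a) = of_int k *\<^sub>R chain_increment z a"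
proof -
  have "finite (Poly_Mapping.keys a)" by simp
  note sup = chain_increment_superset[OF this]
  show ?thesis
    by (subst (1 2) sup) (use keys_cmul in \<open>auto simp: scaleR_sum_right\<close>)
qed

lemma chain_increment_diff: "chain_increment z (a - b) = chain_increment z a - chain_increment z b"
  using chain_increment_add[of z "a - b" b] by simp

lemma chain_increment_of: "chain_increment z (frag_of f) = lift_increment z f"
  by (simp add: chain_increment_def)

lemma chain_increment_boundary:
  assumes z: "z \<in> ball z0 r" and "singular_chain 2 (top_of_set {\<rho>. q \<rho> = z}) c"
  shows "chain_increment z (chain_boundary 2 c) = 0"
  using assms(2) unfolding singular_chain_def
proof (induction c rule: frag_induction)
  case zero
  then show ?case by (simp add: chain_increment_def)
next
  case (one f)
  have "chain_boundary 2 (frag_of f) =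
      frag_of (singular_face 2 0 f) - frag_of (singular_face 2 1 f) + frag_of (singular_face 2 2 f)"
    by (simp add: chain_boundary_of numeral_2_eq_2)
  then show ?case
    using lift_increment_boundary[OF z, of f] one
    by (simp add: chain_increment_add chain_increment_diff chain_increment_of)
next
  case (diff a b)
  then show ?case by (simp add: chain_boundary_diff chain_increment_diff)
qed

lemma chain_increment_homologous:
  assumes z: "z \<in> ball z0 r" and "homologous_rel 1 (top_of_set {\<rho>. q \<rho> = z}) {} a b"
  shows "chain_increment z a = chain_increment z b"
proof -
  obtain d where d: "singular_chain 2 (top_of_set {\<rho>. q \<rho> = z}) d" "chain_boundary 2 d = a - b"
    using assms(2) unfolding homologous_rel_def singular_relboundary_def mod_subset_empty
    by (auto simp: numeral_2_eq_2)
  then show ?thesis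
    using chain_increment_boundary[OF z d(1)] by (simp add: chain_increment_diff)
qed

text \<open>The coordinate loops of the torus are integer combinations of the two given cycles, so their
  winding vectors generate \<open>\<int>\<^sup>2\<close>.\<close>

lemma homology_basis_winding_det:
  assumes z: "z \<in> ball z0 r"
    and basis: "homology_basis {\<rho>. q \<rho> = z} g1 g2"
    and g1: "path g1" "path_image g1 \<subseteq> {\<rho>. q \<rho> = z}" "pathfinish g1 = pathstart g1"
    and g2: "path g2" "path_image g2 \<subseteq> {\<rho>. q \<rho> = z}" "pathfinish g2 = pathstart g2"
    and \<theta>1: "continuous_on {0..1} \<theta>1" "\<And>u. u \<in> {0..1} \<Longrightarrow> \<Psi> (z, \<theta>1 u) = g1 u"
    and \<theta>2: "continuous_on {0..1} \<theta>2" "\<And>u. u \<in> {0..1} \<Longrightarrow> \<Psi> (z, \<theta>2 u) = g2 u"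
    and w: "w1 = \<theta>1 1 - \<theta>1 0" "w2 = \<theta>2 1 - \<theta>2 0"
  shows "\<bar>w1 $ 1 * w2 $ 2 - w1 $ 2 * w2 $ 1\<bar> = 1"
proof -
  let ?\<Gamma> = "{\<rho>. q \<rho> = z}"
  let ?X = "top_of_set ?\<Gamma>"
  let ?H = "homology_group 1 ?X"
  have incr: "chain_increment z (frag_of (path_simplex g)) = \<theta> 1 - \<theta> 0"
    if "continuous_on {0..1} \<theta>" "\<And>u. u \<in> {0..1} \<Longrightarrow> \<Psi> (z, \<theta> u) = g u" for g \<theta>
    using that lift_increment_eq[OF z, of \<theta> "path_simplex g"]
    by (simp add: chain_increment_of path_simplex_edge_point)
  have int: "int_vec (\<theta> 1 - \<theta> 0)" if "\<And>u. u \<in> {0..1} \<Longrightarrow> \<Psi> (z, \<theta> u) = g u" "pathfinish g = pathstart g"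
    for g :: "real \<Rightarrow> rphase" and \<theta>
    using that \<Psi>_eq_iff[OF z z, of "\<theta> 1" "\<theta> 0"] by (simp add: pathfinish_def pathstart_def)
  have comb: "\<exists>m n :: int. axis k 1 = of_int m *\<^sub>R w1 + of_int n *\<^sub>R w2" for k
  proof -
    \<comment> \<open>The coordinate loop, given together with a lift whose increment is
      \<open>axis k 1\<close>.\<close>
    let ?c = "\<lambda>u. \<Psi> (z, u *\<^sub>R axis k 1)"
    have \<Psi>cont: "continuous_on (ball z0 r \<times> UNIV) \<Psi>" by (rule smooth_on_continuous_on[OF smooth])
    have "path ?c"
      unfolding path_def
      by (rule continuous_on_compose2[OF \<Psi>cont]) (use z in \<open>auto intro!: continuous_intros\<close>)
    moreover have "path_image ?c \<subseteq> ?\<Gamma>" using q_\<Psi>[OF z] by (auto simp: path_image_def)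
    moreover have "pathfinish ?c = pathstart ?c"
      using \<Psi>_eq_iff[OF z z, of "axis k 1" 0] int_vec_axis by (simp add: pathfinish_def pathstart_def)
    ultimately have "singular_relcycle 1 ?X {} (frag_of (path_simplex ?c))"
      by (rule singular_relcycle_path_simplex)
    then have "homologous_rel_set 1 ?X {} (frag_of (path_simplex ?c)) \<in> carrier ?H"
      using carrier_relative_homology_group[of 1 ?X "{}"] by simp
    then have "homologous_rel_set 1 ?X {} (frag_of (path_simplex ?c)) \<in>
        range (\<lambda>(m::int, n::int). (loop_class ?\<Gamma> g1 [^]\<^bsub>?H\<^esub> m) \<otimes>\<^bsub>?H\<^esub> (loop_class ?\<Gamma> g2 [^]\<^bsub>?H\<^esub> n))"
      using basis by (simp only: homology_basis_def bij_betw_def Let_def)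
    then obtain m n :: int where "homologous_rel_set 1 ?X {} (frag_of (path_simplex ?c)) =
        (loop_class ?\<Gamma> g1 [^]\<^bsub>?H\<^esub> m) \<otimes>\<^bsub>?H\<^esub> (loop_class ?\<Gamma> g2 [^]\<^bsub>?H\<^esub> n)"
      by (rule imageE) (simp only: case_prod_unfold)
    also have "\<dots> = homologous_rel_set 1 ?X {} (frag_cmul m (frag_of (path_simplex g1)) + frag_cmul n (frag_of (path_simplex g2)))"
      unfolding loop_class_def
      by (intro homology_group_combination singular_relcycle_path_simplex g1 g2)
    finally have "homologous_rel 1 ?X {} (frag_of (path_simplex ?c))
        (frag_cmul m (frag_of (path_simplex g1)) + frag_cmul n (frag_of (path_simplex g2)))"
      by (simp add: homologous_rel_set_eq)
    from chain_increment_homologous[OF z this]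
    have "axis k 1 = of_int m *\<^sub>R w1 + of_int n *\<^sub>R w2"
      using incr[of "\<lambda>u. u *\<^sub>R axis k 1" ?c] incr[OF \<theta>1] incr[OF \<theta>2]
      by (simp add: chain_increment_add chain_increment_cmul w continuous_intros)
    then show ?thesis by blast
  qed
  obtain a b :: int where ab: "axis 1 1 = of_int a *\<^sub>R w1 + of_int b *\<^sub>R w2" using comb by blast
  obtain c d :: int where cd: "axis 2 1 = of_int c *\<^sub>R w1 + of_int d *\<^sub>R w2" using comb by blast
  have eqs: "of_int a * w1 $ 1 + of_int b * w2 $ 1 = 1" "of_int a * w1 $ 2 + of_int b * w2 $ 2 = 0"
    "of_int c * w1 $ 1 + of_int d * w2 $ 1 = 0" "of_int c * w1 $ 2 + of_int d * w2 $ 2 = 1"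
    using arg_cong[OF ab, of "\<lambda>v. v $ 1"] arg_cong[OF ab, of "\<lambda>v. v $ 2"]
      arg_cong[OF cd, of "\<lambda>v. v $ 1"] arg_cong[OF cd, of "\<lambda>v. v $ 2"] by simp_all
  have "int_vec w1" "int_vec w2"
    unfolding w using int[OF \<theta>1(2) g1(3)] int[OF \<theta>2(2) g2(3)] by auto
  then have "w1 $ 1 * w2 $ 2 - w1 $ 2 * w2 $ 1 \<in> \<int>" by (auto simp: int_vec_def)
  then obtain D :: int where D: "w1 $ 1 * w2 $ 2 - w1 $ 2 * w2 $ 1 = of_int D" by (metis Ints_cases)
  \<comment> \<open>Multiplicativity of the 2 by 2 determinant: the integer matrix with rows (a, b)
    and (c, d) inverts the winding matrix, so both determinants are units of the integers.\<close>
  have "of_int (a * d - b * c) * (w1 $ 1 * w2 $ 2 - w1 $ 2 * w2 $ 1) =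
     (of_int a * w1 $ 1 + of_int b * w2 $ 1) * (of_int c * w1 $ 2 + of_int d * w2 $ 2)
   - (of_int a * w1 $ 2 + of_int b * w2 $ 2) * (of_int c * w1 $ 1 + of_int d * w2 $ 1)"
    by (simp add: algebra_simps)
  also have "\<dots> = 1" by (simp only: eqs)
  finally have "(of_int ((a * d - b * c) * D) :: real) = of_int 1"
    unfolding D by simp
  then have "(a * d - b * c) * D = 1" by (simp only: of_int_eq_iff)
  then have "\<bar>D\<bar> = 1" using zmult_eq_1_iff by auto
  then show ?thesis unfolding D by linarith
qed

end

section \<open>Symplectic linear algebra\<close>

definition sympl :: "rphase \<Rightarrow> rphase \<Rightarrow> real" where
  "sympl u v = snd u \<bullet> fst v - snd v \<bullet> fst u"

lemma sympl_coords:
  "sympl u v = snd u $ 1 * fst v $ 1 + snd u $ 2 * fst v $ 2 - snd v $ 1 * fst u $ 1 - snd v $ 2 * fst u $ 2"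
  by (simp add: sympl_def inner_vec_def sum_2)

lemma sympl_bilinear:
  "sympl (u + u') v = sympl u v + sympl u' v" "sympl u (v + v') = sympl u v + sympl u v'"
  "sympl (c *\<^sub>R u) v = c * sympl u v" "sympl u (c *\<^sub>R v) = c * sympl u v"
  "sympl 0 v = 0" "sympl u 0 = 0"
  by (simp_all add: sympl_coords algebra_simps)

lemma sympl_swap: "sympl u v = - sympl v u" and sympl_self: "sympl u u = 0"
  by (simp_all add: sympl_coords)

lemma det_4:
  "det (A::'a::comm_ring_1^4^4) =
     A$1$1 * (A$2$2 * (A$3$3 * A$4$4 - A$3$4 * A$4$3) - A$2$3 * (A$3$2 * A$4$4 - A$3$4 * A$4$2)
        + A$2$4 * (A$3$2 * A$4$3 - A$3$3 * A$4$2))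
   - A$1$2 * (A$2$1 * (A$3$3 * A$4$4 - A$3$4 * A$4$3) - A$2$3 * (A$3$1 * A$4$4 - A$3$4 * A$4$1)
        + A$2$4 * (A$3$1 * A$4$3 - A$3$3 * A$4$1))
   + A$1$3 * (A$2$1 * (A$3$2 * A$4$4 - A$3$4 * A$4$2) - A$2$2 * (A$3$1 * A$4$4 - A$3$4 * A$4$1)
        + A$2$4 * (A$3$1 * A$4$2 - A$3$2 * A$4$1))
   - A$1$4 * (A$2$1 * (A$3$2 * A$4$3 - A$3$3 * A$4$2) - A$2$2 * (A$3$1 * A$4$3 - A$3$3 * A$4$1)
        + A$2$3 * (A$3$1 * A$4$2 - A$3$2 * A$4$1))"
proof -
  have f1234: "finite {2::4, 3, 4}" "1 \<notin> {2::4, 3, 4}" by auto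
  have f234: "finite {3::4, 4}" "2 \<notin> {3::4, 4}" by auto
  have f34: "finite {4::4}" "3 \<notin> {4::4}" by auto
  show ?thesis
    unfolding det_def UNIV_4
    unfolding sum_over_permutations_insert[OF f1234]
    unfolding sum_over_permutations_insert[OF f234]
    unfolding sum_over_permutations_insert[OF f34]
    unfolding permutes_sing
    by (simp add: sign_swap_id permutation_swap_id permutation_compose sign_compose sign_id transpose_def algebra_simps)
qed

text \<open>The second argument is the Hamiltonian vector of the covector \<open>l\<close>, the
  vector that represents \<open>l\<close> through the symplectic form.\<close>

lemma sympl_hamiltonian_field:
  assumes "linear l"
  shows "sympl v ((\<chi> j. l (0, axis j 1)), (\<chi> j. - l (axis j 1, 0))) = l v"
proof -
  have "v = fst v $ 1 *\<^sub>R (axis 1 1, 0) + fst v $ 2 *\<^sub>R (axis 2 1, 0)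
     + snd v $ 1 *\<^sub>R (0, axis 1 1) + snd v $ 2 *\<^sub>R (0, axis 2 1)"
    by (cases v) (simp add: vec_eq_iff forall_2)
  then have "l v = fst v $ 1 * l (axis 1 1, 0) + fst v $ 2 * l (axis 2 1, 0)
     + snd v $ 1 * l (0, axis 1 1) + snd v $ 2 * l (0, axis 2 1)"
    using linear_add[OF assms] linear_cmul[OF assms] by (metis real_scaleR_def)
  then show ?thesis by (simp add: sympl_coords)
qed

locale lagrangian_torus_chart = torus_chart +
  assumes poisson: "\<And>\<rho>. poisson (\<lambda>\<rho>. Re (q \<rho>)) (\<lambda>\<rho>. Im (q \<rho>)) \<rho> = 0"
begin

text \<open>The Hamiltonian field of \<open>Re q\<close> is tangent to the torus because the bracket vanishes, and its
  pairing with any tangent vector is a derivative of \<open>Re q\<close> along the torus, hence zero.\<close>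

lemma sympl_tangent:
  assumes z: "z \<in> ball z0 r"
  shows "sympl (dir_deriv (0, axis 1 1) \<Psi> (z, t)) (dir_deriv (0, axis 2 1) \<Psi> (z, t)) = 0"
proof (rule ccontr)
  let ?L = "\<lambda>v. dir_deriv v \<Psi> (z, t)" and ?\<rho> = "\<Psi> (z, t)"
  let ?S = "?L (0, axis 1 1)" and ?T = "?L (0, axis 2 1)"
  assume ne: "sympl ?S ?T \<noteq> 0"
  have linL: "linear ?L" by (rule linear_dir_deriv[OF z])
  have "inj ?L"
    using dir_deriv_eq_0[OF z, of _ t] by (simp add: linear_injective_0[OF linL])
  then have "dim (range ?L) = dim (UNIV :: (complex \<times> (real^2)) set)"
    by (intro dim_image_eq linL) simp
  then have "span (range ?L) = UNIV"
    by (simp add: dim_eq_full[symmetric])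
  then have surj: "range ?L = UNIV"
    using linear_subspace_image[OF linL subspace_UNIV] by (simp add: span_eq_iff[THEN iffD2])
  have linq: "linear (q' ?\<rho>)" using q_deriv has_derivative_linear by blast
  let ?l = "\<lambda>v. Re (q' ?\<rho> v)"
  have linl: "linear ?l" 
    using linear_compose[OF linq bounded_linear.linear[OF bounded_linear_Re]] by (simp add: o_def)
  define H where "H = ((\<chi> j. ?l (0, axis j 1)), (\<chi> j. - ?l (axis j 1, 0)))"
  have H: "sympl v H = ?l v" for v
    unfolding H_def by (rule sympl_hamiltonian_field[OF linl])
  have fr: "frechet_derivative (\<lambda>\<rho>. Re (q \<rho>)) (at ?\<rho>) = ?l"
    "frechet_derivative (\<lambda>\<rho>. Im (q \<rho>)) (at ?\<rho>) = (\<lambda>v. Im (q' ?\<rho> v))"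
    using has_derivative_Re[OF q_deriv] has_derivative_Im[OF q_deriv] frechet_derivative_at by metis+
  have linm: "linear (\<lambda>v. Im (q' ?\<rho> v))"
    using linear_compose[OF linq bounded_linear.linear[OF bounded_linear_Im]] by (simp add: o_def)
  have "Im (q' ?\<rho> H) = sympl H ((\<chi> j. Im (q' ?\<rho> (0, axis j 1))), (\<chi> j. - Im (q' ?\<rho> (axis j 1, 0))))"
    by (rule sympl_hamiltonian_field[OF linm, symmetric])
  also have "\<dots> = poisson (\<lambda>\<rho>. Re (q \<rho>)) (\<lambda>\<rho>. Im (q \<rho>)) ?\<rho>"
    by (simp add: poisson_def d_x_def d_xi_def fr sympl_coords H_def sum_2 algebra_simps)
  finally have "Im (q' ?\<rho> H) = 0" using poisson by simp
  moreover have "Re (q' ?\<rho> H) = 0" using H[of H] sympl_self by simp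
  ultimately have qH: "q' ?\<rho> H = 0" by (simp add: complex_eq_iff)
  have "H \<in> range ?L" using surj by simp
  then obtain v where v: "H = ?L v" by (rule imageE)
  have "fst v = 0" using q'_dir_deriv[OF z, of t v] qH v by simp
  then have veq: "v = snd v $ 1 *\<^sub>R (0, axis 1 1) + snd v $ 2 *\<^sub>R (0, axis 2 1)"
    by (cases v) (simp add: vec_eq_iff forall_2)
  have "H = ?L (snd v $ 1 *\<^sub>R (0, axis 1 1) + snd v $ 2 *\<^sub>R (0, axis 2 1))"
    unfolding v by (rule arg_cong[OF veq, of ?L])
  then have HST: "H = snd v $ 1 *\<^sub>R ?S + snd v $ 2 *\<^sub>R ?T"
    by (simp only: linear_add[OF linL] linear_cmul[OF linL])
  \<comment> \<open>If the form were nondegenerate on the tangent plane, a tangent vector whose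
    pairings with both spanning vectors vanish would be zero.\<close>
  have "sympl ?S H = 0" "sympl ?T H = 0"
    using H q'_dir_deriv[OF z] by simp_all
  then have "snd v $ 2 = 0" "snd v $ 1 = 0"
    using ne sympl_swap[of ?T ?S] unfolding HST by (auto simp: sympl_bilinear sympl_self)
  then have "H = 0" using HST by simp
  \<comment> \<open>The contradiction: this pairing is the derivative of Re z in direction 1, which
    is 1.\<close>
  then have "sympl (?L (1, 0)) H = 0" by (simp add: sympl_bilinear)
  then show False using H[of "?L (1, 0)"] q'_dir_deriv[OF z, of t "(1, 0)"] by simp
qed

end

section \<open>Change of variables on phase space\<close>

text \<open>The vector-valued change of variables is applied with values in
  \<open>real^1\<close>.\<close>

lemma change_of_variables_real:
  fixes f :: "real^'m::{finite,wellorder} \<Rightarrow> real" and g :: "real^'m::_ \<Rightarrow> real^'m::_"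
  assumes S: "S \<in> sets lebesgue"
    and der_g: "\<And>x. x \<in> S \<Longrightarrow> (g has_derivative g' x) (at x within S)"
    and inj: "inj_on g S"
    and int: "(\<lambda>x. \<bar>det (matrix (g' x))\<bar> * f (g x)) absolutely_integrable_on S"
  shows "f absolutely_integrable_on g ` S"
    "integral (g ` S) f = integral S (\<lambda>x. \<bar>det (matrix (g' x))\<bar> * f (g x))"
proof -
  have eq: "(\<lambda>x. \<bar>det (matrix (g' x))\<bar> *\<^sub>R vec (f (g x)) $ 1) = (\<lambda>x. \<bar>det (matrix (g' x))\<bar> * f (g x))"
    by simp
  have "(\<lambda>x. vec (f x) :: real^1) absolutely_integrable_on (g ` S) \<and>
      integral (g ` S) (\<lambda>x. vec (f x) :: real^1) = vec (integral S (\<lambda>x. \<bar>det (matrix (g' x))\<bar> * f (g x)))"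
    using has_absolute_integral_change_of_variables[OF S der_g inj, of "\<lambda>x. vec (f x) :: real^1"
        "vec (integral S (\<lambda>x. \<bar>det (matrix (g' x))\<bar> * f (g x)))"] int
    by (simp add: absolutely_integrable_on_1_iff integral_on_1_eq)
  then show "f absolutely_integrable_on g ` S"
    "integral (g ` S) f = integral S (\<lambda>x. \<bar>det (matrix (g' x))\<bar> * f (g x))"
    by (simp_all add: absolutely_integrable_on_1_iff integral_on_1_eq vec_eq_iff)
qed

text \<open>Determinants and the change of variables live on \<open>real^4\<close>. This map and
  \<open>phase_coords\<close> match standard bases, so they preserve Lebesgue measure by
  \<open>distr_lborel_Basis_bij\<close>.\<close>

definition chart_coords :: "real^4 \<Rightarrow> complex \<times> (real^2)" where
  "chart_coords v = (Complex (v $ 1) (v $ 2), \<chi> j. if j = 1 then v $ 3 else v $ 4)"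

definition phase_coords :: "real^4 \<Rightarrow> rphase" where
  "phase_coords v = ((\<chi> j. if j = 1 then v $ 1 else v $ 2), (\<chi> j. if j = 1 then v $ 3 else v $ 4))"

definition coords_phase :: "rphase \<Rightarrow> real^4" where
  "coords_phase \<rho> = (\<chi> i. if i = 1 then fst \<rho> $ 1 else if i = 2 then fst \<rho> $ 2
     else if i = 3 then snd \<rho> $ 1 else snd \<rho> $ 2)"

lemma coords_phase_nth:
  "coords_phase \<rho> $ 1 = fst \<rho> $ 1" "coords_phase \<rho> $ 2 = fst \<rho> $ 2"
  "coords_phase \<rho> $ 3 = snd \<rho> $ 1" "coords_phase \<rho> $ 4 = snd \<rho> $ 2"
  by (simp_all add: coords_phase_def)

lemma phase_coords_inverse: "phase_coords (coords_phase \<rho>) = \<rho>" "coords_phase (phase_coords v) = v"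
  by (auto simp: phase_coords_def coords_phase_nth vec_eq_iff forall_2 forall_4 prod_eq_iff)

lemma linear_coords: "linear chart_coords" "linear phase_coords" "linear coords_phase"
  by (auto intro!: linearI simp: chart_coords_def phase_coords_def coords_phase_def vec_eq_iff forall_2 complex_eq_iff)

lemma chart_coords_axis:
  "chart_coords (axis 1 1) = (1, 0)" "chart_coords (axis 2 1) = (\<i>, 0)"
  "chart_coords (axis 3 1) = (0, axis 1 1)" "chart_coords (axis 4 1) = (0, axis 2 1)"
  by (auto simp: chart_coords_def axis_def vec_eq_iff forall_2 complex_eq_iff)

lemma phase_coords_axis:
  "phase_coords (axis 1 1) = (axis 1 1, 0)" "phase_coords (axis 2 1) = (axis 2 1, 0)"
  "phase_coords (axis 3 1) = (0, axis 1 1)" "phase_coords (axis 4 1) = (0, axis 2 1)"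
  by (auto simp: phase_coords_def axis_def vec_eq_iff forall_2)

lemma Basis_real_2: "(Basis :: (real^2) set) = {axis 1 1, axis 2 1}"
  by (auto simp: Basis_vec_def UNIV_2)

lemma Basis_real_4: "(Basis :: (real^4) set) = {axis 1 1, axis 2 1, axis 3 1, axis 4 1}"
  by (auto simp: Basis_vec_def UNIV_4)

lemma Basis_bij_coords: "bij_betw chart_coords Basis Basis" "bij_betw phase_coords Basis Basis"
  unfolding bij_betw_def
  by (auto simp: Basis_real_4 chart_coords_axis phase_coords_axis Basis_prod_def Basis_real_2
      Basis_complex_def inj_on_def axis_eq_axis axis_eq_0_iff)

lemma inj_coords: "inj chart_coords" "inj coords_phase"
proof -
  show "inj chart_coords" by (auto intro!: injI simp: chart_coords_def vec_eq_iff forall_2 forall_4)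
  show "inj coords_phase" by (rule inj_on_inverseI[where g = phase_coords]) (rule phase_coords_inverse)
qed

lemma borel_measurable_linear:
  fixes L :: "'a::euclidean_space \<Rightarrow> 'b::euclidean_space"
  shows "linear L \<Longrightarrow> L \<in> borel_measurable borel"
  using borel_measurable_continuous_onI linear_continuous_on linear_conv_bounded_linear by blast

lemmas borel_measurable_coords [measurable] = linear_coords[THEN borel_measurable_linear]

lemma chart_coords_surj: "\<exists>v. chart_coords v = x"
proof
  show "chart_coords (\<chi> i. if i = 1 then Re (fst x) else if i = 2 then Im (fst x) else if i = 3 then snd x $ 1 else snd x $ 2) = x"
    by (auto simp: chart_coords_def vec_eq_iff forall_2 prod_eq_iff complex_eq_iff)
qed

text \<open>Both sides are carried to \<open>real^4\<close>. Vanishing of \<open>f\<close> off the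
  image of \<open>S\<close> extends the integral from that image to all of phase space.\<close>

lemma phase_integral_change_of_variables:
  fixes \<Psi> :: "complex \<times> (real^2) \<Rightarrow> rphase" and f :: "rphase \<Rightarrow> real"
    and D :: "complex \<times> (real^2) \<Rightarrow> complex \<times> (real^2) \<Rightarrow> rphase"
  defines "J x \<equiv> \<bar>det (matrix (\<lambda>v. coords_phase (D x (chart_coords v))))\<bar>"
  assumes S: "S \<in> sets borel" and f: "f \<in> borel_measurable borel"
    and der: "\<And>x. x \<in> S \<Longrightarrow> (\<Psi> has_derivative D x) (at x)"
    and inj: "inj_on \<Psi> S"
    and int: "set_integrable lborel S (\<lambda>x. J x * f (\<Psi> x))"
    and zero: "\<And>\<rho>. \<rho> \<notin> \<Psi> ` S \<Longrightarrow> f \<rho> = 0"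
  shows "(LINT \<rho>|lborel. f \<rho>) = (LINT x:S|lborel. J x * f (\<Psi> x))"
proof -
  note distr1 = distr_lborel_Basis_bij[OF linear_coords(1) Basis_bij_coords(1)]
  note distr2 = distr_lborel_Basis_bij[OF linear_coords(2) Basis_bij_coords(2)]
  define g where "g v = coords_phase (\<Psi> (chart_coords v))" for v
  define g' where "g' v h = coords_phase (D (chart_coords v) (chart_coords h))" for v h
  define T where "T = chart_coords -` S"
  have T: "T \<in> sets borel"
    using measurable_sets[OF borel_measurable_coords(1) S] by (simp add: T_def)
  have JT: "\<bar>det (matrix (g' v))\<bar> = J (chart_coords v)" for v
    by (simp add: J_def g'_def[abs_def])
  have fg: "f (phase_coords (g v)) = f (\<Psi> (chart_coords v))" for v
    by (simp add: g_def phase_coords_inverse)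
  have der_g: "(g has_derivative g' v) (at v within T)" if "v \<in> T" for v
  proof -
    have lin: "(L has_derivative L) (at x)" if "linear L" for L :: "'x::euclidean_space \<Rightarrow> 'y::euclidean_space" and x
      using that by (simp add: bounded_linear_imp_has_derivative linear_conv_bounded_linear)
    have "((\<lambda>v. \<Psi> (chart_coords v)) has_derivative (\<lambda>h. D (chart_coords v) (chart_coords h))) (at v)"
      by (rule has_derivative_compose[OF lin[OF linear_coords(1)] der]) (use that in \<open>simp add: T_def\<close>)
    from has_derivative_compose[OF this lin[OF linear_coords(3)]]
    have "(g has_derivative g' v) (at v)" unfolding g_def g'_def .
    then show ?thesis by (rule has_derivative_at_withinI)
  qed
  have inj_g: "inj_on g T"
    using inj inj_coords unfolding g_def T_def inj_on_def by blast
  have "integrable lborel (\<lambda>x. indicator S x *\<^sub>R (J x * f (\<Psi> x)))"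
    using int by (simp add: set_integrable_def)
  then have int4: "integrable lborel (\<lambda>v. indicator S (chart_coords v) *\<^sub>R (J (chart_coords v) * f (\<Psi> (chart_coords v))))"
    using integrable_distr[of chart_coords lborel borel "\<lambda>x. indicator S x *\<^sub>R (J x * f (\<Psi> x))"]
    by (simp add: distr1)
  have indT: "indicator T v = (indicator S (chart_coords v) :: real)" for v
    by (simp add: T_def indicator_def)
  have intT: "set_integrable lborel T (\<lambda>v. \<bar>det (matrix (g' v))\<bar> * f (phase_coords (g v)))"
    using int4 by (simp add: set_integrable_def indT JT fg)
  then have absT: "(\<lambda>v. \<bar>det (matrix (g' v))\<bar> * f (phase_coords (g v))) absolutely_integrable_on T"
    using integrable_completion[OF borel_measurable_integrable] unfolding set_integrable_def by blast
  note cv = change_of_variables_real[where f = "\<lambda>y. f (phase_coords y)" and g = g and g' = g', OF _ der_g inj_g absT]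
  have T': "T \<in> sets lebesgue" using T by simp
  have fm: "(\<lambda>y. f (phase_coords y)) \<in> borel_measurable borel"
    using f by measurable
  have outside: "f (phase_coords y) = 0" if "y \<notin> g ` T" for y
  proof (rule zero)
    show "phase_coords y \<notin> \<Psi> ` S"
    proof
      assume "phase_coords y \<in> \<Psi> ` S"
      then obtain x where x: "x \<in> S" "phase_coords y = \<Psi> x" by blast
      obtain v where v: "chart_coords v = x" using chart_coords_surj by blast
      have "g v = y" using x(2) v phase_coords_inverse(2)[of y] by (simp add: g_def)
      moreover have "v \<in> T" using v x by (simp add: T_def)
      ultimately show False using that by blast
    qed
  qed
  have "(LINT \<rho>|lborel. f \<rho>) = (LINT y|lborel. f (phase_coords y))"
    by (subst distr2[symmetric], subst integral_distr) (use f in auto)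
  \<comment> \<open>The change of variables speaks of gauge integrals and the completed measure; the
    Borel measure is regained on the parameter side.\<close>
  also have "\<dots> = (LINT y|lebesgue. f (phase_coords y))"
    using fm by (intro integral_completion[symmetric]) simp
  also have "\<dots> = (LINT y:g ` T|lebesgue. f (phase_coords y))"
    unfolding set_lebesgue_integral_def
    by (intro Bochner_Integration.integral_cong refl) (use outside in \<open>auto simp: indicator_def\<close>)
  also have "\<dots> = integral (g ` T) (\<lambda>y. f (phase_coords y))"
    by (rule set_lebesgue_integral_eq_integral(2)[OF cv(1)[OF T']])
  also have "\<dots> = integral T (\<lambda>v. \<bar>det (matrix (g' v))\<bar> * f (phase_coords (g v)))"
    by (rule cv(2)[OF T'])
  also have "\<dots> = (LINT v:T|lborel. \<bar>det (matrix (g' v))\<bar> * f (phase_coords (g v)))"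
    by (rule set_borel_integral_eq_integral(2)[OF intT, symmetric])
  also have "\<dots> = (LINT v|lborel. indicator S (chart_coords v) *\<^sub>R (J (chart_coords v) * f (\<Psi> (chart_coords v))))"
    by (simp add: set_lebesgue_integral_def indT JT fg)
  also have "\<dots> = (LINT x:S|lborel. J x * f (\<Psi> x))"
    unfolding set_lebesgue_integral_def
    by (subst distr1[symmetric], subst integral_distr)
      (use int in \<open>auto simp: set_integrable_def dest: borel_measurable_integrable\<close>)
  finally show ?thesis .
qed

section \<open>The symplectic form in torus coordinates\<close>

lemma has_derivative_sympl:
  assumes "(f has_derivative f') (at x)" "(g has_derivative g') (at x)"
  shows "((\<lambda>x. sympl (f x) (g x)) has_derivative (\<lambda>h. sympl (f' h) (g x) + sympl (f x) (g' h))) (at x)"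
  unfolding sympl_def
  by (rule has_derivative_eq_rhs, (rule derivative_intros assms)+) (auto simp: algebra_simps)

lemma continuous_on_sympl:
  "continuous_on S f \<Longrightarrow> continuous_on S g \<Longrightarrow> continuous_on S (\<lambda>x. sympl (f x) (g x))"
  unfolding sympl_def by (intro continuous_intros)

lemma C1_on_slice:
  assumes "C1_on (B \<times> UNIV) f f'" "z \<in> B"
  shows "C1_on UNIV (\<lambda>t. f (z, t)) (\<lambda>t h. f' (z, t) (0, h))"
proof (rule C1_onI)
  fix t
  show "((\<lambda>t. f (z, t)) has_derivative (\<lambda>h. f' (z, t) (0, h))) (at t)"
    by (rule has_derivative_compose[where f = "\<lambda>t. (z, t)" and g' = "f' (z, t)"])
      (use C1_onD(1)[OF assms(1), of "(z, t)"] assms(2) in \<open>auto intro!: derivative_eq_intros\<close>)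
next
  fix v
  show "continuous_on UNIV (\<lambda>t. f' (z, t) (0, v))"
    by (rule continuous_on_compose2[OF C1_onD(2)[OF assms(1)]])
      (use assms(2) in \<open>auto intro!: continuous_intros\<close>)
qed

abbreviation angle_dir :: "2 \<Rightarrow> complex \<times> (real^2)" where
  "angle_dir k \<equiv> (0, axis k 1)"

section \<open>The pulled-back Liouville and symplectic forms\<close>

context torus_chart
begin

text \<open>The pullback under \<Psi> of the one-form xi dx, evaluated on a constant vector
  field.\<close>

definition liouville_form :: "complex \<times> (real^2) \<Rightarrow> complex \<times> (real^2) \<Rightarrow> real" where
  "liouville_form v x = snd (\<Psi> x) \<bullet> fst (dir_deriv v \<Psi> x)"

definition sympl_form :: "complex \<times> (real^2) \<Rightarrow> complex \<times> (real^2) \<Rightarrow> complex \<times> (real^2) \<Rightarrow> real" where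
  "sympl_form u v x = sympl (dir_deriv u \<Psi> x) (dir_deriv v \<Psi> x)"

text \<open>Once the Liouville form is closed on the torus, this mean is its integral over any
  coordinate loop in direction \<open>k\<close>, that is, the action of that loop.\<close>

definition mean_action :: "2 \<Rightarrow> complex \<Rightarrow> real" where
  "mean_action k z = integral (cbox 0 1) (\<lambda>t. liouville_form (angle_dir k) (z, t))"

lemma C1_on_liouville_form:
  "C1_on (ball z0 r \<times> UNIV) (liouville_form v)
     (\<lambda>x u. snd (dir_deriv u \<Psi> x) \<bullet> fst (dir_deriv v \<Psi> x) + snd (\<Psi> x) \<bullet> fst (dir_deriv u (dir_deriv v \<Psi>) x))"
  unfolding liouville_form_def
proof (rule C1_onI)
  fix x assume x: "x \<in> ball z0 r \<times> (UNIV :: (real^2) set)"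
  note d = smooth_on_has_derivative[OF smooth x]
    smooth_on_has_derivative[OF smooth_on_dir_deriv[OF smooth] x]
  show "((\<lambda>x. snd (\<Psi> x) \<bullet> fst (dir_deriv v \<Psi> x)) has_derivative (\<lambda>u. snd (dir_deriv u \<Psi> x) \<bullet> fst (dir_deriv v \<Psi> x)
       + snd (\<Psi> x) \<bullet> fst (dir_deriv u (dir_deriv v \<Psi>) x))) (at x)"
    by (rule has_derivative_eq_rhs, (rule derivative_intros d)+) auto
qed (intro continuous_intros smooth_on_continuous_on smooth_on_dir_deriv smooth)

lemma C1_on_sympl_form:
  "C1_on (ball z0 r \<times> UNIV) (sympl_form u v)
     (\<lambda>x w. sympl (dir_deriv w (dir_deriv u \<Psi>) x) (dir_deriv v \<Psi> x)
        + sympl (dir_deriv u \<Psi> x) (dir_deriv w (dir_deriv v \<Psi>) x))"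
  unfolding sympl_form_def
proof (rule C1_onI)
  fix x assume x: "x \<in> ball z0 r \<times> (UNIV :: (real^2) set)"
  note d = smooth_on_has_derivative[OF smooth_on_dir_deriv[OF smooth] x]
  show "((\<lambda>x. sympl (dir_deriv u \<Psi> x) (dir_deriv v \<Psi> x)) has_derivative (\<lambda>w. sympl (dir_deriv w (dir_deriv u \<Psi>) x) (dir_deriv v \<Psi> x)
        + sympl (dir_deriv u \<Psi> x) (dir_deriv w (dir_deriv v \<Psi>) x))) (at x)"
    by (rule has_derivative_sympl d)+
qed (intro continuous_intros continuous_on_sympl smooth_on_continuous_on smooth_on_dir_deriv smooth)

lemma dir_deriv_commute:
  assumes "z \<in> ball z0 r"
  shows "dir_deriv u (dir_deriv v \<Psi>) (z, t) = dir_deriv v (dir_deriv u \<Psi>) (z, t)"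
  by (rule smooth_on_dir_deriv_commute[OF _ smooth]) (use assms in \<open>auto intro!: open_Times\<close>)

lemma \<Psi>_periodic: "z \<in> ball z0 r \<Longrightarrow> int_vec m \<Longrightarrow> \<Psi> (z, t + m) = \<Psi> (z, t)"
  using \<Psi>_eq_iff[of z z "t + m" t] by simp

lemma dir_deriv_periodic:
  assumes z: "z \<in> ball z0 r" and m: "int_vec m"
  shows "dir_deriv v \<Psi> (z, t + m) = dir_deriv v \<Psi> (z, t)"
proof -
  have "((\<lambda>x. \<Psi> (fst x, snd x + m)) has_derivative (\<lambda>v. dir_deriv v \<Psi> (z, t + m))) (at (z, t))"
  proof (rule has_derivative_compose[where g' = "\<lambda>v. dir_deriv v \<Psi> (z, t + m)" and f' = "\<lambda>v. v"])
    have "((\<lambda>x. (fst x, snd x + m)) has_derivative (\<lambda>v. (fst v, snd v + 0))) (at (z, t))"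
      by (intro derivative_intros)
    then show "((\<lambda>x. (fst x, snd x + m)) has_derivative (\<lambda>v. v)) (at (z, t))" by simp
    show "(\<Psi> has_derivative (\<lambda>v. dir_deriv v \<Psi> (z, t + m))) (at (fst (z, t), snd (z, t) + m))"
      using \<Psi>_has_derivative[OF z] by simp
  qed
  then have "(\<Psi> has_derivative (\<lambda>v. dir_deriv v \<Psi> (z, t + m))) (at (z, t))"
    by (rule has_derivative_transform_within_open[of _ _ _ _ "ball z0 r \<times> UNIV"])
      (use z m \<Psi>_periodic in \<open>auto intro!: open_Times simp del: mem_ball\<close>)
  then show ?thesis by (simp add: has_derivative_imp_dir_deriv)
qed

lemma liouville_form_periodic:
  "z \<in> ball z0 r \<Longrightarrow> int_vec m \<Longrightarrow> liouville_form v (z, t + m) = liouville_form v (z, t)"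
  and sympl_form_periodic:
  "z \<in> ball z0 r \<Longrightarrow> int_vec m \<Longrightarrow> sympl_form u v (z, t + m) = sympl_form u v (z, t)"
  by (simp_all add: liouville_form_def sympl_form_def dir_deriv_periodic \<Psi>_periodic)

text \<open>Cartan's formula in coordinates: the change of the Liouville form in direction
  \<open>h\<close> is the symplectic form on \<open>h\<close> and the angle, plus the angular
  derivative of the periodic function \<open>liouville_form (h, 0)\<close>. The latter has mean
  zero.\<close>

lemma mean_action_has_derivative:
  assumes z: "z \<in> ball z0 r"
  shows "(mean_action k has_derivative
    (\<lambda>h. integral (cbox 0 1) (\<lambda>t. sympl_form (h, 0) (angle_dir k) (z, t)))) (at z)"
proof -
  let ?f' = "\<lambda>z t h. snd (dir_deriv (h, 0) \<Psi> (z, t)) \<bullet> fst (dir_deriv (angle_dir k) \<Psi> (z, t))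
     + snd (\<Psi> (z, t)) \<bullet> fst (dir_deriv (h, 0) (dir_deriv (angle_dir k) \<Psi>) (z, t))"
  note C1 = C1_on_liouville_form[of "angle_dir k"]
  have "(mean_action k has_derivative (\<lambda>h. integral (cbox 0 1) (\<lambda>t. ?f' z t h))) (at z)"
    unfolding mean_action_def
  proof (rule integral_has_derivative[OF open_ball convex_ball z])
    fix w and t :: "real^2" assume w: "w \<in> ball z0 r"
    show "((\<lambda>x. liouville_form (angle_dir k) (x, t)) has_derivative ?f' w t) (at w)"
      by (rule has_derivative_compose[where f = "\<lambda>x. (x, t)", OF _ C1_onD(1)[OF C1]])
        (use w in \<open>auto intro!: derivative_eq_intros\<close>)
  next
    fix w assume w: "w \<in> ball z0 r"
    show "continuous_on (cbox 0 1) (\<lambda>t. liouville_form (angle_dir k) (w, t))"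
      by (rule continuous_on_subset[OF C1_onD(3)[OF C1_on_slice[OF C1 w]]]) simp
  next
    fix h
    show "continuous_on (ball z0 r \<times> cbox 0 1) (\<lambda>(z, t). ?f' z t h)"
      using continuous_on_subset[OF C1_onD(2)[OF C1, of "(h, 0)"], of "ball z0 r \<times> cbox 0 1"]
      by (auto simp: case_prod_unfold)
  qed
  moreover have "integral (cbox 0 1) (\<lambda>t. ?f' z t h) =
      integral (cbox 0 1) (\<lambda>t. sympl_form (h, 0) (angle_dir k) (z, t))" for h
  proof -
    let ?g = "\<lambda>t h'. snd (dir_deriv (0, h') \<Psi> (z, t)) \<bullet> fst (dir_deriv (h, 0) \<Psi> (z, t))
      + snd (\<Psi> (z, t)) \<bullet> fst (dir_deriv (0, h') (dir_deriv (h, 0) \<Psi>) (z, t))"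
    note C1' = C1_on_slice[OF C1_on_liouville_form[of "(h, 0)"] z]
    have "integral (cbox 0 1) (\<lambda>t. ?g t (axis k 1)) = 0"
      by (rule integral_dir_deriv_periodic[OF C1_onD(1)[OF C1'] C1_onD(2)[OF C1']])
        (auto intro!: liouville_form_periodic z int_vec_axis)
    moreover have "?f' z t h = sympl_form (h, 0) (angle_dir k) (z, t) + ?g t (axis k 1)" for t
      using dir_deriv_commute[OF z, of "(h, 0)" "angle_dir k" t]
      by (simp add: sympl_form_def sympl_def)
    moreover have "(\<lambda>t. sympl_form (h, 0) (angle_dir k) (z, t)) integrable_on cbox 0 1"
      by (intro integrable_continuous continuous_on_subset[OF C1_onD(3)[OF C1_on_slice[OF C1_on_sympl_form z]]]) simp
    moreover have "(\<lambda>t. ?g t (axis k 1)) integrable_on cbox 0 1"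
      by (intro integrable_continuous continuous_on_subset[OF C1_onD(2)[OF C1']]) simp
    ultimately show ?thesis
      by (simp add: Henstock_Kurzweil_Integration.integral_add)
  qed
  ultimately show ?thesis by simp
qed

end

section \<open>Closedness from the Lagrangian condition\<close>

context lagrangian_torus_chart
begin

lemma sympl_form_angles: "z \<in> ball z0 r \<Longrightarrow> sympl_form (angle_dir i) (angle_dir j) (z, t) = 0"
  using sympl_tangent[of z t] sympl_swap[of "dir_deriv (angle_dir 2) \<Psi> (z, t)" "dir_deriv (angle_dir 1) \<Psi> (z, t)"] exhaust_2[of i] exhaust_2[of j]
  by (auto simp: sympl_form_def sympl_self)

text \<open>Mixed derivatives commute, so the two sides differ by the symplectic form on two angular
  directions, which vanishes on a Lagrangian torus.\<close>

lemma liouville_form_closed: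
  assumes z: "z \<in> ball z0 r"
  shows "snd (dir_deriv (angle_dir i) \<Psi> (z, t)) \<bullet> fst (dir_deriv (angle_dir j) \<Psi> (z, t))
       + snd (\<Psi> (z, t)) \<bullet> fst (dir_deriv (angle_dir i) (dir_deriv (angle_dir j) \<Psi>) (z, t)) =
     snd (dir_deriv (angle_dir j) \<Psi> (z, t)) \<bullet> fst (dir_deriv (angle_dir i) \<Psi> (z, t))
       + snd (\<Psi> (z, t)) \<bullet> fst (dir_deriv (angle_dir j) (dir_deriv (angle_dir i) \<Psi>) (z, t))"
  using sympl_form_angles[OF z, of i j t] dir_deriv_commute[OF z, of "angle_dir i" "angle_dir j" t]
  by (simp add: sympl_form_def sympl_def)

text \<open>\<open>d\<sigma> = 0\<close> evaluated on \<open>v\<close> and the two angular directions; the third term vanishes since the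
  tori are Lagrangian.\<close>

lemma sympl_form_closed:
  assumes z: "z \<in> ball z0 r"
  shows "sympl (dir_deriv (angle_dir i) (dir_deriv v \<Psi>) (z, t)) (dir_deriv (angle_dir j) \<Psi> (z, t))
        + sympl (dir_deriv v \<Psi> (z, t)) (dir_deriv (angle_dir i) (dir_deriv (angle_dir j) \<Psi>) (z, t)) =
     sympl (dir_deriv (angle_dir j) (dir_deriv v \<Psi>) (z, t)) (dir_deriv (angle_dir i) \<Psi> (z, t))
        + sympl (dir_deriv v \<Psi> (z, t)) (dir_deriv (angle_dir j) (dir_deriv (angle_dir i) \<Psi>) (z, t))"
proof -
  let ?D = "\<lambda>v. dir_deriv v \<Psi> (z, t)" and ?D2 = "\<lambda>u v. dir_deriv u (dir_deriv v \<Psi>) (z, t)"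
  have "(sympl_form (angle_dir i) (angle_dir j) has_derivative (\<lambda>w. sympl (?D2 w (angle_dir i)) (?D (angle_dir j))
        + sympl (?D (angle_dir i)) (?D2 w (angle_dir j)))) (at (z, t))"
    using C1_onD(1)[OF C1_on_sympl_form] z by simp
  moreover have "(sympl_form (angle_dir i) (angle_dir j) has_derivative (\<lambda>w. 0)) (at (z, t))"
    by (rule has_derivative_transform_within_open[of "\<lambda>x. 0" _ _ _ "ball z0 r \<times> UNIV"])
      (use z sympl_form_angles in \<open>auto intro!: open_Times simp del: mem_ball\<close>)
  ultimately have "(\<lambda>w. sympl (?D2 w (angle_dir i)) (?D (angle_dir j))
        + sympl (?D (angle_dir i)) (?D2 w (angle_dir j))) = (\<lambda>w. 0)"
    by (rule has_derivative_unique)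
  then have "sympl (?D2 v (angle_dir i)) (?D (angle_dir j)) + sympl (?D (angle_dir i)) (?D2 v (angle_dir j)) = 0"
    by (rule fun_cong)
  then show ?thesis
    using dir_deriv_commute[OF z, of "angle_dir i" "angle_dir j" t] dir_deriv_commute[OF z, of "angle_dir i" v t]
      dir_deriv_commute[OF z, of "angle_dir j" v t] sympl_swap[of "?D (angle_dir i)" "?D2 v (angle_dir j)"]
    by simp
qed

lemma integral_sympl_minor:
  assumes z: "z \<in> ball z0 r"
  shows "integral (cbox 0 1) (\<lambda>t. sympl_form u (angle_dir 1) (z, t) * sympl_form v (angle_dir 2) (z, t)
       - sympl_form u (angle_dir 2) (z, t) * sympl_form v (angle_dir 1) (z, t)) =
     integral (cbox 0 1) (\<lambda>t. sympl_form u (angle_dir 1) (z, t)) * integral (cbox 0 1) (\<lambda>t. sympl_form v (angle_dir 2) (z, t))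
     - integral (cbox 0 1) (\<lambda>t. sympl_form u (angle_dir 2) (z, t)) * integral (cbox 0 1) (\<lambda>t. sympl_form v (angle_dir 1) (z, t))"
  by (rule integral_wedge_closed_forms[OF C1_on_slice[OF C1_on_sympl_form z] C1_on_slice[OF C1_on_sympl_form z]
        C1_on_slice[OF C1_on_sympl_form z] C1_on_slice[OF C1_on_sympl_form z]])
    (intro sympl_form_closed sympl_form_periodic z; assumption)+

end

section \<open>Actions along lifted loops\<close>

context torus_chart
begin

text \<open>Near \<open>u\<close> the lift is the angle part of a local inverse of \<Psi> composed
  with the path, and that inverse is differentiable because the derivative of \<Psi> is
  injective.\<close>

lemma lift_has_derivative:
  fixes g :: "real \<Rightarrow> rphase"
  assumes z: "z \<in> ball z0 r" and u: "u \<in> {0<..<1}"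
    and \<theta>: "continuous_on {0..1} \<theta>" "\<And>s. s \<in> {0..1} \<Longrightarrow> \<Psi> (z, \<theta> s) = g s"
    and g: "(g has_derivative g') (at u)"
  obtains \<theta>' where "(\<theta> has_derivative \<theta>') (at u)" "\<And>h. dir_deriv (0, \<theta>' h) \<Psi> (z, \<theta> u) = g' h"
proof -
  let ?c = "\<theta> u"
  \<comment> \<open>Radius 1/2: two angles in the ball are less than 1 apart, so they cannot differ
    by a nonzero integer vector.\<close>
  let ?W = "ball z0 r \<times> ball ?c (1/2)"
  have openW: "open ?W" by (auto intro!: open_Times)
  have cont: "continuous_on ?W \<Psi>"
    by (rule continuous_on_subset[OF smooth_on_continuous_on[OF smooth]]) auto
  have inj: "inj_on \<Psi> ?W"
  proof (rule inj_onI, clarsimp simp del: mem_ball)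
    fix x s y t assume *: "x \<in> ball z0 r" "y \<in> ball z0 r" "\<Psi> (x, s) = \<Psi> (y, t)"
      "s \<in> ball ?c (1/2)" "t \<in> ball ?c (1/2)"
    then have "int_vec (s - t)" "x = y" using \<Psi>_eq_iff by auto
    moreover have "norm (s - t) < 1"
      using dist_triangle_half_r[of ?c s 1 t] *(4,5) by (simp add: dist_norm)
    then have "\<bar>(s - t) $ j\<bar> < 1" for j
      using component_le_norm_cart[of "s - t" j] by linarith
    ultimately show "x = y \<and> s = t" using int_vec_eq_0[of "s - t"] by simp
  qed
  define G where "G = inv_into ?W \<Psi>"
  have G: "G (\<Psi> x) = x" if "x \<in> ?W" for x
    using inj that by (simp add: G_def)
  have dims: "DIM(rphase) \<le> DIM(complex \<times> (real^2))" by simp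
  have contG: "continuous_on (\<Psi> ` ?W) G"
    by (rule continuous_on_inverse_open[OF openW cont dims G])
  have open_im: "open (\<Psi> ` ?W)"
    by (rule invariance_of_domain_gen[OF openW cont inj dims])
  have zc: "(z, ?c) \<in> ?W" using z by simp
  let ?L = "\<lambda>v. dir_deriv v \<Psi> (z, ?c)"
  have linL: "linear ?L" by (rule linear_dir_deriv[OF z])
  have "inj ?L"
    using dir_deriv_eq_0[OF z, of _ ?c] by (simp add: linear_injective_0[OF linL])
  then obtain M where M: "linear M" "M \<circ> ?L = id"
    using linear_injective_left_inverse[OF linL] by blast
  have dG: "(G has_derivative M) (at (\<Psi> (z, ?c)))"
  proof (rule has_derivative_inverse_basic[where f = \<Psi> and f' = ?L and T = "\<Psi> ` ?W"])
    show "(\<Psi> has_derivative ?L) (at (G (\<Psi> (z, ?c))))"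
      unfolding G[OF zc] by (rule \<Psi>_has_derivative[OF z])
    show "bounded_linear M" using M(1) by (simp add: linear_conv_bounded_linear)
    show "continuous (at (\<Psi> (z, ?c))) G"
      using contG open_im zc by (simp add: continuous_on_eq_continuous_at)
    show "\<Psi> (G y) = y" if "y \<in> \<Psi> ` ?W" for y
      using that G by auto
  qed (use M open_im zc in auto)
  have "isCont \<theta> u"
  proof -
    have "{0<..<1::real} \<subseteq> {0..1}" by auto
    from continuous_on_subset[OF \<theta>(1) this] show ?thesis
      using u by (simp add: continuous_on_eq_continuous_at)
  qed
  then have "(\<theta> \<longlongrightarrow> ?c) (at u)" by (simp add: isCont_def)
  \<comment> \<open>Continuity keeps the lift on the sheet chosen at \<open>u\<close>, where
    \<open>G\<close> undoes \<Psi>.\<close>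
  from topological_tendstoD[OF this open_ball, of ?c "1/2"]
  have ev: "\<forall>\<^sub>F s in at u. \<theta> s \<in> ball ?c (1/2)" by simp
  have evI: "\<forall>\<^sub>F s in at u. s \<in> {0<..<1}"
    using u eventually_at_in_open'[of "{0<..<1::real}" u] by simp
  have gu: "g u = \<Psi> (z, ?c)" using \<theta>(2)[of u] u by simp
  have "((\<lambda>s. snd (G (g s))) has_derivative (\<lambda>h. snd (M (g' h)))) (at u)"
    by (rule has_derivative_snd, rule has_derivative_compose[OF g]) (simp add: gu dG)
  then have d\<theta>: "(\<theta> has_derivative (\<lambda>h. snd (M (g' h)))) (at u)"
  proof (rule has_derivative_transform_eventually)
    show "\<forall>\<^sub>F s in at u. snd (G (g s)) = \<theta> s"
      using ev evI
    proof eventually_elim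
      case (elim s)
      then have "G (\<Psi> (z, \<theta> s)) = (z, \<theta> s)" using z by (intro G) simp
      then show ?case using \<theta>(2)[of s] elim by simp
    qed
    show "snd (G (g u)) = \<theta> u" unfolding gu by (simp only: G[OF zc] snd_conv)
  qed simp
  have "((\<lambda>s. \<Psi> (z, \<theta> s)) has_derivative (\<lambda>h. ?L (0, snd (M (g' h))))) (at u)"
    by (rule has_derivative_compose[where f = "\<lambda>s. (z, \<theta> s)", OF _ \<Psi>_has_derivative[OF z]])
      (intro has_derivative_Pair has_derivative_const d\<theta>)
  moreover have "((\<lambda>s. \<Psi> (z, \<theta> s)) has_derivative g') (at u)"
    by (rule has_derivative_transform_within_open[OF g, of "{0<..<1}"]) (use u \<theta>(2) in auto)
  ultimately have "(\<lambda>h. ?L (0, snd (M (g' h)))) = g'" by (rule has_derivative_unique)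
  then have "?L (0, snd (M (g' h))) = g' h" for h by (rule fun_cong)
  with d\<theta> show thesis by (rule that)
qed

end

context lagrangian_torus_chart
begin

text \<open>Along the lift the action integrand is the derivative of a primitive of the closed
  Liouville form. The action is therefore the increment of that primitive across an integer vector,
  which the means determine.\<close>

lemma action_eq_mean_actions:
  assumes z: "z \<in> ball z0 r" and g: "valid_path g" "pathfinish g = pathstart g"
    and \<theta>: "continuous_on {0..1} \<theta>" "\<And>s. s \<in> {0..1} \<Longrightarrow> \<Psi> (z, \<theta> s) = g s"
    and w: "w = \<theta> 1 - \<theta> 0"
  shows "action g = w $ 1 * mean_action 1 z + w $ 2 * mean_action 2 z"
proof -
  note slice = C1_on_slice[OF C1_on_liouville_form z]
  obtain F where F: "C1_on UNIV F (\<lambda>t h. h $ 1 * liouville_form (angle_dir 1) (z, t) + h $ 2 * liouville_form (angle_dir 2) (z, t))"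
    using closed_form_primitive[OF slice slice liouville_form_closed[OF z]] by blast
  obtain S where S: "finite S" "g C1_differentiable_on ({0..1} - S)"
    using g(1) unfolding valid_path_def piecewise_C1_differentiable_on_def by blast
  then obtain D where D: "\<And>u. u \<in> {0..1} - S \<Longrightarrow> (g has_vector_derivative D u) (at u)"
    unfolding C1_differentiable_on_def by blast
  have "((\<lambda>u. snd (g u) \<bullet> fst (vector_derivative g (at u within {0..1}))) has_integral (F (\<theta> 1) - F (\<theta> 0))) {0..1}"
  \<comment> \<open>The loop is only piecewise C1: its derivative is known off a finite set, and
    continuity of \<open>F\<close> along the lift covers the rest.\<close>
  proof (rule fundamental_theorem_of_calculus_interior_strong[OF S(1)])
    fix u :: real assume u: "u \<in> {0<..<1} - S"
    then have Du: "(g has_derivative (\<lambda>h. h *\<^sub>R D u)) (at u)"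
      using D[of u] by (simp add: has_vector_derivative_def)
    have "vector_derivative g (at u within {0..1}) = D u"
      using u D[of u] at_within_Icc_at[of 0 u 1] by (simp add: vector_derivative_at)
    moreover obtain \<theta>' where \<theta>': "(\<theta> has_derivative \<theta>') (at u)"
      "\<And>h. dir_deriv (0, \<theta>' h) \<Psi> (z, \<theta> u) = h *\<^sub>R D u"
      using lift_has_derivative[OF z _ \<theta> Du] u by blast
    have "((\<lambda>u. F (\<theta> u)) has_derivative (\<lambda>h. \<theta>' h $ 1 * liouville_form (angle_dir 1) (z, \<theta> u)
        + \<theta>' h $ 2 * liouville_form (angle_dir 2) (z, \<theta> u))) (at u)"
      using has_derivative_compose[OF \<theta>'(1) C1_onD(1)[OF F UNIV_I]] .
    moreover have "\<theta>' h $ 1 * liouville_form (angle_dir 1) (z, \<theta> u)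
        + \<theta>' h $ 2 * liouville_form (angle_dir 2) (z, \<theta> u) = h *\<^sub>R (snd (g u) \<bullet> fst (D u))" for h
    proof -
      have v: "(0, \<theta>' h) = \<theta>' h $ 1 *\<^sub>R angle_dir 1 + \<theta>' h $ 2 *\<^sub>R angle_dir 2"
        by (simp add: vec_eq_iff forall_2)
      have "h *\<^sub>R D u = dir_deriv (\<theta>' h $ 1 *\<^sub>R angle_dir 1 + \<theta>' h $ 2 *\<^sub>R angle_dir 2) \<Psi> (z, \<theta> u)"
        unfolding v[symmetric] by (rule \<theta>'(2)[symmetric])
      also have "\<dots> = \<theta>' h $ 1 *\<^sub>R dir_deriv (angle_dir 1) \<Psi> (z, \<theta> u)
          + \<theta>' h $ 2 *\<^sub>R dir_deriv (angle_dir 2) \<Psi> (z, \<theta> u)"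
        by (simp only: linear_add[OF linear_dir_deriv[OF z]] linear_cmul[OF linear_dir_deriv[OF z]])
      finally have "h *\<^sub>R fst (D u) = \<theta>' h $ 1 *\<^sub>R fst (dir_deriv (angle_dir 1) \<Psi> (z, \<theta> u))
          + \<theta>' h $ 2 *\<^sub>R fst (dir_deriv (angle_dir 2) \<Psi> (z, \<theta> u))"
        by (auto dest!: arg_cong[where f = fst])
      then have "snd (g u) \<bullet> (h *\<^sub>R fst (D u)) = snd (g u) \<bullet> (\<theta>' h $ 1 *\<^sub>R fst (dir_deriv (angle_dir 1) \<Psi> (z, \<theta> u))
          + \<theta>' h $ 2 *\<^sub>R fst (dir_deriv (angle_dir 2) \<Psi> (z, \<theta> u)))" by simp
      then show ?thesis
        using \<theta>(2)[of u] u by (simp add: liouville_form_def inner_add_right)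
    qed
    ultimately show "((\<lambda>u. F (\<theta> u)) has_vector_derivative snd (g u) \<bullet> fst (vector_derivative g (at u within {0..1}))) (at u)"
      by (simp add: has_vector_derivative_def)
  next
    show "continuous_on {0..1} (\<lambda>u. F (\<theta> u))"
      by (rule continuous_on_compose2[OF C1_onD(3)[OF F] \<theta>(1)]) simp
  qed simp
  then have "action g = F (\<theta> 1) - F (\<theta> 0)"
    unfolding action_def by (rule integral_unique)
  also have "\<dots> = F (\<theta> 0 + w) - F (\<theta> 0)" by (simp add: w)
  also have "\<dots> = w $ 1 * mean_action 1 z + w $ 2 * mean_action 2 z"
    unfolding mean_action_def
  proof (rule primitive_shift[OF F C1_onD(3)[OF slice] C1_onD(3)[OF slice]])
    show "int_vec w"
      unfolding w using g(2) \<theta>(2)[of 0] \<theta>(2)[of 1] \<Psi>_eq_iff[OF z z, of "\<theta> 1" "\<theta> 0"]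
      by (simp add: pathfinish_def pathstart_def)
  qed (auto intro: liouville_form_periodic z)
  finally show ?thesis .
qed

text \<open>Lifting over the ball times the interval at once makes the increment continuous in
  \<open>z\<close>; as an integer vector it is constant. Hence the winding coefficients behave as
  constants when actions are differentiated.\<close>

lemma loop_family_lift:
  assumes sub: "ball z0 r \<subseteq> V" and \<gamma>: "loop_family V (\<lambda>z. {\<rho>. q \<rho> = z}) \<gamma>"
  shows "\<exists>\<theta> w. \<forall>z\<in>ball z0 r. continuous_on {0..1} (\<theta> z) \<and>
    (\<forall>u\<in>{0..1}. \<Psi> (z, \<theta> z u) = \<gamma> z u) \<and> w = \<theta> z 1 - \<theta> z 0"
proof -
  let ?U = "ball z0 r \<times> {0..1::real}"
  have conv: "convex ?U" by (intro convex_Times convex_ball convex_real_interval)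
  have cont: "continuous_on ?U (\<lambda>(z, t). \<gamma> z t)"
    using \<gamma> sub unfolding loop_family_def by (meson Sigma_mono continuous_on_subset order_refl)
  have \<gamma>': "pathfinish (\<gamma> z) = pathstart (\<gamma> z)" "path_image (\<gamma> z) \<subseteq> {\<rho>. q \<rho> = z}"
    if "z \<in> ball z0 r" for z
    using \<gamma> sub that unfolding loop_family_def by blast+
  have q: "q (\<gamma> z u) = z" if "z \<in> ball z0 r" "u \<in> {0..1}" for z u
    using \<gamma>'(2)[OF that(1)] that(2) by (force simp: path_image_def)
  obtain \<theta> where \<theta>: "continuous_on ?U \<theta>"
    "\<And>x. x \<in> ?U \<Longrightarrow> \<Psi> (q (case x of (z, t) \<Rightarrow> \<gamma> z t), \<theta> x) = (case x of (z, t) \<Rightarrow> \<gamma> z t)"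
    by (rule lift_exists[OF convex_imp_simply_connected[OF conv] convex_imp_locally_path_connected[OF conv] cont])
      (use q in \<open>force+\<close>)
  have \<Psi>\<theta>: "\<Psi> (z, \<theta> (z, u)) = \<gamma> z u" if "z \<in> ball z0 r" "u \<in> {0..1}" for z u
    using \<theta>(2)[of "(z, u)"] q[OF that] that by simp
  have edge: "continuous_on (ball z0 r) (\<lambda>z. \<theta> (z, s))" if "s \<in> {0..1}" for s
    by (rule continuous_on_compose2[OF \<theta>(1)]) (use that in \<open>auto intro!: continuous_intros\<close>)
  have w: "\<theta> (z, 1) - \<theta> (z, 0) = \<theta> (z0, 1) - \<theta> (z0, 0)" if z: "z \<in> ball z0 r" for z
  proof (rule int_vec_continuous_const[of "ball z0 r" "\<lambda>z. \<theta> (z, 1) - \<theta> (z, 0)"])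
    fix z assume z: "z \<in> ball z0 r"
    then show "int_vec (\<theta> (z, 1) - \<theta> (z, 0))"
      using \<Psi>\<theta>[OF z, of 0] \<Psi>\<theta>[OF z, of 1] \<gamma>'(1)[OF z] \<Psi>_eq_iff[OF z z, of "\<theta> (z, 1)" "\<theta> (z, 0)"]
      by (simp add: pathfinish_def pathstart_def)
  qed (use z r_pos in \<open>auto intro!: continuous_intros edge\<close>)
  have "continuous_on {0..1} (\<lambda>u. \<theta> (z, u))" if "z \<in> ball z0 r" for z
    by (rule continuous_on_compose2[OF \<theta>(1)]) (use that in \<open>auto intro!: continuous_intros\<close>)
  then show ?thesis
    using w \<Psi>\<theta> by (intro exI[of _ "\<lambda>z u. \<theta> (z, u)"] exI[of _ "\<theta> (z0, 1) - \<theta> (z0, 0)"]) auto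
qed

text \<open>The differentials of the actions are those of the mean actions transformed by the
  constant winding matrix. Its determinant and the sign in the spectral density both have modulus 1
  and disappear in the absolute value.\<close>

lemma spectral_density_eq_integral:
  assumes sub: "ball z0 r \<subseteq> V" and cycles: "fundamental_cycles V (\<lambda>z. {\<rho>. q \<rho> = z}) \<gamma>1 \<gamma>2"
    and omega: "spectral_density V (\<lambda>z. action (\<gamma>1 z)) (\<lambda>z. action (\<gamma>2 z)) \<omega>"
    and z: "z \<in> ball z0 r"
  shows "\<omega> z = \<bar>integral (cbox 0 1) (\<lambda>t. sympl_form (1, 0) (angle_dir 1) (z, t) * sympl_form (\<i>, 0) (angle_dir 2) (z, t)
       - sympl_form (1, 0) (angle_dir 2) (z, t) * sympl_form (\<i>, 0) (angle_dir 1) (z, t))\<bar>"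
proof -
  have fam: "loop_family V (\<lambda>z. {\<rho>. q \<rho> = z}) \<gamma>1" "loop_family V (\<lambda>z. {\<rho>. q \<rho> = z}) \<gamma>2"
    and basis: "homology_basis {\<rho>. q \<rho> = z} (\<gamma>1 z) (\<gamma>2 z)"
    using cycles z sub unfolding fundamental_cycles_def by blast+
  obtain \<theta>1 w1 where \<theta>1:
    "\<And>z. z \<in> ball z0 r \<Longrightarrow> continuous_on {0..1} (\<theta>1 z)"
    "\<And>z u. z \<in> ball z0 r \<Longrightarrow> u \<in> {0..1} \<Longrightarrow> \<Psi> (z, \<theta>1 z u) = \<gamma>1 z u"
    "\<And>z. z \<in> ball z0 r \<Longrightarrow> w1 = \<theta>1 z 1 - \<theta>1 z 0"
    using loop_family_lift[OF sub fam(1)] by metis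
  obtain \<theta>2 w2 where \<theta>2:
    "\<And>z. z \<in> ball z0 r \<Longrightarrow> continuous_on {0..1} (\<theta>2 z)"
    "\<And>z u. z \<in> ball z0 r \<Longrightarrow> u \<in> {0..1} \<Longrightarrow> \<Psi> (z, \<theta>2 z u) = \<gamma>2 z u"
    "\<And>z. z \<in> ball z0 r \<Longrightarrow> w2 = \<theta>2 z 1 - \<theta>2 z 0"
    using loop_family_lift[OF sub fam(2)] by metis
  have loops: "valid_path (\<gamma>1 x)" "pathfinish (\<gamma>1 x) = pathstart (\<gamma>1 x)" "path_image (\<gamma>1 x) \<subseteq> {\<rho>. q \<rho> = x}"
    "valid_path (\<gamma>2 x)" "pathfinish (\<gamma>2 x) = pathstart (\<gamma>2 x)" "path_image (\<gamma>2 x) \<subseteq> {\<rho>. q \<rho> = x}"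
    if "x \<in> ball z0 r" for x
    using fam sub that unfolding loop_family_def by blast+
  let ?S = "\<lambda>k h. integral (cbox 0 1) (\<lambda>t. sympl_form (h, 0) (angle_dir k) (z, t))"
  have d: "frechet_derivative (\<lambda>z. action (\<gamma> z)) (at z) = (\<lambda>h. w $ 1 * ?S 1 h + w $ 2 * ?S 2 h)"
    if "\<And>x. x \<in> ball z0 r \<Longrightarrow> action (\<gamma> x) = w $ 1 * mean_action 1 x + w $ 2 * mean_action 2 x" for \<gamma> w
  proof -
    have "((\<lambda>x. w $ 1 * mean_action 1 x + w $ 2 * mean_action 2 x) has_derivative
        (\<lambda>h. w $ 1 * ?S 1 h + w $ 2 * ?S 2 h)) (at z)"
      by (intro derivative_intros mean_action_has_derivative z)
    then have "((\<lambda>z. action (\<gamma> z)) has_derivative (\<lambda>h. w $ 1 * ?S 1 h + w $ 2 * ?S 2 h)) (at z)"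
      by (rule has_derivative_transform_within_open[OF _ open_ball z]) (simp only: that)
    then show ?thesis by (simp add: frechet_derivative_at[symmetric])
  qed
  have a1: "action (\<gamma>1 x) = w1 $ 1 * mean_action 1 x + w1 $ 2 * mean_action 2 x" if x: "x \<in> ball z0 r" for x
    using action_eq_mean_actions[OF x loops(1)[OF x] loops(2)[OF x] \<theta>1(1)[OF x] \<theta>1(2)[OF x] \<theta>1(3)[OF x]] .
  have a2: "action (\<gamma>2 x) = w2 $ 1 * mean_action 1 x + w2 $ 2 * mean_action 2 x" if x: "x \<in> ball z0 r" for x
    using action_eq_mean_actions[OF x loops(4)[OF x] loops(5)[OF x] \<theta>2(1)[OF x] \<theta>2(2)[OF x] \<theta>2(3)[OF x]] .
  have d1: "frechet_derivative (\<lambda>z. action (\<gamma>1 z)) (at z) = (\<lambda>h. w1 $ 1 * ?S 1 h + w1 $ 2 * ?S 2 h)"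
    by (rule d) (rule a1)
  have d2: "frechet_derivative (\<lambda>z. action (\<gamma>2 z)) (at z) = (\<lambda>h. w2 $ 1 * ?S 1 h + w2 $ 2 * ?S 2 h)"
    by (rule d) (rule a2)
  have det: "\<bar>w1 $ 1 * w2 $ 2 - w1 $ 2 * w2 $ 1\<bar> = 1"
    by (rule homology_basis_winding_det[OF z basis valid_path_imp_path[OF loops(1)[OF z]] loops(3)[OF z] loops(2)[OF z]
        valid_path_imp_path[OF loops(4)[OF z]] loops(6)[OF z] loops(5)[OF z]
        \<theta>1(1)[OF z] \<theta>1(2)[OF z] \<theta>2(1)[OF z] \<theta>2(2)[OF z] \<theta>1(3)[OF z] \<theta>2(3)[OF z]])
  obtain \<sigma> :: real where \<sigma>: "\<sigma> \<in> {1, -1}" and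
    wedge: "\<And>u v. wedge (frechet_derivative (\<lambda>z. action (\<gamma>1 z)) (at z)) (frechet_derivative (\<lambda>z. action (\<gamma>2 z)) (at z)) u v
          = \<sigma> * \<omega> z * wedge Re Im u v"
    and pos: "\<omega> z > 0"
    using omega z sub unfolding spectral_density_def by blast
  \<comment> \<open>Two-forms on the plane are compared on the pair 1, \<open>\<i>\<close>, where
    \<open>wedge Re Im\<close> equals 1.\<close>
  have "\<sigma> * \<omega> z = \<sigma> * \<omega> z * wedge Re Im 1 \<i>" by (simp add: wedge_def)
  also have "\<sigma> * \<omega> z * wedge Re Im 1 \<i> = (w1 $ 1 * w2 $ 2 - w1 $ 2 * w2 $ 1) * (?S 1 1 * ?S 2 \<i> - ?S 2 1 * ?S 1 \<i>)"
    unfolding wedge[symmetric] d1 d2 by (simp add: wedge_def algebra_simps)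
  finally have "\<bar>\<sigma> * \<omega> z\<bar> = \<bar>?S 1 1 * ?S 2 \<i> - ?S 2 1 * ?S 1 \<i>\<bar>"
    by (simp add: abs_mult det)
  moreover have "\<bar>\<sigma> * \<omega> z\<bar> = \<omega> z" using \<sigma> pos by auto
  ultimately show ?thesis by (simp add: integral_sympl_minor[OF z])
qed

end

section \<open>The Weyl density\<close>

text \<open>Half the square of the symplectic form is the volume form up to sign, so the determinant
  is minus the Pfaffian of the symplectic products of the four columns. The last term is the one
  removed by the Lagrangian condition.\<close>

lemma det_sympl:
  assumes "f (axis 1 1) = coords_phase a" "f (axis 2 1) = coords_phase b"
    "f (axis 3 1) = coords_phase s" "f (axis 4 1) = coords_phase t"
  shows "det (matrix f :: real^4^4) = sympl a s * sympl b t - sympl a t * sympl b s - sympl a b * sympl s t"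
  unfolding det_4 matrix_def sympl_coords
  by (simp add: assms coords_phase_nth algebra_simps)

text \<open>A fundamental domain for integer translations: every orbit meets it exactly
  once.\<close>

definition half_open_square :: "(real^2) set" where
  "half_open_square = {t. \<forall>j. 0 \<le> t $ j \<and> t $ j < 1}"

lemma half_open_square_borel: "half_open_square \<in> sets borel"
proof -
  have eq: "half_open_square = {t. 0 \<le> t $ 1} \<inter> {t. t $ 1 < 1} \<inter> ({t. 0 \<le> t $ 2} \<inter> {t. t $ 2 < 1})"
    by (auto simp: half_open_square_def forall_2)
  show ?thesis
    unfolding eq by (intro sets.Int borel_closed borel_open closed_halfspace_component_ge_cart
        open_halfspace_component_lt_cart)
qed

lemma integral_half_open_square:
  fixes f :: "real^2 \<Rightarrow> real"
  assumes "continuous_on UNIV f"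
  shows "(LINT t:half_open_square|lborel. f t) = integral (cbox 0 1) f"
proof -
  have sub: "half_open_square \<subseteq> cbox 0 1" "box 0 1 \<subseteq> half_open_square"
    by (auto simp: half_open_square_def mem_box_cart less_imp_le)
  have "set_integrable lborel (cbox 0 1) f"
    using borel_integrable_compact[OF compact_cbox continuous_on_subset[OF assms]]
    by (simp add: set_integrable_def)
  then have "set_integrable lborel half_open_square f"
    by (rule set_integrable_subset) (use half_open_square_borel sub in auto)
  then have "(LINT t:half_open_square|lborel. f t) = integral half_open_square f"
    by (rule set_borel_integral_eq_integral(2))
  also have "\<dots> = integral (cbox 0 1) f"
  proof (rule integral_spike_set)
    show "negligible {x \<in> half_open_square - cbox 0 1. f x \<noteq> 0}"
      by (rule negligible_subset[OF negligible_empty]) (use sub in auto)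
    show "negligible {x \<in> cbox 0 1 - half_open_square. f x \<noteq> 0}"
      by (rule negligible_subset[OF negligible_frontier_interval[of 0 1]]) (use sub in auto)
  qed
  finally show ?thesis .
qed

section \<open>Integration over the fibres of the symbol\<close>

context lagrangian_torus_chart
begin

definition sympl_minor :: "complex \<times> (real^2) \<Rightarrow> real" where
  "sympl_minor x = sympl_form (1, 0) (angle_dir 1) x * sympl_form (\<i>, 0) (angle_dir 2) x
       - sympl_form (1, 0) (angle_dir 2) x * sympl_form (\<i>, 0) (angle_dir 1) x"

lemma continuous_on_sympl_minor: "continuous_on (ball z0 r \<times> UNIV) sympl_minor"
  unfolding sympl_minor_def by (intro continuous_intros C1_onD(3)[OF C1_on_sympl_form])

lemma continuous_on_sympl_minor_slice:
  "z \<in> ball z0 r \<Longrightarrow> continuous_on UNIV (\<lambda>t. sympl_minor (z, t))"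
  by (rule continuous_on_compose2[OF continuous_on_sympl_minor]) (auto intro!: continuous_intros)

lemma det_\<Psi>:
  assumes z: "z \<in> ball z0 r"
  shows "det (matrix (\<lambda>v. coords_phase (dir_deriv (chart_coords v) \<Psi> (z, t)))) = sympl_minor (z, t)"
proof -
  let ?f = "\<lambda>v. coords_phase (dir_deriv (chart_coords v) \<Psi> (z, t))"
  have "det (matrix ?f) =
     sympl_form (1, 0) (angle_dir 1) (z, t) * sympl_form (\<i>, 0) (angle_dir 2) (z, t)
       - sympl_form (1, 0) (angle_dir 2) (z, t) * sympl_form (\<i>, 0) (angle_dir 1) (z, t)
       - sympl_form (1, 0) (\<i>, 0) (z, t) * sympl_form (angle_dir 1) (angle_dir 2) (z, t)"
    unfolding sympl_form_def by (rule det_sympl) (simp_all only: chart_coords_axis)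
  then show ?thesis by (simp add: sympl_minor_def sympl_form_angles[OF z])
qed

lemma sympl_minor_nonzero:
  assumes z: "z \<in> ball z0 r"
  shows "sympl_minor (z, t) \<noteq> 0"
proof -
  let ?f = "\<lambda>v. coords_phase (dir_deriv (chart_coords v) \<Psi> (z, t))"
  have lin: "linear ?f"
    using linear_compose[OF linear_compose[OF linear_coords(1) linear_dir_deriv[OF z, of t]] linear_coords(3)]
    by (simp add: o_def)
  have "inj (\<lambda>v. dir_deriv v \<Psi> (z, t))"
    using dir_deriv_eq_0[OF z, of _ t] by (simp add: linear_injective_0[OF linear_dir_deriv[OF z]])
  then have "inj ?f"
    using inj_coords unfolding inj_def by blast
  then have "det (matrix ?f) \<noteq> 0"
    using det_nz_iff_inj[OF lin] by simp
  then show ?thesis by (simp add: det_\<Psi>[OF z])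
qed

text \<open>The change of variables puts the modulus inside the integral, the determinant of periods
  outside. A continuous function without zeros on the plane has constant sign, which reconciles the
  two.\<close>

lemma abs_integral_sympl_minor:
  assumes z: "z \<in> ball z0 r"
  shows "\<bar>integral (cbox 0 1) (\<lambda>t. sympl_minor (z, t))\<bar> = integral (cbox 0 1) (\<lambda>t. \<bar>sympl_minor (z, t)\<bar>)"
proof -
  let ?m = "\<lambda>t. sympl_minor (z, t)"
  have conn: "connected (range ?m)"
    by (rule connected_continuous_image[OF continuous_on_sympl_minor_slice[OF z] connected_UNIV])
  have "(\<forall>t. ?m t > 0) \<or> (\<forall>t. ?m t < 0)"
  proof (rule ccontr)
    assume "\<not> ?thesis"
    then obtain s t where "?m s \<le> 0" "0 \<le> ?m t" by (meson linorder_not_less)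
    then have "0 \<in> range ?m"
      using connectedD_interval[OF conn, of "?m s" "?m t" 0] by blast
    then show False using sympl_minor_nonzero[OF z] by auto
  qed
  moreover have int: "?m integrable_on cbox 0 1"
    by (intro integrable_continuous continuous_on_subset[OF continuous_on_sympl_minor_slice[OF z]]) simp
  ultimately show ?thesis
  proof (elim disjE)
    assume pos: "\<forall>t. ?m t > 0"
    have "integral (cbox 0 1) ?m \<ge> 0" using pos by (intro integral_nonneg int) (auto intro: less_imp_le)
    moreover have "(\<lambda>t. \<bar>?m t\<bar>) = ?m" using pos by (simp add: fun_eq_iff less_imp_le)
    ultimately show ?thesis by simp
  next
    assume neg: "\<forall>t. ?m t < 0"
    have "integral (cbox 0 1) (\<lambda>t. - ?m t) \<ge> 0"
      using neg int by (intro integral_nonneg integrable_neg) (auto intro: less_imp_le)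
    moreover have "(\<lambda>t. \<bar>?m t\<bar>) = (\<lambda>t. - ?m t)" using neg by (simp add: fun_eq_iff less_imp_le abs_if)
    ultimately show ?thesis by simp
  qed
qed

text \<open>Change of variables on the ball times the fundamental square, where the symbol becomes
  the first coordinate, followed by Fubini with the angles innermost.\<close>

lemma integral_symbol_pushforward:
  fixes f :: "complex \<Rightarrow> real"
  assumes cont: "continuous_on UNIV f" and s: "s < r" and supp: "\<And>z. z \<notin> cball z0 s \<Longrightarrow> f z = 0"
  shows "(LINT \<rho>|lborel. f (q \<rho>)) =
    (LINT z|lborel. f z * \<bar>integral (cbox 0 1) (\<lambda>t. sympl_minor (z, t))\<bar>)"
proof -
  let ?S = "ball z0 r \<times> half_open_square" and ?K = "cball z0 s \<times> cbox 0 (1::real^2)"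
  have S: "?S \<in> sets borel"
    using half_open_square_borel by (intro borel_Times) auto
  have sub: "cball z0 s \<subseteq> ball z0 r" using s by auto
  have contK: "continuous_on ?K (\<lambda>x. \<bar>sympl_minor x\<bar> * f (fst x))"
    using sub by (intro continuous_intros continuous_on_subset[OF continuous_on_sympl_minor]
        continuous_on_compose2[OF cont]) auto
  \<comment> \<open>Support in a smaller closed ball places the integrand on a compact set where it
    is continuous; no bound on the minor is available towards the boundary of the chart.\<close>
  have "integrable lborel (\<lambda>x. indicator ?K x *\<^sub>R (\<bar>sympl_minor x\<bar> * f (fst x)))"
    by (rule borel_integrable_compact[OF _ contK]) (intro compact_Times compact_cball compact_cbox)
  from integrable_mult_indicator[OF _ this, of ?S]
  have "integrable lborel (\<lambda>x. indicator ?S x *\<^sub>R (indicator ?K x *\<^sub>R (\<bar>sympl_minor x\<bar> * f (fst x))))"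
    using S by simp
  moreover have "(\<lambda>x. indicator ?S x *\<^sub>R (indicator ?K x *\<^sub>R (\<bar>sympl_minor x\<bar> * f (fst x)))) =
      (\<lambda>x. indicator ?S x *\<^sub>R (\<bar>sympl_minor x\<bar> * f (fst x)))"
  proof
    fix x :: "complex \<times> (real^2)"
    have "x \<in> ?K" if "x \<in> ?S" "f (fst x) \<noteq> 0"
      using that supp[of "fst x"] by (cases x) (auto simp: half_open_square_def mem_box_cart less_imp_le)
    then show "indicator ?S x *\<^sub>R (indicator ?K x *\<^sub>R (\<bar>sympl_minor x\<bar> * f (fst x))) =
      indicator ?S x *\<^sub>R (\<bar>sympl_minor x\<bar> * f (fst x))"
      by (cases "f (fst x) = 0"; cases "x \<in> ?S") simp_all
  qed
  ultimately have int: "integrable lborel (\<lambda>x. indicator ?S x *\<^sub>R (\<bar>sympl_minor x\<bar> * f (fst x)))"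
    by simp
  let ?J = "\<lambda>x. \<bar>det (matrix (\<lambda>v. coords_phase (dir_deriv (chart_coords v) \<Psi> x)))\<bar>"
  have J: "indicator ?S x *\<^sub>R (?J x * f (q (\<Psi> x))) = indicator ?S x *\<^sub>R (\<bar>sympl_minor x\<bar> * f (fst x))" for x
    by (cases x; cases "x \<in> ?S") (simp_all add: det_\<Psi> q_\<Psi> del: mem_ball)
  have contq: "continuous_on UNIV q"
    using has_derivative_continuous[OF q_deriv] by (simp add: continuous_at_imp_continuous_on)
  have "(LINT \<rho>|lborel. f (q \<rho>)) = (LINT x:?S|lborel. ?J x * f (q (\<Psi> x)))"
  proof (rule phase_integral_change_of_variables[OF S])
    show "(\<lambda>\<rho>. f (q \<rho>)) \<in> borel_measurable borel"
      by (intro borel_measurable_continuous_onI continuous_on_compose2[OF cont contq]) simp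
    show "(\<Psi> has_derivative (\<lambda>v. dir_deriv v \<Psi> x)) (at x)" if "x \<in> ?S" for x
      using that by (intro smooth_on_has_derivative[OF smooth]) auto
    show "inj_on \<Psi> ?S"
    proof (rule inj_onI, clarsimp simp del: mem_ball)
      fix x s y t assume *: "x \<in> ball z0 r" "y \<in> ball z0 r" "\<Psi> (x, s) = \<Psi> (y, t)"
        "s \<in> half_open_square" "t \<in> half_open_square"
      then have "int_vec (s - t)" "x = y" using \<Psi>_eq_iff by auto
      moreover have "\<bar>(s - t) $ j\<bar> < 1" for j
      proof -
        have "0 \<le> s $ j" "s $ j < 1" "0 \<le> t $ j" "t $ j < 1"
          using *(4,5) by (auto simp: half_open_square_def)
        then show ?thesis by simp
      qed
      ultimately show "x = y \<and> s = t" using int_vec_eq_0[of "s - t"] by simp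
    qed
    show "set_integrable lborel ?S (\<lambda>x. ?J x * f (q (\<Psi> x)))"
      unfolding set_integrable_def J by (rule int)
    fix \<rho> assume \<rho>: "\<rho> \<notin> \<Psi> ` ?S"
    show "f (q \<rho>) = 0"
    proof (rule ccontr)
      assume "f (q \<rho>) \<noteq> 0"
      then have z: "q \<rho> \<in> ball z0 r" using supp sub by blast
      then obtain t where t: "\<Psi> (q \<rho>, t) = \<rho>" using \<Psi>_surj by blast
      \<comment> \<open>Subtracting integer parts moves the angles into the fundamental
        square.\<close>
      let ?m = "(\<chi> j. - of_int \<lfloor>t $ j\<rfloor>) :: real^2"
      have "int_vec ?m" by (simp add: int_vec_def)
      then have eq: "\<Psi> (q \<rho>, t + ?m) = \<rho>" using \<Psi>_periodic[OF z] t by simp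
      have "t + ?m \<in> half_open_square"
        unfolding half_open_square_def by (simp add: less_diff_eq[symmetric]; linarith)
      then have "\<Psi> (q \<rho>, t + ?m) \<in> \<Psi> ` ?S" using z by (intro imageI SigmaI)
      then have "\<rho> \<in> \<Psi> ` ?S" unfolding eq .
      then show False using \<rho> by blast
    qed
  qed
  also have "\<dots> = (LINT x|(lborel \<Otimes>\<^sub>M lborel). indicator ?S x *\<^sub>R (\<bar>sympl_minor x\<bar> * f (fst x)))"
    unfolding set_lebesgue_integral_def J by (simp add: lborel_prod)
  also have "\<dots> = (LINT z|lborel. LINT t|lborel. indicator ?S (z, t) *\<^sub>R (\<bar>sympl_minor (z, t)\<bar> * f (fst (z, t))))"
    by (rule lborel_pair.integral_fst'[symmetric]) (use int in \<open>simp add: lborel_prod\<close>)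
  also have "\<dots> = (LINT z|lborel. f z * \<bar>integral (cbox 0 1) (\<lambda>t. sympl_minor (z, t))\<bar>)"
  proof (rule Bochner_Integration.integral_cong[OF refl])
    fix z
    show "(LINT t|lborel. indicator ?S (z, t) *\<^sub>R (\<bar>sympl_minor (z, t)\<bar> * f (fst (z, t)))) =
       f z * \<bar>integral (cbox 0 1) (\<lambda>t. sympl_minor (z, t))\<bar>"
    proof (cases "z \<in> ball z0 r")
      case True
      have "(LINT t|lborel. indicator ?S (z, t) *\<^sub>R (\<bar>sympl_minor (z, t)\<bar> * f (fst (z, t)))) =
          (LINT t|lborel. f z * (indicator half_open_square t *\<^sub>R \<bar>sympl_minor (z, t)\<bar>))"
        using True by (intro Bochner_Integration.integral_cong[OF refl]) (simp add: indicator_def)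
      also have "\<dots> = f z * (LINT t:half_open_square|lborel. \<bar>sympl_minor (z, t)\<bar>)"
        by (simp add: set_lebesgue_integral_def)
      also have "\<dots> = f z * \<bar>integral (cbox 0 1) (\<lambda>t. sympl_minor (z, t))\<bar>"
        using continuous_on_sympl_minor_slice[OF True]
        by (subst integral_half_open_square) (auto intro!: continuous_intros simp: abs_integral_sympl_minor[OF True])
      finally show ?thesis .
    next
      case False
      then have "f z = 0" using supp sub by blast
      then show ?thesis by simp
    qed
  qed
  finally show ?thesis .
qed

end

section \<open>Comparison of the densities\<close>

lemma ck_on_subset: "ck_on k S f \<Longrightarrow> T \<subseteq> S \<Longrightarrow> ck_on k T f"
  by (induction k arbitrary: f) (auto intro: continuous_on_subset)

lemma smooth_on_subset: "smooth_on S f \<Longrightarrow> T \<subseteq> S \<Longrightarrow> smooth_on T f"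
  unfolding smooth_on_def using ck_on_subset by blast

lemma bounded_linear_cplx: "bounded_linear cplx"
proof -
  have "linear cplx"
    by (auto intro!: linearI simp: cplx_def vec_eq_iff complex_eq_iff)
  then show ?thesis by (simp add: linear_conv_bounded_linear)
qed

lemma holomorphic_phase_has_derivative_cplx:
  assumes "\<delta> > 0" "holomorphic_phase (tube \<delta>) p"
  shows "((\<lambda>\<rho>. p (cplx \<rho>)) has_derivative (\<lambda>v. frechet_derivative p (at (cplx \<rho>)) (cplx v))) (at \<rho>)"
proof -
  have "cplx \<rho> \<in> tube \<delta>" using assms(1) unfolding tube_def by (intro CollectI exI[of _ \<rho>]) simp
  then have "p differentiable (at (cplx \<rho>))"
    using assms(2) unfolding holomorphic_phase_def differentiable_def by blast
  then have "(p has_derivative frechet_derivative p (at (cplx \<rho>))) (at (cplx \<rho>))"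
    using frechet_derivative_works by blast
  from has_derivative_compose[OF bounded_linear_imp_has_derivative[OF bounded_linear_cplx] this]
  show ?thesis .
qed

text \<open>If \<open>d\<close> were positive at \<open>z0\<close>, it would be positive on a small
  ball. A nonnegative integrand with integral zero vanishes almost everywhere, yet on that ball both
  factors are positive. The one-sided form suits a difference and its negative alike.\<close>

lemma pos_if_bump_integrals_zero:
  fixes d :: "complex \<Rightarrow> real"
  assumes V: "open V" "z0 \<in> V" and d: "continuous_on V d" and r: "r > 0"
    and zero: "\<And>s. 0 < s \<Longrightarrow> s < r \<Longrightarrow> cball z0 s \<subseteq> V \<Longrightarrow>
      (LINT z|lborel. indicator (cball z0 s) z * (bump z0 s z * d z)) = 0"
  shows "d z0 \<le> 0"
proof (rule ccontr)
  assume "\<not> d z0 \<le> 0"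
  then have pos: "d z0 > 0" by simp
  have "d \<midarrow>z0\<rightarrow> d z0"
    using d V by (simp add: continuous_on_eq_continuous_at isCont_def)
  then have "\<forall>\<^sub>F z in at z0. d z > 0" by (rule order_tendstoD) (rule pos)
  then have "\<forall>\<^sub>F z in nhds z0. d z > 0"
    using pos by (simp add: eventually_nhds_conv_at)
  then have "\<forall>\<^sub>F z in nhds z0. d z > 0 \<and> z \<in> V"
    using eventually_nhds_in_open[OF V] by (rule eventually_conj)
  then obtain e where e: "e > 0" "\<And>z. dist z z0 < e \<Longrightarrow> d z > 0 \<and> z \<in> V"
    unfolding eventually_nhds_metric by blast
  \<comment> \<open>Below \<open>e\<close>, so that \<open>d\<close> is positive on the closed ball,
    and below \<open>r\<close>, where the integrals are known to vanish.\<close>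
  define s where "s = min e r / 2"
  have s: "s > 0" "s < r" "s < e" using e r by (auto simp: s_def)
  have ball: "d z > 0" "z \<in> V" if "z \<in> cball z0 s" for z
    using e(2)[of z] that s by (auto simp: dist_commute)
  let ?h = "\<lambda>z. indicator (cball z0 s) z * (bump z0 s z * d z)"
  have sub: "cball z0 s \<subseteq> V" using ball by blast
  have "integrable lborel (\<lambda>z. indicator (cball z0 s) z *\<^sub>R (bump z0 s z * d z))"
    by (rule borel_integrable_compact[OF compact_cball])
      (intro continuous_intros continuous_on_bump continuous_on_subset[OF d sub])
  then have int: "integrable lborel ?h" by simp
  have "AE z in lborel. ?h z = 0"
    using zero[OF s(1,2) sub] bump_nonneg ball(1)
    by (subst integral_nonneg_eq_0_iff_AE[OF int, symmetric])
      (auto simp: indicator_def intro!: AE_I2 mult_nonneg_nonneg intro: less_imp_le)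
  moreover have "?h z \<noteq> 0" if "z \<in> ball z0 s" for z
    using bump_pos_iff[OF s(1), of z0 z] that ball(1)[of z] by (auto simp: indicator_def)
  ultimately have "AE z in lborel. z \<notin> ball z0 s" by (auto elim!: eventually_mono)
  then have "ball z0 s \<in> null_sets lborel" by (subst AE_iff_null_sets) simp_all
  then have "negligible (ball z0 s)" by (simp add: negligible_iff_null_sets null_sets_completionI)
  then show False using open_not_negligible[of "ball z0 s"] s(1) by simp
qed

theorem mainTheorem2:
  fixes p :: "(complex^2) \<times> (complex^2) \<Rightarrow> complex"
    and V :: "complex set"
    and \<gamma>1 \<gamma>2 :: "complex \<Rightarrow> real \<Rightarrow> (real^2) \<times> (real^2)"
    and \<omega> w :: "complex \<Rightarrow> real"
  assumes holo: "\<exists>\<delta>>0. holomorphic_phase (tube \<delta>) p \<and> bounded (p ` tube \<delta>)"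
    and A1: "level_set p 0 \<noteq> {}" "connected (level_set p 0)"
    and A2: "\<exists>C>0. \<forall>\<rho>. norm \<rho> \<ge> C \<longrightarrow> norm (p (cplx \<rho>)) \<ge> 1 / C"
    and A3: "\<forall>\<rho>\<in>level_set p 0.
        independent_covectors (frechet_derivative (re_symbol p) (at \<rho>))
                              (frechet_derivative (im_symbol p) (at \<rho>))"
    and commute: "\<forall>\<rho>. poisson (re_symbol p) (im_symbol p) \<rho> = 0"
    and V: "open V" "0 \<in> V"
    and tori: "smooth_torus_family V (level_set p)"
    and cycles: "fundamental_cycles V (level_set p) \<gamma>1 \<gamma>2"
    and A5: "diffeo_on V ((\<lambda>z. (action (\<gamma>1 z), action (\<gamma>2 z))) ` V)
               (\<lambda>z. (action (\<gamma>1 z), action (\<gamma>2 z)))"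
    and omega: "spectral_density V (\<lambda>z. action (\<gamma>1 z)) (\<lambda>z. action (\<gamma>2 z)) \<omega>"
    and weyl: "weyl_density V p w"
  shows "\<forall>z\<in>V. w z = \<omega> z"
proof
  fix z0 assume z0: "z0 \<in> V"
  let ?q = "\<lambda>\<rho>. p (cplx \<rho>)"
  have level: "level_set p = (\<lambda>z. {\<rho>. ?q \<rho> = z})" by (simp add: level_set_def fun_eq_iff)
  obtain U \<Phi> where U: "open U" "z0 \<in> U" "U \<subseteq> V"
    and smooth: "smooth_on (U \<times> UNIV) (\<lambda>(z, t). \<Phi> z t)"
    and torus: "\<And>z. z \<in> U \<Longrightarrow> torus_embedding (\<Phi> z) (level_set p z)"
    using tori z0 unfolding smooth_torus_family_def by meson
  obtain r where r: "r > 0" "ball z0 r \<subseteq> U" using U openE by blast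
  obtain \<delta> where \<delta>: "\<delta> > 0" "holomorphic_phase (tube \<delta>) p" using holo by blast
  have "lagrangian_torus_chart ?q (\<lambda>\<rho> v. frechet_derivative p (at (cplx \<rho>)) (cplx v)) (\<lambda>(z, t). \<Phi> z t) z0 r"
  proof unfold_locales
    show "(?q has_derivative (\<lambda>v. frechet_derivative p (at (cplx \<rho>)) (cplx v))) (at \<rho>)" for \<rho>
      by (rule holomorphic_phase_has_derivative_cplx[OF \<delta>])
    show "smooth_on (ball z0 r \<times> UNIV) (\<lambda>(z, t). \<Phi> z t)"
      by (rule smooth_on_subset[OF smooth]) (use r in auto)
    show "torus_embedding (\<lambda>t. case (z, t) of (z, t) \<Rightarrow> \<Phi> z t) {\<rho>. ?q \<rho> = z}" if "z \<in> ball z0 r" for z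
      using torus[of z] that r(2) by (auto simp: level)
    show "poisson (\<lambda>\<rho>. Re (?q \<rho>)) (\<lambda>\<rho>. Im (?q \<rho>)) \<rho> = 0" for \<rho>
      using commute[rule_format, of \<rho>] by (simp add: re_symbol_def[abs_def] im_symbol_def[abs_def])
  qed (rule r)
  then interpret lagrangian_torus_chart ?q "\<lambda>\<rho> v. frechet_derivative p (at (cplx \<rho>)) (cplx v)" "\<lambda>(z, t). \<Phi> z t" z0 r .
  have sub: "ball z0 r \<subseteq> V" using r(2) U(3) by blast
  have \<omega>: "\<omega> z = \<bar>integral (cbox 0 1) (\<lambda>t. sympl_minor (z, t))\<bar>" if "z \<in> ball z0 r" for z
    unfolding sympl_minor_def using spectral_density_eq_integral[OF sub _ omega that] cycles level by simp
  have cont: "continuous_on V w" "continuous_on V \<omega>"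
    using weyl omega smooth_on_continuous_on unfolding weyl_density_def spectral_density_def by blast+
  \<comment> \<open>Both sides equal the phase space integral of the bump composed with the symbol:
    one by the defining identity of the Weyl density, the other by the torus chart.\<close>
  have eq: "(LINT z|lborel. indicator (cball z0 s) z * (bump z0 s z * w z)) =
      (LINT z|lborel. indicator (cball z0 s) z * (bump z0 s z * \<omega> z))" if s: "0 < s" "s < r" for s
  proof -
    have cb: "cball z0 s \<subseteq> ball z0 r" using s by auto
    have bump0: "bump z0 s z = 0" if "z \<notin> cball z0 s" for z
      using that bump_pos_iff[OF s(1), of z0 z] bump_nonneg[of z0 s z] by force
    have "test_function V (\<lambda>z. complex_of_real (bump z0 s z))"
      using cb sub by (intro test_function_bump s) auto
    then have "(LINT z:V|lborel. complex_of_real (bump z0 s z) * complex_of_real (w z)) =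
        (LINT \<rho>|lborel. complex_of_real (bump z0 s (?q \<rho>)))"
      using weyl unfolding weyl_density_def by blast
    moreover have "(LINT z:V|lborel. complex_of_real (bump z0 s z) * complex_of_real (w z)) =
        (LINT z|lborel. complex_of_real (indicator (cball z0 s) z * (bump z0 s z * w z)))"
      unfolding set_lebesgue_integral_def
      by (rule Bochner_Integration.integral_cong[OF refl])
        (use bump0 cb sub in \<open>auto simp: indicator_def\<close>)
    \<comment> \<open>Test functions are complex valued; injectivity of the embedding brings the
      identity back to real integrals.\<close>
    ultimately have "complex_of_real (LINT z|lborel. indicator (cball z0 s) z * (bump z0 s z * w z)) =
        complex_of_real (LINT \<rho>|lborel. bump z0 s (?q \<rho>))"
      by (simp only: integral_complex_of_real)
    then have "(LINT z|lborel. indicator (cball z0 s) z * (bump z0 s z * w z)) = (LINT \<rho>|lborel. bump z0 s (?q \<rho>))"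
      by (simp only: of_real_eq_iff)
    also have "\<dots> = (LINT z|lborel. bump z0 s z * \<bar>integral (cbox 0 1) (\<lambda>t. sympl_minor (z, t))\<bar>)"
      by (rule integral_symbol_pushforward[OF continuous_on_bump s(2) bump0])
    also have "\<dots> = (LINT z|lborel. indicator (cball z0 s) z * (bump z0 s z * \<omega> z))"
      by (rule Bochner_Integration.integral_cong[OF refl])
        (use bump0 cb \<omega> in \<open>auto simp: indicator_def\<close>)
    finally show ?thesis .
  qed
  have diff: "(LINT z|lborel. indicator (cball z0 s) z * (bump z0 s z * (f z - g z))) =
      (LINT z|lborel. indicator (cball z0 s) z * (bump z0 s z * f z)) -
      (LINT z|lborel. indicator (cball z0 s) z * (bump z0 s z * g z))"
    if f: "continuous_on V f" and g: "continuous_on V g" and cb: "cball z0 s \<subseteq> V" for f g :: "complex \<Rightarrow> real" and s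
  proof -
    have int: "integrable lborel (\<lambda>z. indicator (cball z0 s) z * (bump z0 s z * h z))"
      if "continuous_on V h" for h :: "complex \<Rightarrow> real"
      using borel_integrable_compact[OF compact_cball, of z0 s "\<lambda>z. bump z0 s z * h z"]
        continuous_on_mult[OF continuous_on_bump continuous_on_subset[OF that cb]] by simp
    show ?thesis
      by (subst Bochner_Integration.integral_diff[OF int[OF f] int[OF g], symmetric])
        (simp add: algebra_simps)
  qed
  \<comment> \<open>Continuity of both densities turns the equality of bump integrals into two
    opposite inequalities at the centre.\<close>
  have "w z0 - \<omega> z0 \<le> 0"
    by (rule pos_if_bump_integrals_zero[OF V(1) z0 _ r(1), where d = "\<lambda>z. w z - \<omega> z"])
      (use cont eq diff in \<open>auto intro!: continuous_intros\<close>)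
  moreover have "\<omega> z0 - w z0 \<le> 0"
    by (rule pos_if_bump_integrals_zero[OF V(1) z0 _ r(1), where d = "\<lambda>z. \<omega> z - w z"])
      (use cont eq diff in \<open>auto intro!: continuous_intros\<close>)
  ultimately show "w z0 = \<omega> z0" by simp
qed

end
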